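(* Let $\phi=\phi(t,z)=\phi_0(z)+\psi(t,z)$ be a smooth curve in $\mathcal{K}$, and write $\phi_t=\partial\phi/\partial t=\psi_t$. Then $$\mathcal{L}'.\phi_t=\int_Z\phi_t\,B_\phi e^{-\phi}\qquad\text{and}\qquad \frac{\partial^2}{\partial t\,\partial\bar t}\mathcal{L}(\phi(t,\cdot))=\operatorname{tr}\Theta^E .$$ Hence, for $\mu$ in the tangent space of $\mathcal{K}$ at $\phi$, $$\mathcal{L}''(\mu,\mu)=\operatorname{tr}A(\mu,\cdot),$$ the trace of the quadratic form $u\mapsto A(\mu,u)$ on $\hat E$ with respect to $H_\phi$.
   Context: $Z$ is a compact complex manifold of dimension $n$ and $\hat L$ a positive line bundle over $Z$. $\mathcal{K}$ is the space of smooth metrics $\phi$ on $\hat L$ (written additively, norm $|s|^2e^{-\phi}$) with $\omega^\phi:=i\partial\bar\partial\phi>0$; its tangent space at any point is the space of smooth real functions on $Z$. Curves in $\mathcal{K}$ are written $\phi(t,z)=\phi_0(z)+\psi(t,z)$ with $t$ a complex parameter in a domain $U$ (a strip), $\psi$ smooth, real and independent of $\mathrm{Im}\,t$. $\hat E=H^0(Z,\hat L\otimes K_Z)$, with the norm $H_\phi$ given for $\phi\in\mathcal{K}$ by $\|u\|^2=\int_Z[u,u]e^{-\phi}$, where locally $[u,u]e^{-\phi}=i^{n^2}u\wedge\bar u\,e^{-\phi}$. For a curve $\phi(t,\cdot)$, $E=U\times\hat E$ is the trivial holomorphic bundle with Hermitian metric $H_{\phi(t,\cdot)}$ and $\Theta^E$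 is its Chern curvature viewed as an endomorphism (coefficient of $dt\wedge d\bar t$). $B_\phi e^{-\phi}=\sum_j[u_j,u_j]e^{-\phi}$, with $(u_j)$ an $H_\phi$-orthonormal basis of $\hat E$. $\mathcal{L}(\phi)$ is the negative of the logarithm of the squared norm, for the metric on $\det\hat E$ induced by $H_\phi$, of a fixed nonzero element of $\det\hat E$. Equivalently $\mathcal{L}(\phi)=-\log\det(\langle h_j,h_k\rangle_{H_\phi})$ for a fixed basis $(h_j)$ of $\hat E$. For a smooth function $\mathcal{F}$ on $\mathcal{K}$, $\mathcal{F}'$ is its differential, $\frac{\partial}{\partial t}\mathcal{F}(\phi(t,\cdot))=\mathcal{F}'.\phi_t$, and the Hessian $\mathcal{F}''$ (a quadratic form on the tangent space) is defined by requiring, for curves, $$\frac{\partial^2}{\partial t\,\partial\bar t}\mathcal{F}(\phi(t,\cdot))=\mathcal{F}'.c(\phi)+\mathcal{F}''(\phi_t,\phi_{\bar t}),$$ where $c(\phi)=\psi_{t\bar t}-|\bar\partial_z\psi_t|^2_{\omega^\phi}$. The form $A$ at $\phi\in\mathcal{K}$: for a smooth function $\mu$ on $Z$ and $u\in\hat E$, set $f=\bar\partial\mu\wedge u$, let $v$ be the solution of $\bar\partial v=f$ of minimal $L^2$-norm among $\hat L$-valued $(n,0)$-forms, and put $A(\mu,u)=\|f\|^2-\|v\|^2$, the $L^2$-norms being defined by the metric $\phi$ on $\hat L$ and the Kähler metric $\omega^\phi$ on $Z$ (with $dz_j$ orthonormal when $\omega^\phi=i\sum dz_j\wedge d\bar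 z_j$ at the point, so that $\|v\|^2=\int_Z[v,v]e^{-\phi}$). *)

theory Defs
  imports "HOL-Analysis.Analysis" "Jordan_Normal_Form.Determinant"
begin

no_notation vec_index (infixl \<open>$\<close> 100)

section \<open>Smooth and holomorphic functions on open subsets of Euclidean space\<close>

text \<open>The definitions of this section are meant for open sets \<open>S\<close>.\<close>

fun Ck_on :: "nat \<Rightarrow> ('a::euclidean_space \<Rightarrow> 'b::real_normed_vector) \<Rightarrow> 'a set \<Rightarrow> bool" where
  "Ck_on 0 f S \<longleftrightarrow> continuous_on S f"
| "Ck_on (Suc k) f S \<longleftrightarrow> (\<forall>x\<in>S. f differentiable (at x)) \<and>
     (\<forall>v. Ck_on k (\<lambda>x. frechet_derivative f (at x) v) S)"

definition smooth_on :: "('a::euclidean_space \<Rightarrow> 'b::real_normed_vector) \<Rightarrow> 'a set \<Rightarrow> bool" where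
  "smooth_on f S \<longleftrightarrow> (\<forall>k. Ck_on k f S)"

text \<open>The Wirtinger derivatives \<open>\<partial>/\<partial>z\<^sub>k\<close> and \<open>\<partial>/\<partial>z\<^sub>k\<close>-bar on \<open>\<complex>\<^sup>n\<close>, and \<open>\<partial>/\<partial>t\<close>, \<open>\<partial>/\<partial>t\<close>-bar on \<open>\<complex>\<close>.\<close>

definition pd :: "'n::finite \<Rightarrow> (complex^'n \<Rightarrow> complex) \<Rightarrow> complex^'n \<Rightarrow> complex" where
  "pd k f x = (frechet_derivative f (at x) (axis k 1) - \<i> * frechet_derivative f (at x) (axis k \<i>)) / 2"

definition pdbar :: "'n::finite \<Rightarrow> (complex^'n \<Rightarrow> complex) \<Rightarrow> complex^'n \<Rightarrow> complex" where
  "pdbar k f x = (frechet_derivative f (at x) (axis k 1) + \<i> * frechet_derivative f (at x) (axis k \<i>)) / 2"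

definition dt :: "(complex \<Rightarrow> complex) \<Rightarrow> complex \<Rightarrow> complex" where
  "dt f t = (frechet_derivative f (at t) 1 - \<i> * frechet_derivative f (at t) \<i>) / 2"

definition dtbar :: "(complex \<Rightarrow> complex) \<Rightarrow> complex \<Rightarrow> complex" where
  "dtbar f t = (frechet_derivative f (at t) 1 + \<i> * frechet_derivative f (at t) \<i>) / 2"

definition holomorphic_in :: "(complex^'n::finite \<Rightarrow> complex) \<Rightarrow> (complex^'n) set \<Rightarrow> bool" where
  "holomorphic_in f S \<longleftrightarrow> smooth_on f S \<and> (\<forall>x\<in>S. \<forall>k. pdbar k f x = 0)"


section \<open>Complex manifolds and holomorphic line bundles\<close>

text \<open>
  The underlying space is the type \<open>'z\<close>; the charts \<open>z\<^sub>i : cdom i \<rightarrow> \<complex>\<^sup>n\<close>, \<open>n = CARD('n)\<close>, are indexed by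
  the type \<open>'i\<close>. A line bundle is given by its cocycle \<open>g\<^sub>i\<^sub>j\<close> with respect to the chart domains
  (the atlas being fine enough to trivialise the bundle): a section has local representatives
  with \<open>s\<^sub>i = g\<^sub>i\<^sub>j s\<^sub>j\<close>.
\<close>

record ('z, 'n::finite, 'i) atlas =
  cdom :: "'i \<Rightarrow> 'z set"
  chart :: "'i \<Rightarrow> 'z \<Rightarrow> complex^'n"

record ('z, 'n::finite, 'i) line_bundle = "('z, 'n, 'i) atlas" +
  cocycle :: "'i \<Rightarrow> 'i \<Rightarrow> 'z \<Rightarrow> complex"

definition chart_inv :: "('z, 'n::finite, 'i, 'm) atlas_scheme \<Rightarrow> 'i \<Rightarrow> complex^'n \<Rightarrow> 'z" where
  "chart_inv X i = inv_into (cdom X i) (chart X i)"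

definition complex_manifold :: "('z::t2_space, 'n::finite, 'i, 'm) atlas_scheme \<Rightarrow> bool" where
  "complex_manifold X \<longleftrightarrow>
     (\<Union>i. cdom X i) = UNIV \<and>
     (\<forall>i. open (cdom X i) \<and> open (chart X i ` cdom X i) \<and>
          homeomorphism (cdom X i) (chart X i ` cdom X i) (chart X i) (chart_inv X i)) \<and>
     (\<forall>i j k. holomorphic_in (\<lambda>x. chart X i (chart_inv X j x) $ k)
                (chart X j ` (cdom X i \<inter> cdom X j)))"

definition holomorphic_line_bundle :: "('z::t2_space, 'n::finite, 'i) line_bundle \<Rightarrow> bool" where
  "holomorphic_line_bundle X \<longleftrightarrow>
     (\<forall>i j. \<forall>p\<in>cdom X i \<inter> cdom X j. cocycle X i j p \<noteq> 0) \<and>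
     (\<forall>i j. holomorphic_in (\<lambda>x. cocycle X i j (chart_inv X j x))
              (chart X j ` (cdom X i \<inter> cdom X j))) \<and>
     (\<forall>i j k. \<forall>p\<in>cdom X i \<inter> cdom X j \<inter> cdom X k.
        cocycle X i j p * cocycle X j k p = cocycle X i k p)"

text \<open>Smooth real functions on \<open>Z\<close>: the tangent space of \<open>\<K>\<close>.\<close>

definition smooth_functions :: "('z, 'n::finite, 'i, 'm) atlas_scheme \<Rightarrow> ('z \<Rightarrow> real) set" where
  "smooth_functions X = {\<mu>. \<forall>i. smooth_on (\<lambda>x. \<mu> (chart_inv X i x)) (chart X i ` cdom X i)}"


section \<open>Metrics on the line bundle\<close>

text \<open>
  A metric is a family of weights \<open>\<phi>\<^sub>i\<close> such that \<open>|s|\<^sup>2 e\<^sup>-\<^sup>\<phi> = |s\<^sub>i|\<^sup>2 exp (-\<phi>\<^sub>i)\<close> is globally well defined.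
  The values of \<open>\<phi>\<^sub>i\<close> outside \<open>cdom i\<close> are irrelevant.
\<close>

type_synonym ('z, 'i) weight = "'i \<Rightarrow> 'z \<Rightarrow> real"

definition metrics :: "('z, 'n::finite, 'i) line_bundle \<Rightarrow> ('z, 'i) weight set" where
  "metrics X = {\<phi>.
     (\<forall>i. smooth_on (\<lambda>x. \<phi> i (chart_inv X i x)) (chart X i ` cdom X i)) \<and>
     (\<forall>i j. \<forall>p\<in>cdom X i \<inter> cdom X j. \<phi> i p = \<phi> j p + ln ((cmod (cocycle X i j p))\<^sup>2))}"

text \<open>The matrix \<open>(\<phi>\<^sub>j\<^sub>k)\<close> of \<open>\<omega>\<^sup>\<phi> = i \<Sum> \<phi>\<^sub>j\<^sub>k dz\<^sub>j \<and> dz\<^sub>k\<close>-bar in the chart \<open>i\<close>.\<close>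

definition levi :: "('z, 'n::finite, 'i, 'm) atlas_scheme \<Rightarrow> ('z, 'i) weight \<Rightarrow> 'i \<Rightarrow> 'z \<Rightarrow> complex^'n^'n" where
  "levi X \<phi> i p =
     (\<chi> j k. pd j (pdbar k (\<lambda>x. of_real (\<phi> i (chart_inv X i x)))) (chart X i p))"

definition pos_metrics :: "('z, 'n::finite, 'i) line_bundle \<Rightarrow> ('z, 'i) weight set" where
  "pos_metrics X = {\<phi> \<in> metrics X. \<forall>i. \<forall>p\<in>cdom X i. \<forall>w::complex^'n. w \<noteq> 0 \<longrightarrow>
     0 < Re (\<Sum>j\<in>UNIV. \<Sum>k\<in>UNIV. levi X \<phi> i p $ j $ k * w $ j * cnj (w $ k))}"

definition positive_line_bundle :: "('z::t2_space, 'n::finite, 'i) line_bundle \<Rightarrow> bool" where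
  "positive_line_bundle X \<longleftrightarrow> holomorphic_line_bundle X \<and> pos_metrics X \<noteq> {}"

definition shift :: "('z, 'i) weight \<Rightarrow> ('z \<Rightarrow> real) \<Rightarrow> ('z, 'i) weight" where
  "shift \<phi>0 \<mu> i p = \<phi>0 i p + \<mu> p"


section \<open>Integration of top degree forms\<close>

text \<open>
  A form of bidegree \<open>(n,n)\<close> is given by its coefficients \<open>\<rho>\<^sub>i\<close> with respect to
  \<open>i^(n^2) dz \<and> dz\<close>-bar \<open>= \<Prod>\<^sub>k i dz\<^sub>k \<and> dz\<^sub>k\<close>-bar, where \<open>dz = dz\<^sub>1 \<and> ... \<and> dz\<^sub>n\<close>, in the chart \<open>i\<close>.
  That form is \<open>2\<^sup>n\<close> times Lebesgue measure.
\<close>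

definition partition_of_unity :: "('z::t2_space, 'n::finite, 'i, 'm) atlas_scheme \<Rightarrow>
    'i set \<times> ('i \<Rightarrow> 'z \<Rightarrow> real) \<Rightarrow> bool" where
  "partition_of_unity X = (\<lambda>(F, \<eta>). finite F \<and>
     (\<forall>i\<in>F. continuous_on UNIV (\<eta> i) \<and> (\<forall>p. 0 \<le> \<eta> i p) \<and> closure {p. \<eta> i p \<noteq> 0} \<subseteq> cdom X i) \<and>
     (\<forall>p. (\<Sum>i\<in>F. \<eta> i p) = 1))"

definition form_integral :: "('z::t2_space, 'n::finite, 'i, 'm) atlas_scheme \<Rightarrow>
    ('i \<Rightarrow> 'z \<Rightarrow> complex) \<Rightarrow> complex" where
  "form_integral X \<rho> = (case (SOME P. partition_of_unity X P) of (F, \<eta>) \<Rightarrow>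
     \<Sum>i\<in>F. LINT x : chart X i ` cdom X i | lborel.
        2 ^ CARD('n) * of_real (\<eta> i (chart_inv X i x)) * \<rho> i (chart_inv X i x))"


section \<open>Forms with values in the line bundle\<close>

text \<open>
  An \<open>L\<close>-valued \<open>(n,0)\<close>-form is \<open>u = u\<^sub>i dz \<otimes> e\<^sub>i\<close> in the chart \<open>i\<close>, so its coefficients form a section of
  the line bundle with cocycle \<open>g\<^sub>i\<^sub>j det (\<partial>z\<^sub>j/\<partial>z\<^sub>i)\<close>. Coefficients vanish outside \<open>cdom i\<close> so that
  equality of forms is equality of functions. An \<open>L\<close>-valued \<open>(n,1)\<close>-form is given by its
  coefficients \<open>f\<^sub>i\<^sub>,\<^sub>k\<close> with respect to \<open>(dz\<^sub>k\<close>-bar\<open> \<and> dz) \<otimes> e\<^sub>i\<close>.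
\<close>

type_synonym ('z, 'i) n0form = "'i \<Rightarrow> 'z \<Rightarrow> complex"
type_synonym ('z, 'n, 'i) n1form = "'i \<Rightarrow> 'z \<Rightarrow> complex^'n"

definition jacobian :: "('z, 'n::finite, 'i, 'm) atlas_scheme \<Rightarrow> 'i \<Rightarrow> 'i \<Rightarrow> 'z \<Rightarrow> complex^'n^'n" where
  "jacobian X j i p = (\<chi> a b. pd b (\<lambda>x. chart X j (chart_inv X i x) $ a) (chart X i p))"

definition n0_forms :: "('z, 'n::finite, 'i) line_bundle \<Rightarrow> ('z, 'i) n0form set" where
  "n0_forms X = {u.
     (\<forall>i. smooth_on (\<lambda>x. u i (chart_inv X i x)) (chart X i ` cdom X i)) \<and>
     (\<forall>i j. \<forall>p\<in>cdom X i \<inter> cdom X j.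
        u i p = cocycle X i j p * Determinants.det (jacobian X j i p) * u j p) \<and>
     (\<forall>i. \<forall>p. p \<notin> cdom X i \<longrightarrow> u i p = 0)}"

text \<open>\<open>H\<^sup>0(Z, L \<otimes> K\<^sub>Z)\<close>\<close>

definition H0 :: "('z, 'n::finite, 'i) line_bundle \<Rightarrow> ('z, 'i) n0form set" where
  "H0 X = {u \<in> n0_forms X. \<forall>i. holomorphic_in (\<lambda>x. u i (chart_inv X i x)) (chart X i ` cdom X i)}"

definition dbar_form :: "('z, 'n::finite, 'i) line_bundle \<Rightarrow> ('z, 'i) n0form \<Rightarrow> ('z, 'n, 'i) n1form" where
  "dbar_form X v i p = (\<chi> k. pdbar k (\<lambda>x. v i (chart_inv X i x)) (chart X i p))"

definition dbar_fun :: "('z, 'n::finite, 'i, 'm) atlas_scheme \<Rightarrow> ('z \<Rightarrow> real) \<Rightarrow> 'i \<Rightarrow> 'z \<Rightarrow> complex^'n" where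
  "dbar_fun X \<mu> i p = (\<chi> k. pdbar k (\<lambda>x. of_real (\<mu> (chart_inv X i x))) (chart X i p))"

definition dbar_wedge :: "('z, 'n::finite, 'i) line_bundle \<Rightarrow> ('z \<Rightarrow> real) \<Rightarrow> ('z, 'i) n0form \<Rightarrow>
    ('z, 'n, 'i) n1form" where
  "dbar_wedge X \<mu> u i p = (\<chi> k. dbar_fun X \<mu> i p $ k * u i p)"

text \<open>
  The squared norm of the \<open>(0,1)\<close>-covector \<open>\<Sum> \<alpha>\<^sub>k dz\<^sub>k\<close>-bar for the Hermitian metric with matrix \<open>H\<close>,
  normalised so that the \<open>dz\<^sub>k\<close> are orthonormal when \<open>H\<close> is the identity.
\<close>

definition covector_sq :: "complex^'n^'n \<Rightarrow> complex^'n::finite \<Rightarrow> real" where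
  "covector_sq H \<alpha> = Re (\<Sum>j\<in>UNIV. \<Sum>k\<in>UNIV. matrix_inv H $ k $ j * \<alpha> $ k * cnj (\<alpha> $ j))"

text \<open>The Hermitian form \<open>\<integral> [u,v] e\<^sup>-\<^sup>\<phi>\<close>; on \<open>H0 X\<close> this is \<open>H\<^sub>\<phi>\<close>.\<close>

definition ip :: "('z::t2_space, 'n::finite, 'i) line_bundle \<Rightarrow> ('z, 'i) weight \<Rightarrow>
    ('z, 'i) n0form \<Rightarrow> ('z, 'i) n0form \<Rightarrow> complex" where
  "ip X \<phi> u v = form_integral X (\<lambda>i p. u i p * cnj (v i p) * of_real (exp (- \<phi> i p)))"

definition norm_sq_n0 :: "('z::t2_space, 'n::finite, 'i) line_bundle \<Rightarrow> ('z, 'i) weight \<Rightarrow>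
    ('z, 'i) n0form \<Rightarrow> real" where
  "norm_sq_n0 X \<phi> u = Re (ip X \<phi> u u)"

text \<open>
  The \<open>L\<^sup>2\<close>-norm of \<open>(n,1)\<close>-forms: the first factor is the pointwise squared norm for \<open>\<omega>\<^sup>\<phi>\<close> and \<open>\<phi>\<close>, where
  \<open>|dz|\<^sup>2 = 1 / det (\<phi>\<^sub>j\<^sub>k)\<close>; the second factor is the coefficient of the volume form \<open>(\<omega>\<^sup>\<phi>)\<^sup>n / n!\<close>.
\<close>

definition norm_sq_n1 :: "('z::t2_space, 'n::finite, 'i) line_bundle \<Rightarrow> ('z, 'i) weight \<Rightarrow>
    ('z, 'n, 'i) n1form \<Rightarrow> real" where
  "norm_sq_n1 X \<phi> f = Re (form_integral X (\<lambda>i p.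
     (of_real (covector_sq (levi X \<phi> i p) (f i p)) / Determinants.det (levi X \<phi> i p)
        * of_real (exp (- \<phi> i p)))
     * Determinants.det (levi X \<phi> i p)))"


section \<open>The form \<open>A\<close>\<close>

definition dbar_solutions :: "('z::t2_space, 'n::finite, 'i) line_bundle \<Rightarrow> ('z, 'n, 'i) n1form \<Rightarrow>
    ('z, 'i) n0form set" where
  "dbar_solutions X f = {v \<in> n0_forms X. \<forall>i. \<forall>p\<in>cdom X i. dbar_form X v i p = f i p}"

definition minimal_solution :: "('z::t2_space, 'n::finite, 'i) line_bundle \<Rightarrow> ('z, 'i) weight \<Rightarrow>
    ('z, 'n, 'i) n1form \<Rightarrow> ('z, 'i) n0form" where
  "minimal_solution X \<phi> f = (THE v. v \<in> dbar_solutions X f \<and>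
     (\<forall>w\<in>dbar_solutions X f. norm_sq_n0 X \<phi> v \<le> norm_sq_n0 X \<phi> w))"

definition form_A :: "('z::t2_space, 'n::finite, 'i) line_bundle \<Rightarrow> ('z, 'i) weight \<Rightarrow>
    ('z \<Rightarrow> real) \<Rightarrow> ('z, 'i) n0form \<Rightarrow> real" where
  "form_A X \<phi> \<mu> u = norm_sq_n1 X \<phi> (dbar_wedge X \<mu> u)
     - norm_sq_n0 X \<phi> (minimal_solution X \<phi> (dbar_wedge X \<mu> u))"


section \<open>Bases, Bergman kernel and the functional \<open>\<L>\<close>\<close>

definition lin_comb :: "nat \<Rightarrow> (nat \<Rightarrow> ('z, 'i) n0form) \<Rightarrow> (nat \<Rightarrow> complex) \<Rightarrow> ('z, 'i) n0form" where
  "lin_comb N h c = (\<lambda>i p. \<Sum>j<N. c j * h j i p)"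

definition is_basis :: "('z, 'n::finite, 'i) line_bundle \<Rightarrow> nat \<Rightarrow> (nat \<Rightarrow> ('z, 'i) n0form) \<Rightarrow> bool" where
  "is_basis X N h \<longleftrightarrow> (\<forall>j<N. h j \<in> H0 X) \<and>
     (\<forall>u\<in>H0 X. \<exists>!c. (\<forall>j\<ge>N. c j = 0) \<and> u = lin_comb N h c)"

definition orthonormal_basis :: "('z::t2_space, 'n::finite, 'i) line_bundle \<Rightarrow> ('z, 'i) weight \<Rightarrow>
    nat \<Rightarrow> (nat \<Rightarrow> ('z, 'i) n0form) \<Rightarrow> bool" where
  "orthonormal_basis X \<phi> N u \<longleftrightarrow> is_basis X N u \<and>
     (\<forall>j<N. \<forall>k<N. ip X \<phi> (u j) (u k) = (if j = k then 1 else 0))"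

text \<open>\<open>B\<^sub>\<phi> e\<^sup>-\<^sup>\<phi>\<close>, computed with the orthonormal basis \<open>u\<close>.\<close>

definition bergman :: "('z, 'i) weight \<Rightarrow> nat \<Rightarrow> (nat \<Rightarrow> ('z, 'i) n0form) \<Rightarrow> 'i \<Rightarrow> 'z \<Rightarrow> complex" where
  "bergman \<phi> N u i p = (\<Sum>j<N. u j i p * cnj (u j i p) * of_real (exp (- \<phi> i p)))"

text \<open>
  The Gram determinant is the squared norm of \<open>h\<^sub>0 \<and> ... \<and> h\<^sub>N\<^sub>-\<^sub>1\<close> in \<open>det H\<^sup>0\<close>; it is real and positive
  for a basis \<open>h\<close>.
\<close>

definition functional_L :: "('z::t2_space, 'n::finite, 'i) line_bundle \<Rightarrow> nat \<Rightarrow>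
    (nat \<Rightarrow> ('z, 'i) n0form) \<Rightarrow> ('z, 'i) weight \<Rightarrow> real" where
  "functional_L X N h \<phi> =
     - ln (Re (Determinant.det (Matrix.mat N N (\<lambda>(j, k). ip X \<phi> (h j) (h k)))))"

text \<open>Trace of an endomorphism of \<open>H0 X\<close>, computed in the basis \<open>h\<close>.\<close>

definition coord :: "nat \<Rightarrow> (nat \<Rightarrow> ('z, 'i) n0form) \<Rightarrow> ('z, 'i) n0form \<Rightarrow> nat \<Rightarrow> complex" where
  "coord N h u = (THE c. (\<forall>j\<ge>N. c j = 0) \<and> u = lin_comb N h c)"

definition endo_trace :: "nat \<Rightarrow> (nat \<Rightarrow> ('z, 'i) n0form) \<Rightarrow> (('z, 'i) n0form \<Rightarrow> ('z, 'i) n0form) \<Rightarrow> complex" where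
  "endo_trace N h T = (\<Sum>j<N. coord N h (T (h j)) j)"


section \<open>Curves of metrics and Chern curvature\<close>

definition strip :: "complex set \<Rightarrow> bool" where
  "strip U \<longleftrightarrow> (\<exists>J. open J \<and> is_interval J \<and> J \<noteq> {} \<and> U = {t. Re t \<in> J})"

definition curve :: "('z::t2_space, 'n::finite, 'i) line_bundle \<Rightarrow> complex set \<Rightarrow> ('z, 'i) weight \<Rightarrow>
    (complex \<Rightarrow> 'z \<Rightarrow> real) \<Rightarrow> bool" where
  "curve X U \<phi>0 \<psi> \<longleftrightarrow> strip U \<and> \<phi>0 \<in> metrics X \<and>
     (\<forall>i. smooth_on (\<lambda>(t, x). \<psi> t (chart_inv X i x)) (U \<times> chart X i ` cdom X i)) \<and>
     (\<forall>t\<in>U. \<forall>t'\<in>U. Re t = Re t' \<longrightarrow> \<psi> t = \<psi> t') \<and>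
     (\<forall>t\<in>U. shift \<phi>0 (\<psi> t) \<in> pos_metrics X)"

text \<open>\<open>\<phi>\<^sub>t\<close>, its conjugate and \<open>c(\<phi>)\<close>; the derivatives are real because \<open>\<psi>\<close> does not depend on \<open>Im t\<close>.\<close>

definition vel :: "(complex \<Rightarrow> 'z \<Rightarrow> real) \<Rightarrow> complex \<Rightarrow> 'z \<Rightarrow> real" where
  "vel \<psi> t p = Re (dt (\<lambda>\<tau>. of_real (\<psi> \<tau> p)) t)"

definition vel_bar :: "(complex \<Rightarrow> 'z \<Rightarrow> real) \<Rightarrow> complex \<Rightarrow> 'z \<Rightarrow> real" where
  "vel_bar \<psi> t p = Re (dtbar (\<lambda>\<tau>. of_real (\<psi> \<tau> p)) t)"

definition dbar_sq :: "('z, 'n::finite, 'i, 'm) atlas_scheme \<Rightarrow> ('z, 'i) weight \<Rightarrow> ('z \<Rightarrow> real) \<Rightarrow> 'z \<Rightarrow> real" where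
  "dbar_sq X \<phi> \<mu> p =
     (let i = SOME i. p \<in> cdom X i in covector_sq (levi X \<phi> i p) (dbar_fun X \<mu> i p))"

definition geodesic_c :: "('z, 'n::finite, 'i, 'm) atlas_scheme \<Rightarrow> ('z, 'i) weight \<Rightarrow>
    (complex \<Rightarrow> 'z \<Rightarrow> real) \<Rightarrow> complex \<Rightarrow> 'z \<Rightarrow> real" where
  "geodesic_c X \<phi>0 \<psi> t p = Re (dt (dtbar (\<lambda>\<tau>. of_real (\<psi> \<tau> p))) t)
     - dbar_sq X (shift \<phi>0 (\<psi> t)) (vel \<psi> t) p"

text \<open>
  The \<open>(1,0)\<close>-part of the Chern connection on the trivial bundle with fibre \<open>H0 X\<close> and metrics
  \<open>H\<close> for the weights \<open>\<phi>(t)\<close>: metric compatibility against constant (hence holomorphic) sections \<open>v\<close> reads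
  \<open>\<partial>/\<partial>t \<langle>s,v\<rangle> = \<langle>D\<^sub>t s,v\<rangle>\<close>. The \<open>(0,1)\<close>-part is \<open>\<partial>/\<partial>t\<close>-bar, and the coefficient of \<open>dt \<and> dt\<close>-bar in the
  curvature is the commutator of the two. It is tensorial, so it is evaluated on the constant section \<open>u\<close>.
\<close>

definition chern_D :: "('z::t2_space, 'n::finite, 'i) line_bundle \<Rightarrow> (complex \<Rightarrow> ('z, 'i) weight) \<Rightarrow>
    (complex \<Rightarrow> ('z, 'i) n0form) \<Rightarrow> complex \<Rightarrow> ('z, 'i) n0form" where
  "chern_D X \<phi> s t = (THE w. w \<in> H0 X \<and>
     (\<forall>v\<in>H0 X. ip X (\<phi> t) w v = dt (\<lambda>\<tau>. ip X (\<phi> \<tau>) (s \<tau>) v) t))"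

definition dtbar_section :: "(complex \<Rightarrow> ('z, 'i) n0form) \<Rightarrow> complex \<Rightarrow> ('z, 'i) n0form" where
  "dtbar_section s t = (\<lambda>i p. dtbar (\<lambda>\<tau>. s \<tau> i p) t)"

definition chern_curvature :: "('z::t2_space, 'n::finite, 'i) line_bundle \<Rightarrow> (complex \<Rightarrow> ('z, 'i) weight) \<Rightarrow>
    complex \<Rightarrow> ('z, 'i) n0form \<Rightarrow> ('z, 'i) n0form" where
  "chern_curvature X \<phi> t u = (\<lambda>i p.
     chern_D X \<phi> (dtbar_section (\<lambda>_. u)) t i p - dtbar_section (chern_D X \<phi> (\<lambda>_. u)) t i p)"


section \<open>Differential and Hessian of a function on \<open>\<K>\<close>\<close>

definition has_differential :: "('z::t2_space, 'n::finite, 'i) line_bundle \<Rightarrow> (('z, 'i) weight \<Rightarrow> real) \<Rightarrow>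
    ('z, 'i) weight \<Rightarrow> (('z \<Rightarrow> real) \<Rightarrow> real) \<Rightarrow> bool" where
  "has_differential X F \<phi> D \<longleftrightarrow>
     (\<forall>\<mu>\<in>smooth_functions X. \<forall>\<nu>\<in>smooth_functions X. \<forall>a b.
        D (\<lambda>p. a * \<mu> p + b * \<nu> p) = a * D \<mu> + b * D \<nu>) \<and>
     (\<forall>U \<phi>0 \<psi>. \<forall>t\<in>U. curve X U \<phi>0 \<psi> \<longrightarrow> shift \<phi>0 (\<psi> t) = \<phi> \<longrightarrow>
        (\<lambda>\<tau>. F (shift \<phi>0 (\<psi> \<tau>))) differentiable (at t) \<and>
        dt (\<lambda>\<tau>. of_real (F (shift \<phi>0 (\<psi> \<tau>)))) t = of_real (D (vel \<psi> t)))"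

text \<open>
  For \<open>\<phi>\<close> in \<open>pos_metrics X\<close> the conditions determine the values on smooth functions uniquely (every
  smooth function is the velocity of a curve through \<open>\<phi>\<close>); the same holds for \<open>hessian\<close> below.
\<close>

definition differential :: "('z::t2_space, 'n::finite, 'i) line_bundle \<Rightarrow> (('z, 'i) weight \<Rightarrow> real) \<Rightarrow>
    ('z, 'i) weight \<Rightarrow> ('z \<Rightarrow> real) \<Rightarrow> real" where
  "differential X F \<phi> = (SOME D. has_differential X F \<phi> D)"

definition has_hessian :: "('z::t2_space, 'n::finite, 'i) line_bundle \<Rightarrow> (('z, 'i) weight \<Rightarrow> real) \<Rightarrow>
    ('z, 'i) weight \<Rightarrow> (('z \<Rightarrow> real) \<Rightarrow> ('z \<Rightarrow> real) \<Rightarrow> real) \<Rightarrow> bool" where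
  "has_hessian X F \<phi> Q \<longleftrightarrow>
     (\<forall>\<mu>\<in>smooth_functions X. \<forall>\<nu>\<in>smooth_functions X. Q \<mu> \<nu> = Q \<nu> \<mu>) \<and>
     (\<forall>\<mu>\<in>smooth_functions X. \<forall>\<nu>\<in>smooth_functions X. \<forall>\<kappa>\<in>smooth_functions X. \<forall>a b.
        Q (\<lambda>p. a * \<mu> p + b * \<nu> p) \<kappa> = a * Q \<mu> \<kappa> + b * Q \<nu> \<kappa>) \<and>
     (\<forall>U \<phi>0 \<psi>. \<forall>t\<in>U. curve X U \<phi>0 \<psi> \<longrightarrow> shift \<phi>0 (\<psi> t) = \<phi> \<longrightarrow>
        dtbar (\<lambda>\<tau>. of_real (F (shift \<phi>0 (\<psi> \<tau>)))) differentiable (at t) \<and>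
        dt (dtbar (\<lambda>\<tau>. of_real (F (shift \<phi>0 (\<psi> \<tau>))))) t =
          of_real (differential X F \<phi> (geodesic_c X \<phi>0 \<psi> t) + Q (vel \<psi> t) (vel_bar \<psi> t)))"

definition hessian :: "('z::t2_space, 'n::finite, 'i) line_bundle \<Rightarrow> (('z, 'i) weight \<Rightarrow> real) \<Rightarrow>
    ('z, 'i) weight \<Rightarrow> ('z \<Rightarrow> real) \<Rightarrow> ('z \<Rightarrow> real) \<Rightarrow> real" where
  "hessian X F \<phi> = (SOME Q. has_hessian X F \<phi> Q)"

end

theory Submission
  imports Defs
begin

text \<open>
  Fix a basis \<open>h\<close> and let \<open>G = (\<langle>h\<^sub>j, h\<^sub>k\<rangle>)\<close> be its Gram matrix along a curve of metrics. Since \<open>\<psi>\<close> does not depend on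
  \<open>Im t\<close>, everything is a function of the one real variable \<open>Re t\<close> and \<open>\<partial>\<^sub>t\<close>, \<open>\<partial>\<^sub>t\<close>-bar both act as half the real
  derivative (lemma \<open>dt_Re_part\<close>). Differentiation under the integral sign (\<open>ip_curve_derivative\<close>) and Jacobi's formula
  give \<open>\<partial>\<L> = - tr (G\<^sup>-\<^sup>1 \<partial>G)\<close> (\<open>functional_L_derivative\<close>). The Chern connection form is \<open>\<partial>\<^sub>tG G\<^sup>-\<^sup>1\<close>, so the second claim is this
  formula differentiated once more (\<open>trace_chern_curvature\<close>).

  Changing the basis changes \<open>\<L>\<close> by a constant only, so at a given point \<open>h\<close> may be replaced by a basis \<open>u\<close> that is
  orthonormal there (it exists by Gram-Schmidt, \<open>ex_orthonormal_basis\<close>). Then \<open>G = 1\<close> at that point, the first derivative becomes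
  \<open>\<Sum>\<^sub>j \<integral> \<phi>\<^sub>t |u\<^sub>j|\<^sup>2 e\<^sup>-\<^sup>\<phi>\<close>, and the second derivative becomes
  \<open>\<Sum>\<^sub>j (\<integral> \<psi>\<^sub>t\<^sub>t |u\<^sub>j|\<^sup>2 e\<^sup>-\<^sup>\<phi> - \<parallel>\<phi>\<^sub>t u\<^sub>j\<parallel>\<^sup>2 + \<Sum>\<^sub>k |\<langle>\<phi>\<^sub>t u\<^sub>j, u\<^sub>k\<rangle>|\<^sup>2)\<close>, where the second index \<open>t\<close> of \<open>\<psi>\<close> is conjugate. Subtracting
  \<open>\<L>'.c(\<phi>)\<close> replaces the first term by the squared norm of \<open>\<partial>\<phi>\<^sub>t \<and> u\<^sub>j\<close> (with \<open>\<partial>\<close>-bar). The solutions of the equation defining \<open>A\<close> are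
  \<open>\<mu>u\<close> plus holomorphic sections, so the minimal solution is \<open>\<mu>u\<close> minus its orthogonal projection to \<open>H0\<close>, and its squared
  norm is what the two remaining terms subtract (\<open>minimal_solution_eq\<close>).

  The differential and the Hessian are chosen among all forms that satisfy the curve equations. To evaluate the chosen
  ones, two facts about \<open>\<K>\<close> are needed: \<open>c(\<phi>)\<close> is a smooth function, and every smooth function is the velocity of a curve
  through every point of \<open>\<K>\<close> (\<open>ex_curve_velocity\<close>). Both rest on the transformation law of the Levi form under a change of chart
  (\<open>levi_transform\<close>): it makes \<open>|\<partial>\<mu>|\<^sup>2\<close> independent of the chart, and it reduces positivity in infinitely many charts to
  finitely many compact sets.
\<close>

section \<open>Calculus of smooth functions\<close>

lemma Ck_on_cong_open:
  assumes "open S" and "\<And>x. x \<in> S \<Longrightarrow> f x = g x" and "Ck_on k f S"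
  shows "Ck_on k g S"
  using assms(2,3)
proof (induction k arbitrary: f g)
  case 0
  then show ?case by (simp cong: continuous_on_cong)
next
  case (Suc k)
  have d: "f differentiable at x" if "x \<in> S" for x using Suc.prems that by simp
  have fd: "frechet_derivative f (at x) = frechet_derivative g (at x)" if "x \<in> S" for x
    by (rule frechet_derivative_transform_within_open[OF d[OF that] \<open>open S\<close> that]) (use Suc.prems in auto)
  have "g differentiable at x" if "x \<in> S" for x
    using d[OF that] Suc.prems(1) that \<open>open S\<close> unfolding differentiable_def
    by (meson has_derivative_transform_within_open)
  moreover have "Ck_on k (\<lambda>x. frechet_derivative g (at x) v) S" for v
    by (rule Suc.IH[of "\<lambda>x. frechet_derivative f (at x) v"]) (use Suc.prems fd in auto)
  ultimately show ?case by simp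
qed

text \<open>
  The definition speaks of \<^const>\<open>frechet_derivative\<close>; any family of derivatives on an open set will do.
\<close>

lemma Ck_on_SucI:
  assumes "open S" and D: "\<And>x. x \<in> S \<Longrightarrow> (f has_derivative D x) (at x)"
    and "\<And>v. Ck_on k (\<lambda>x. D x v) S"
  shows "Ck_on (Suc k) f S"
proof -
  have "f differentiable at x" if "x \<in> S" for x
    using D[OF that] differentiableI by blast
  moreover have "Ck_on k (\<lambda>x. frechet_derivative f (at x) v) S" for v
    by (rule Ck_on_cong_open[OF assms(1) _ assms(3)[of v]]) (simp flip: frechet_derivative_at[OF D])
  ultimately show ?thesis by simp
qed

lemma Ck_on_SucD:
  assumes "Ck_on (Suc k) f S" "x \<in> S"
  shows "(f has_derivative frechet_derivative f (at x)) (at x)"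
  using assms by (simp flip: frechet_derivative_works)

lemma Ck_on_antimono_Suc: "Ck_on (Suc k) f S \<Longrightarrow> Ck_on k f S"
proof (induction k arbitrary: f)
  case 0
  then show ?case
    by (auto intro!: continuous_at_imp_continuous_on differentiable_imp_continuous_within)
next
  case (Suc k)
  then show ?case by simp
qed

lemma Ck_on_bounded_linear:
  assumes "open S" "bounded_linear L"
  shows "Ck_on k f S \<Longrightarrow> Ck_on k (\<lambda>x. L (f x)) S"
proof (induction k arbitrary: f)
  case 0
  then show ?case using assms by (auto intro: bounded_linear.continuous_on)
next
  case (Suc k)
  show ?case
    by (rule Ck_on_SucI[OF assms(1), of _ "\<lambda>x v. L (frechet_derivative f (at x) v)"])
      (use Suc Ck_on_SucD[OF Suc.prems] in \<open>auto intro!: bounded_linear.has_derivative[OF assms(2)]\<close>)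
qed

lemma Ck_on_add:
  assumes "open S"
  shows "Ck_on k f S \<Longrightarrow> Ck_on k g S \<Longrightarrow> Ck_on k (\<lambda>x. f x + g x) S"
proof (induction k arbitrary: f g)
  case 0
  then show ?case by (auto intro: continuous_intros)
next
  case (Suc k)
  show ?case
    by (rule Ck_on_SucI[OF assms, of _ "\<lambda>x v. frechet_derivative f (at x) v + frechet_derivative g (at x) v"])
      (use Suc Ck_on_SucD[OF Suc.prems(1)] Ck_on_SucD[OF Suc.prems(2)] in \<open>auto intro!: has_derivative_add\<close>)
qed

lemma Ck_on_mult:
  fixes f g :: "'a::euclidean_space \<Rightarrow> 'b::real_normed_algebra"
  assumes "open S"
  shows "Ck_on k f S \<Longrightarrow> Ck_on k g S \<Longrightarrow> Ck_on k (\<lambda>x. f x * g x) S"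
proof (induction k arbitrary: f g)
  case 0
  then show ?case by (auto intro: continuous_intros)
next
  case (Suc k)
  have "Ck_on k f S" "Ck_on k g S" using Suc.prems Ck_on_antimono_Suc by blast+
  show ?case
    by (rule Ck_on_SucI[OF assms, of _
          "\<lambda>x v. f x * frechet_derivative g (at x) v + frechet_derivative f (at x) v * g x"])
      (use Suc \<open>Ck_on k f S\<close> \<open>Ck_on k g S\<close> Ck_on_SucD[OF Suc.prems(1)] Ck_on_SucD[OF Suc.prems(2)]
        in \<open>auto intro!: has_derivative_mult Ck_on_add assms\<close>)
qed

lemma Ck_on_inverse:
  fixes f :: "'a::euclidean_space \<Rightarrow> 'b::real_normed_field"
  assumes "open S" and nz: "\<And>x. x \<in> S \<Longrightarrow> f x \<noteq> 0"
  shows "Ck_on k f S \<Longrightarrow> Ck_on k (\<lambda>x. inverse (f x)) S"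
proof (induction k)
  case 0
  then show ?case using nz by (auto intro: continuous_intros)
next
  case (Suc k)
  have IH: "Ck_on k (\<lambda>x. inverse (f x)) S" using Suc Ck_on_antimono_Suc by blast
  have D: "Ck_on k (\<lambda>x. - (frechet_derivative f (at x) v)) S" for v
    by (rule Ck_on_bounded_linear[OF assms(1)]) (use Suc.prems bounded_linear_minus[OF bounded_linear_ident] in auto)
  show ?case
  proof (rule Ck_on_SucI[OF assms(1)])
    show "((\<lambda>x. inverse (f x)) has_derivative
        (\<lambda>v. - (inverse (f x) * frechet_derivative f (at x) v * inverse (f x)))) (at x)" if "x \<in> S" for x
      by (rule Deriv.has_derivative_inverse[OF nz Ck_on_SucD[OF Suc.prems]]) (use that in auto)
    show "Ck_on k (\<lambda>x. - (inverse (f x) * frechet_derivative f (at x) v * inverse (f x))) S" for v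
      using Ck_on_mult[OF assms(1) Ck_on_mult[OF assms(1) IH D[of v]] IH] by simp
  qed
qed

lemma Ck_on_const: "Ck_on k (\<lambda>x. c) S"
  by (induction k arbitrary: c) auto

lemma Ck_on_affine:
  assumes "open S" "open T" "bounded_linear L" and LT: "\<And>y. y \<in> T \<Longrightarrow> c + L y \<in> S"
  shows "Ck_on k f S \<Longrightarrow> Ck_on k (\<lambda>y. f (c + L y)) T"
proof (induction k arbitrary: f)
  case 0
  have "continuous_on T (\<lambda>y. c + L y)"
    by (intro continuous_intros bounded_linear.continuous_on[OF assms(3)])
  then show ?case using 0 LT
    by (auto intro: continuous_on_compose2[of S f])
next
  case (Suc k)
  show ?case
  proof (rule Ck_on_SucI[OF assms(2)])
    fix y assume y: "y \<in> T"
    have L: "((\<lambda>y. c + L y) has_derivative L) (at y)"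
      by (auto intro!: derivative_eq_intros bounded_linear_imp_has_derivative assms(3))
    show "((\<lambda>y. f (c + L y)) has_derivative (\<lambda>v. frechet_derivative f (at (c + L y)) (L v))) (at y)"
      using diff_chain_at[OF L Ck_on_SucD[OF Suc.prems LT[OF y]]] by (simp add: o_def)
  next
    show "Ck_on k (\<lambda>x. frechet_derivative f (at (c + L x)) (L v)) T" for v
      by (rule Suc.IH) (use Suc.prems in auto)
  qed
qed

lemma smooth_on_cong_open:
  "open S \<Longrightarrow> (\<And>x. x \<in> S \<Longrightarrow> f x = g x) \<Longrightarrow> smooth_on f S \<Longrightarrow> smooth_on g S"
  unfolding smooth_on_def using Ck_on_cong_open by blast

lemma smooth_on_const: "smooth_on (\<lambda>x. c) S"
  by (simp add: smooth_on_def Ck_on_const)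

lemma smooth_on_bounded_linear:
  "open S \<Longrightarrow> bounded_linear L \<Longrightarrow> smooth_on f S \<Longrightarrow> smooth_on (\<lambda>x. L (f x)) S"
  by (simp add: smooth_on_def Ck_on_bounded_linear)

lemma smooth_on_add: "open S \<Longrightarrow> smooth_on f S \<Longrightarrow> smooth_on g S \<Longrightarrow> smooth_on (\<lambda>x. f x + g x) S"
  by (simp add: smooth_on_def Ck_on_add)

lemma smooth_on_minus: "open S \<Longrightarrow> smooth_on f S \<Longrightarrow> smooth_on (\<lambda>x. - f x) S"
  by (rule smooth_on_bounded_linear[of S "\<lambda>x. - x"]) (auto intro: bounded_linear_minus[OF bounded_linear_ident])

lemma smooth_on_diff: "open S \<Longrightarrow> smooth_on f S \<Longrightarrow> smooth_on g S \<Longrightarrow> smooth_on (\<lambda>x. f x - g x) S"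
  using smooth_on_add[of S f "\<lambda>x. - g x"] smooth_on_minus[of S g] by simp

lemma smooth_on_mult:
  fixes f g :: "'a::euclidean_space \<Rightarrow> 'b::real_normed_algebra"
  shows "open S \<Longrightarrow> smooth_on f S \<Longrightarrow> smooth_on g S \<Longrightarrow> smooth_on (\<lambda>x. f x * g x) S"
  by (simp add: smooth_on_def Ck_on_mult)

lemma smooth_on_divide:
  fixes f g :: "'a::euclidean_space \<Rightarrow> 'b::real_normed_field"
  shows "open S \<Longrightarrow> (\<And>x. x \<in> S \<Longrightarrow> g x \<noteq> 0) \<Longrightarrow> smooth_on f S \<Longrightarrow> smooth_on g S \<Longrightarrow>
    smooth_on (\<lambda>x. f x / g x) S"
  by (simp add: smooth_on_def Ck_on_mult Ck_on_inverse divide_inverse)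

lemma smooth_on_cnj: "open S \<Longrightarrow> smooth_on f S \<Longrightarrow> smooth_on (\<lambda>x. cnj (f x)) S"
  by (rule smooth_on_bounded_linear) (auto intro: bounded_linear_cnj)

lemma smooth_on_of_real:
  "open S \<Longrightarrow> smooth_on f S \<Longrightarrow> smooth_on (\<lambda>x. of_real (f x) :: 'b::{real_normed_algebra_1}) S"
  by (rule smooth_on_bounded_linear) (auto intro: bounded_linear_of_real)

lemma smooth_on_Re: "open S \<Longrightarrow> smooth_on f S \<Longrightarrow> smooth_on (\<lambda>x. Re (f x)) S"
  by (rule smooth_on_bounded_linear) (auto intro: bounded_linear_Re)

lemma smooth_on_sum:
  "open S \<Longrightarrow> (\<And>i. i \<in> I \<Longrightarrow> smooth_on (f i) S) \<Longrightarrow> smooth_on (\<lambda>x. \<Sum>i\<in>I. f i x) S"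
  by (induction I rule: infinite_finite_induct) (auto simp: smooth_on_const intro!: smooth_on_add)

lemma smooth_on_prod:
  fixes f :: "'i \<Rightarrow> 'a::euclidean_space \<Rightarrow> 'b::real_normed_field"
  shows "open S \<Longrightarrow> (\<And>i. i \<in> I \<Longrightarrow> smooth_on (f i) S) \<Longrightarrow> smooth_on (\<lambda>x. \<Prod>i\<in>I. f i x) S"
  by (induction I rule: infinite_finite_induct) (auto simp: smooth_on_const intro!: smooth_on_mult)

lemma smooth_on_linear:
  assumes "bounded_linear L"
  shows "smooth_on L S"
  unfolding smooth_on_def
proof
  fix k
  have "frechet_derivative L (at x) = L" for x
    using frechet_derivative_at[OF bounded_linear_imp_has_derivative[OF assms]] by metis
  then show "Ck_on k L S"
    using assms bounded_linear_imp_differentiable bounded_linear.continuous_on[OF assms continuous_on_id]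
    by (cases k) (auto simp: Ck_on_const)
qed

lemma smooth_on_affine:
  assumes "open S" "open T" "bounded_linear L" "\<And>y. y \<in> T \<Longrightarrow> c + L y \<in> S" "smooth_on f S"
  shows "smooth_on (\<lambda>y. f (c + L y)) T"
  using assms unfolding smooth_on_def by (blast intro: Ck_on_affine)

lemma smooth_on_subset: "smooth_on f S \<Longrightarrow> T \<subseteq> S \<Longrightarrow> smooth_on f T"
proof -
  have "Ck_on k f S \<Longrightarrow> T \<subseteq> S \<Longrightarrow> Ck_on k f T" for k f
    by (induction k arbitrary: f) (auto intro: continuous_on_subset)
  then show "smooth_on f S \<Longrightarrow> T \<subseteq> S \<Longrightarrow> smooth_on f T" by (auto simp: smooth_on_def)
qed

lemma smooth_on_has_derivative:
  "smooth_on f S \<Longrightarrow> x \<in> S \<Longrightarrow> (f has_derivative frechet_derivative f (at x)) (at x)"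
  unfolding smooth_on_def using Ck_on_SucD by blast

lemma smooth_on_frechet: "smooth_on f S \<Longrightarrow> smooth_on (\<lambda>x. frechet_derivative f (at x) v) S"
  unfolding smooth_on_def using Ck_on.simps(2) by blast

lemma smooth_on_imp_continuous_on: "smooth_on f S \<Longrightarrow> continuous_on S f"
  unfolding smooth_on_def using Ck_on.simps(1) by blast

text \<open>
  Symmetry of the second derivative. The second difference of \<open>f\<close> over the parallelogram spanned by
  \<open>s v\<close> and \<open>s w\<close> equals, by two applications of the mean value theorem, \<open>s\<^sup>2\<close> times a second derivative
  \<open>D(D f v) w\<close> at a nearby point; divided by \<open>s\<^sup>2\<close> it tends to \<open>D(D f v) w\<close> at the base point. The second
  difference is symmetric in \<open>v\<close> and \<open>w\<close>.
\<close>

lemma second_difference_real: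
  fixes f :: "'a::euclidean_space \<Rightarrow> real"
  assumes S: "smooth_on f (ball x r)" and s: "0 < s" "s * (norm v + norm w) < r"
  obtains y where "norm (y - x) \<le> s * (norm v + norm w)"
    and "f (x + s *\<^sub>R v + s *\<^sub>R w) - f (x + s *\<^sub>R v) - f (x + s *\<^sub>R w) + f x
      = s\<^sup>2 * frechet_derivative (\<lambda>z. frechet_derivative f (at z) v) (at y) w"
proof -
  define D where "D z = frechet_derivative f (at z)" for z
  define D2 where "D2 z = frechet_derivative (\<lambda>z. D z v) (at z)" for z
  have Df: "(f has_derivative D z) (at z)" if "z \<in> ball x r" for z
    using smooth_on_has_derivative[OF S that] by (simp add: D_def)
  have D2f: "((\<lambda>z. D z v) has_derivative D2 z) (at z)" if "z \<in> ball x r" for z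
    using smooth_on_has_derivative[OF smooth_on_frechet[OF S] that] by (simp add: D_def D2_def)
  have nb: "norm (a *\<^sub>R v + b *\<^sub>R w) \<le> s * (norm v + norm w)" if "0 \<le> a" "a \<le> s" "0 \<le> b" "b \<le> s" for a b
  proof -
    have "norm (a *\<^sub>R v + b *\<^sub>R w) \<le> a * norm v + b * norm w"
      using norm_triangle_ineq[of "a *\<^sub>R v" "b *\<^sub>R w"] \<open>0 \<le> a\<close> \<open>0 \<le> b\<close> unfolding norm_scaleR by linarith
    also have "\<dots> \<le> s * norm v + s * norm w"
      using that by (intro add_mono mult_right_mono) auto
    finally show ?thesis by (simp add: algebra_simps)
  qed
  have inb: "x + a *\<^sub>R v + b *\<^sub>R w \<in> ball x r" if "0 \<le> a" "a \<le> s" "0 \<le> b" "b \<le> s" for a b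
  proof -
    have "dist x (x + a *\<^sub>R v + b *\<^sub>R w) = norm (a *\<^sub>R v + b *\<^sub>R w)"
      by (metis add.assoc add_diff_cancel_left' dist_commute dist_norm)
    then show ?thesis using nb[OF that] s by simp
  qed
  define g where "g a = f (x + a *\<^sub>R v + s *\<^sub>R w) - f (x + a *\<^sub>R v)" for a
  have path: "((\<lambda>a. x + a *\<^sub>R v + b *\<^sub>R w) has_derivative (\<lambda>h. h *\<^sub>R v)) (at a)" for a b
    by (auto intro!: derivative_eq_intros)
  have line: "((\<lambda>a. f (x + a *\<^sub>R v + b *\<^sub>R w)) has_real_derivative D (x + a *\<^sub>R v + b *\<^sub>R w) v) (at a)"
    if "0 \<le> a" "a \<le> s" "0 \<le> b" "b \<le> s" for a b
  proof -
    have lin: "linear (D (x + a *\<^sub>R v + b *\<^sub>R w))"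
      using Df[OF inb[OF that]] by (rule has_derivative_linear)
    show ?thesis
      using diff_chain_at[OF path Df[OF inb[OF that]]]
      by (simp add: has_field_derivative_def o_def linear_scale[OF lin] mult.commute[of _ "D _ v"])
  qed
  have g': "(g has_real_derivative (D (x + a *\<^sub>R v + s *\<^sub>R w) v - D (x + a *\<^sub>R v) v)) (at a)"
    if "0 \<le> a" "a \<le> s" for a
    unfolding g_def using line[OF that, of s] line[OF that, of 0] s by (auto intro!: DERIV_diff)
  obtain a where a: "0 < a" "a < s" and ga: "g s - g 0 = (s - 0) * (D (x + a *\<^sub>R v + s *\<^sub>R w) v - D (x + a *\<^sub>R v) v)"
    using MVT2[of 0 s g, OF s(1) g'] by blast
  define k where "k b = D (x + a *\<^sub>R v + b *\<^sub>R w) v" for b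
  have path2: "((\<lambda>b. x + a *\<^sub>R v + b *\<^sub>R w) has_derivative (\<lambda>h. h *\<^sub>R w)) (at b)" for b
    by (auto intro!: derivative_eq_intros)
  have k': "(k has_real_derivative D2 (x + a *\<^sub>R v + b *\<^sub>R w) w) (at b)" if "0 \<le> b" "b \<le> s" for b
  proof -
    have I: "x + a *\<^sub>R v + b *\<^sub>R w \<in> ball x r" using inb a that by simp
    have lin: "linear (D2 (x + a *\<^sub>R v + b *\<^sub>R w))"
      using D2f[OF I] by (rule has_derivative_linear)
    show ?thesis
      using diff_chain_at[OF path2 D2f[OF I]]
      unfolding k_def by (simp add: has_field_derivative_def o_def linear_scale[OF lin] mult.commute[of _ "D2 _ w"])
  qed
  obtain b where b: "0 < b" "b < s" and kb: "k s - k 0 = (s - 0) * D2 (x + a *\<^sub>R v + b *\<^sub>R w) w"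
    using MVT2[of 0 s k, OF s(1) k'] by blast
  show ?thesis
  proof (rule that)
    show "norm (x + a *\<^sub>R v + b *\<^sub>R w - x) \<le> s * (norm v + norm w)"
      using nb[of a b] a b by (simp add: add.assoc less_imp_le)
    show "f (x + s *\<^sub>R v + s *\<^sub>R w) - f (x + s *\<^sub>R v) - f (x + s *\<^sub>R w) + f x
      = s\<^sup>2 * frechet_derivative (\<lambda>z. frechet_derivative f (at z) v) (at (x + a *\<^sub>R v + b *\<^sub>R w)) w"
      using ga kb by (simp add: g_def k_def D2_def D_def power2_eq_square algebra_simps)
  qed
qed

lemma frechet_second_symmetric_real:
  fixes f :: "'a::euclidean_space \<Rightarrow> real"
  assumes "open S" "x \<in> S" and S: "smooth_on f S"
  shows "frechet_derivative (\<lambda>z. frechet_derivative f (at z) v) (at x) w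
       = frechet_derivative (\<lambda>z. frechet_derivative f (at z) w) (at x) v"
proof -
  obtain r where r: "r > 0" "ball x r \<subseteq> S" using assms openE by blast
  have sm: "smooth_on f (ball x r)" using smooth_on_subset[OF S r(2)] .
  define Q where "Q s = (f (x + s *\<^sub>R v + s *\<^sub>R w) - f (x + s *\<^sub>R v) - f (x + s *\<^sub>R w) + f x) / s\<^sup>2" for s
  define C where "C v w z = frechet_derivative (\<lambda>z. frechet_derivative f (at z) v) (at z) w" for v w z
  have lim: "\<exists>d>0. \<forall>s. 0 < s \<and> s < d \<longrightarrow>
      \<bar>(f (x + s *\<^sub>R v + s *\<^sub>R w) - f (x + s *\<^sub>R v) - f (x + s *\<^sub>R w) + f x) / s\<^sup>2 - C v w x\<bar> < e"
    if "e > 0" for e v w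
  proof -
    have "continuous_on (ball x r) (C v w)"
      unfolding C_def by (intro smooth_on_imp_continuous_on smooth_on_frechet sm)
    then have "isCont (C v w) x" using r by (simp add: continuous_on_eq_continuous_at)
    then obtain d where d: "d > 0" "\<And>y. norm (y - x) < d \<Longrightarrow> \<bar>C v w y - C v w x\<bar> < e"
      unfolding continuous_at_eps_delta dist_norm using \<open>e > 0\<close> by (metis real_norm_def)
    define B where "B = norm v + norm w + 1"
    have B: "B > 0" "norm v + norm w < B" by (auto simp: B_def intro: add_nonneg_pos)
    show ?thesis
    proof (intro exI[of _ "min d r / B"] conjI allI impI)
      show "min d r / B > 0" using d r B by simp
      fix s assume s: "0 < s \<and> s < min d r / B"
      have "s * (norm v + norm w) < s * B" using s B by simp
      also have "s * B < min d r" using s B by (simp add: field_simps)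
      finally have sB: "s * (norm v + norm w) < min d r" .
      then obtain y where y: "norm (y - x) \<le> s * (norm v + norm w)"
        "f (x + s *\<^sub>R v + s *\<^sub>R w) - f (x + s *\<^sub>R v) - f (x + s *\<^sub>R w) + f x = s\<^sup>2 * C v w y"
        using second_difference_real[OF sm, of s v w] s unfolding C_def by auto
      then show "\<bar>(f (x + s *\<^sub>R v + s *\<^sub>R w) - f (x + s *\<^sub>R v) - f (x + s *\<^sub>R w) + f x) / s\<^sup>2 - C v w x\<bar> < e"
        using d(2)[of y] sB s by simp
    qed
  qed
  have "\<bar>C v w x - C w v x\<bar> < 2 * e" if e: "e > 0" for e
  proof -
    obtain d1 where d1: "d1 > 0" "\<And>s. 0 < s \<and> s < d1 \<Longrightarrow> \<bar>Q s - C v w x\<bar> < e"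
      using lim[OF e, of v w] unfolding Q_def by blast
    obtain d2 where d2: "d2 > 0" "\<And>s. 0 < s \<and> s < d2 \<Longrightarrow> \<bar>Q s - C w v x\<bar> < e"
      using lim[OF e, of w v] unfolding Q_def by (auto simp: algebra_simps)
    have "0 < min d1 d2 / 2 \<and> min d1 d2 / 2 < d1" "0 < min d1 d2 / 2 \<and> min d1 d2 / 2 < d2"
      using d1(1) d2(1) by auto
    from d1(2)[OF this(1)] d2(2)[OF this(2)] show ?thesis by linarith
  qed
  from this[of "\<bar>C v w x - C w v x\<bar> / 2"] have "C v w x = C w v x" by fastforce
  then show ?thesis by (simp add: C_def)
qed

lemma frechet_derivative_bounded_linear:
  assumes "bounded_linear L" "f differentiable at x"
  shows "frechet_derivative (\<lambda>z. L (f z)) (at x) v = L (frechet_derivative f (at x) v)"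
proof -
  have "((\<lambda>z. L (f z)) has_derivative (\<lambda>v. L (frechet_derivative f (at x) v))) (at x)"
    by (rule bounded_linear.has_derivative[OF assms(1)]) (use assms(2) in \<open>simp add: frechet_derivative_works\<close>)
  from frechet_derivative_at[OF this] show ?thesis by metis
qed

lemma frechet_second_symmetric:
  fixes f :: "'a::euclidean_space \<Rightarrow> complex"
  assumes "open S" "x \<in> S" and S: "smooth_on f S"
  shows "frechet_derivative (\<lambda>z. frechet_derivative f (at z) v) (at x) w
       = frechet_derivative (\<lambda>z. frechet_derivative f (at z) w) (at x) v"
proof -
  have diff: "f differentiable at z" if "z \<in> S" for z
    using smooth_on_has_derivative[OF S that] differentiableI by blast
  have diff2: "(\<lambda>z. frechet_derivative f (at z) v) differentiable at x" for v
    using smooth_on_has_derivative[OF smooth_on_frechet[OF S] assms(2)] differentiableI by blast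
  have *: "L (frechet_derivative (\<lambda>z. frechet_derivative f (at z) v) (at x) w)
      = L (frechet_derivative (\<lambda>z. frechet_derivative f (at z) w) (at x) v)"
    if L: "bounded_linear L" for L :: "complex \<Rightarrow> real"
  proof -
    have sL: "smooth_on (\<lambda>z. L (f z)) S" by (rule smooth_on_bounded_linear[OF assms(1) L S])
    have eq: "frechet_derivative (\<lambda>z. frechet_derivative (\<lambda>z. L (f z)) (at z) v) (at x) w
       = L (frechet_derivative (\<lambda>z. frechet_derivative f (at z) v) (at x) w)" for v w
    proof -
      have "frechet_derivative (\<lambda>z. frechet_derivative (\<lambda>z. L (f z)) (at z) v) (at x)
         = frechet_derivative (\<lambda>z. L (frechet_derivative f (at z) v)) (at x)"
        by (rule frechet_derivative_transform_within_open[OF _ assms(1,2)])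
          (use smooth_on_has_derivative[OF smooth_on_frechet[OF sL] assms(2)] diff
            in \<open>auto simp: frechet_derivative_bounded_linear[OF L] intro: differentiableI\<close>)
      then show ?thesis by (simp add: frechet_derivative_bounded_linear[OF L diff2])
    qed
    show ?thesis using frechet_second_symmetric_real[OF assms(1,2) sL, of v w] by (simp add: eq)
  qed
  show ?thesis
    using *[OF bounded_linear_Re] *[OF bounded_linear_Im] by (rule complex_eqI)
qed

section \<open>Wirtinger calculus\<close>

lemma frechet_cong_open:
  assumes "open S" "x \<in> S" "\<And>y. y \<in> S \<Longrightarrow> f y = g y"
  shows "frechet_derivative f (at x) = frechet_derivative g (at x)"
proof -
  have "(f has_derivative D) (at x) \<longleftrightarrow> (g has_derivative D) (at x)" for D
    using assms by (metis has_derivative_transform_within_open)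
  then show ?thesis by (simp add: frechet_derivative_def)
qed

lemma pd_cong_open:
  assumes "open S" "x \<in> S" "\<And>y. y \<in> S \<Longrightarrow> f y = g y"
  shows "pd k f x = pd k g x" "pdbar k f x = pdbar k g x"
  unfolding pd_def pdbar_def by (simp_all add: frechet_cong_open[OF assms])

lemma pd_has_derivative:
  assumes "(f has_derivative D) (at x)"
  shows "pd k f x = (D (axis k 1) - \<i> * D (axis k \<i>)) / 2"
    and "pdbar k f x = (D (axis k 1) + \<i> * D (axis k \<i>)) / 2"
  unfolding pd_def pdbar_def frechet_derivative_at[OF assms, symmetric] by simp_all

text \<open>
  Each variable \<open>v\<^sub>b\<close> contributes a real linear map \<open>\<complex> \<rightarrow> \<complex>\<close>, which is uniquely a complex linear plus an antilinear one;
  the coefficients are the two Wirtinger derivatives.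
\<close>

lemma linear_wirtinger:
  fixes D :: "complex^'n \<Rightarrow> complex"
  assumes "linear D"
  shows "D v = (\<Sum>b\<in>UNIV. (D (axis b 1) - \<i> * D (axis b \<i>)) / 2 * v $ b
                      + (D (axis b 1) + \<i> * D (axis b \<i>)) / 2 * cnj (v $ b))"
proof -
  have "v = (\<Sum>b\<in>UNIV. Re (v $ b) *\<^sub>R axis b 1 + Im (v $ b) *\<^sub>R axis b \<i>)"
  proof (subst Finite_Cartesian_Product.vec_eq_iff, intro allI)
    fix a
    have "(\<Sum>b\<in>UNIV. Re (v $ b) *\<^sub>R axis b 1 + Im (v $ b) *\<^sub>R axis b \<i>) $ a
        = (\<Sum>b\<in>UNIV. if b = a then v $ b else 0)"
      unfolding sum_component
      by (intro sum.cong refl) (simp add: axis_def complex_eq_iff)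
    then show "v $ a = (\<Sum>b\<in>UNIV. Re (v $ b) *\<^sub>R axis b 1 + Im (v $ b) *\<^sub>R axis b \<i>) $ a" by simp
  qed
  then have "D v = D (\<Sum>b\<in>UNIV. Re (v $ b) *\<^sub>R axis b 1 + Im (v $ b) *\<^sub>R axis b \<i>)" by simp
  also have "\<dots> = (\<Sum>b\<in>UNIV. Re (v $ b) *\<^sub>R D (axis b 1) + Im (v $ b) *\<^sub>R D (axis b \<i>))"
    by (simp add: linear_sum[OF assms] linear_add[OF assms] linear_scale[OF assms])
  also have "\<dots> = (\<Sum>b\<in>UNIV. (D (axis b 1) - \<i> * D (axis b \<i>)) / 2 * v $ b
                      + (D (axis b 1) + \<i> * D (axis b \<i>)) / 2 * cnj (v $ b))"
    by (intro sum.cong refl) (simp add: complex_eq_iff field_simps)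
  finally show ?thesis .
qed

lemma pd_add:
  assumes "f differentiable at x" "g differentiable at x"
  shows "pd k (\<lambda>x. f x + g x) x = pd k f x + pd k g x"
    and "pdbar k (\<lambda>x. f x + g x) x = pdbar k f x + pdbar k g x"
proof -
  obtain F G where FG: "(f has_derivative F) (at x)" "(g has_derivative G) (at x)"
    using assms by (auto simp: differentiable_def)
  show "pd k (\<lambda>x. f x + g x) x = pd k f x + pd k g x" "pdbar k (\<lambda>x. f x + g x) x = pdbar k f x + pdbar k g x"
    unfolding pd_has_derivative[OF has_derivative_add[OF FG]] pd_has_derivative[OF FG(1)]
      pd_has_derivative[OF FG(2)] by (simp_all add: field_simps)
qed

lemma pd_mult:
  assumes "f differentiable at x" "g differentiable at x"
  shows "pd k (\<lambda>x. f x * g x) x = pd k f x * g x + f x * pd k g x"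
    and "pdbar k (\<lambda>x. f x * g x) x = pdbar k f x * g x + f x * pdbar k g x"
proof -
  obtain F G where FG: "(f has_derivative F) (at x)" "(g has_derivative G) (at x)"
    using assms by (auto simp: differentiable_def)
  show "pd k (\<lambda>x. f x * g x) x = pd k f x * g x + f x * pd k g x"
    "pdbar k (\<lambda>x. f x * g x) x = pdbar k f x * g x + f x * pdbar k g x"
    unfolding pd_has_derivative[OF has_derivative_mult[OF FG]] pd_has_derivative[OF FG(1)]
      pd_has_derivative[OF FG(2)] by (simp_all add: field_simps)
qed

lemma pd_const: "pd k (\<lambda>x. c) x = 0" "pdbar k (\<lambda>x. c) x = 0"
  using pd_has_derivative[OF has_derivative_const[of c "at x"]] by simp_all

lemma pd_cmult:
  assumes "f differentiable at x"
  shows "pd k (\<lambda>x. c * f x) x = c * pd k f x" "pdbar k (\<lambda>x. c * f x) x = c * pdbar k f x"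
  using pd_mult[of "\<lambda>_. c" x f k] assms by (simp_all add: pd_const)

lemma pd_diff:
  assumes "f differentiable at x" "g differentiable at x"
  shows "pd k (\<lambda>x. f x - g x) x = pd k f x - pd k g x"
    and "pdbar k (\<lambda>x. f x - g x) x = pdbar k f x - pdbar k g x"
  using pd_add[of f x "\<lambda>x. (-1) * g x" k] assms by (simp_all add: pd_cmult[of g x _ "-1", simplified])

lemma pd_sum:
  assumes "finite I" "\<And>i. i \<in> I \<Longrightarrow> f i differentiable at x"
  shows "pd k (\<lambda>x. \<Sum>i\<in>I. f i x) x = (\<Sum>i\<in>I. pd k (f i) x)"
    and "pdbar k (\<lambda>x. \<Sum>i\<in>I. f i x) x = (\<Sum>i\<in>I. pdbar k (f i) x)"
  using assms by (induction I) (simp_all add: pd_const pd_add differentiable_sum)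

lemma pd_cnj:
  assumes "f differentiable at x"
  shows "pd k (\<lambda>x. cnj (f x)) x = cnj (pdbar k f x)" "pdbar k (\<lambda>x. cnj (f x)) x = cnj (pd k f x)"
proof -
  obtain F where F: "(f has_derivative F) (at x)"
    using assms by (auto simp: differentiable_def)
  show "pd k (\<lambda>x. cnj (f x)) x = cnj (pdbar k f x)" "pdbar k (\<lambda>x. cnj (f x)) x = cnj (pd k f x)"
    unfolding pd_has_derivative[OF has_derivative_cnj[OF F]] pd_has_derivative[OF F]
    by simp_all
qed

lemma smooth_on_differentiable: "smooth_on f S \<Longrightarrow> x \<in> S \<Longrightarrow> f differentiable at x"
  using smooth_on_has_derivative differentiableI by blast

lemma smooth_on_pd:
  assumes "open S" "smooth_on f S"
  shows "smooth_on (pd k f) S" "smooth_on (pdbar k f) S"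
proof -
  have "smooth_on (\<lambda>x. (frechet_derivative f (at x) (axis k 1) - \<i> * frechet_derivative f (at x) (axis k \<i>)) / 2) S"
    "smooth_on (\<lambda>x. (frechet_derivative f (at x) (axis k 1) + \<i> * frechet_derivative f (at x) (axis k \<i>)) / 2) S"
    by (intro smooth_on_divide smooth_on_diff smooth_on_add smooth_on_mult smooth_on_const smooth_on_frechet assms; simp)+
  then show "smooth_on (pd k f) S" "smooth_on (pdbar k f) S"
    by (simp_all add: pd_def[abs_def] pdbar_def[abs_def])
qed

lemma differentiable_vec_lambda:
  fixes g :: "'b::real_normed_vector \<Rightarrow> complex^'n"
  assumes "\<And>b. ((\<lambda>y. g y $ b) has_derivative E b) (at x)"
  shows "(g has_derivative (\<lambda>v. \<chi> b. E b v)) (at x)"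
proof -
  have ax: "bounded_linear (axis b :: complex \<Rightarrow> complex^'n)" for b
    by (rule linear_conv_bounded_linear[THEN iffD1], rule linearI) (auto simp: axis_def Finite_Cartesian_Product.vec_eq_iff)
  have eq: "(\<Sum>b\<in>UNIV. axis b (w $ b)) = w" for w :: "complex^'n"
    by (subst Finite_Cartesian_Product.vec_eq_iff) (simp add: axis_def if_distrib[where f="\<lambda>f. f _"] cong: if_cong)
  have "((\<lambda>y. \<Sum>b\<in>UNIV. axis b (g y $ b)) has_derivative (\<lambda>v. \<Sum>b\<in>UNIV. axis b (E b v))) (at x)"
    by (intro has_derivative_sum bounded_linear.has_derivative[OF ax] assms)
  moreover have "(\<Sum>b\<in>UNIV. axis b (E b v)) = (\<chi> b. E b v)" for v
    using eq[of "\<chi> b. E b v"] by simp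
  ultimately show ?thesis by (simp add: eq)
qed

text \<open>
  The differential of \<open>g\<close> at \<open>x\<close> is complex linear, so it preserves the splitting into linear and antilinear parts:
  \<open>\<partial>\<close> of the composition involves only \<open>\<partial>f\<close>, and \<open>\<partial>\<close>-bar only \<open>\<partial>\<close>-bar of \<open>f\<close>.
\<close>

lemma pd_compose_holomorphic:
  fixes g :: "complex^'m \<Rightarrow> complex^'n" and f :: "complex^'n \<Rightarrow> complex"
  assumes f: "f differentiable at (g x)"
    and g: "\<And>b. (\<lambda>y. g y $ b) differentiable at x" "\<And>b l. pdbar l (\<lambda>y. g y $ b) x = 0"
  shows "pd k (\<lambda>y. f (g y)) x = (\<Sum>b\<in>UNIV. pd b f (g x) * pd k (\<lambda>y. g y $ b) x)"
    and "pdbar k (\<lambda>y. f (g y)) x = (\<Sum>b\<in>UNIV. pdbar b f (g x) * cnj (pd k (\<lambda>y. g y $ b) x))"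
    and "(\<lambda>y. f (g y)) differentiable at x"
proof -
  obtain F where F: "(f has_derivative F) (at (g x))" using f by (auto simp: differentiable_def)
  define E where "E b = frechet_derivative (\<lambda>y. g y $ b) (at x)" for b
  have E: "((\<lambda>y. g y $ b) has_derivative E b) (at x)" for b
    using g(1) by (simp add: E_def frechet_derivative_works)
  have Ei: "E b (axis k \<i>) = \<i> * E b (axis k 1)" for b
    using g(2)[of k b] unfolding pd_has_derivative[OF E]
    by (simp add: complex_eq_iff algebra_simps)
  have pdg: "pd k (\<lambda>y. g y $ b) x = E b (axis k 1)" for b
    unfolding pd_has_derivative[OF E] Ei by simp
  have fg: "((\<lambda>y. f (g y)) has_derivative (\<lambda>v. F (\<chi> b. E b v))) (at x)"
    using diff_chain_at[OF differentiable_vec_lambda[OF E] F] by (simp add: o_def)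
  have Fx: "F v = (\<Sum>b\<in>UNIV. pd b f (g x) * v $ b + pdbar b f (g x) * cnj (v $ b))" for v
    unfolding pd_has_derivative[OF F] by (rule linear_wirtinger[OF has_derivative_linear[OF F]])
  show "(\<lambda>y. f (g y)) differentiable at x" using fg differentiableI by blast
  show "pd k (\<lambda>y. f (g y)) x = (\<Sum>b\<in>UNIV. pd b f (g x) * pd k (\<lambda>y. g y $ b) x)"
    "pdbar k (\<lambda>y. f (g y)) x = (\<Sum>b\<in>UNIV. pdbar b f (g x) * cnj (pd k (\<lambda>y. g y $ b) x))"
    unfolding pd_has_derivative[OF fg] Fx pdg
      sum_distrib_left sum_subtractf[symmetric] sum.distrib[symmetric] sum_divide_distrib
    by (rule sum.cong; simp add: Ei field_simps)+
qed

lemma holomorphic_in_smooth: "holomorphic_in f S \<Longrightarrow> smooth_on f S"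
  by (simp add: holomorphic_in_def)

lemma holomorphic_in_pdbar: "holomorphic_in f S \<Longrightarrow> x \<in> S \<Longrightarrow> pdbar k f x = 0"
  by (simp add: holomorphic_in_def)

lemma pd_pdbar_commute:
  assumes "open S" "smooth_on f S" "x \<in> S"
  shows "pdbar j (pd k f) x = pd k (pdbar j f) x"
proof -
  define C where "C v w = frechet_derivative (\<lambda>z. frechet_derivative f (at z) v) (at x) w" for v w
  have sym: "C v w = C w v" for v w
    unfolding C_def by (rule frechet_second_symmetric[OF assms(1,3,2)])
  have H: "((\<lambda>z. frechet_derivative f (at z) v) has_derivative C v) (at x)" for v
    unfolding C_def by (rule smooth_on_has_derivative[OF smooth_on_frechet[OF assms(2)] assms(3)])
  have d: "(pd k f has_derivative (\<lambda>w. (C (axis k 1) w - \<i> * C (axis k \<i>) w) / 2)) (at x)"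
    "(pdbar j f has_derivative (\<lambda>w. (C (axis j 1) w + \<i> * C (axis j \<i>) w) / 2)) (at x)"
    unfolding pd_def[abs_def] pdbar_def[abs_def]
    by (auto intro!: derivative_eq_intros H)
  show ?thesis
    unfolding pd_has_derivative[OF d(1)] pd_has_derivative[OF d(2)]
    by (simp add: sym[of "axis k _"] field_simps)
qed

text \<open>
  \<open>\<partial>\<close>-bar of \<open>\<partial>f\<close> is \<open>\<partial>\<close> of \<open>\<partial>\<close>-bar \<open>f\<close>, by the symmetry of the second derivative.
\<close>

lemma holomorphic_in_pd:
  assumes "open S" "holomorphic_in f S"
  shows "holomorphic_in (pd k f) S"
  unfolding holomorphic_in_def
proof (intro conjI ballI allI)
  show "smooth_on (pd k f) S"
    using assms smooth_on_pd(1) by (auto simp: holomorphic_in_def)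
  fix x j assume x: "x \<in> S"
  have "pdbar j (pd k f) x = pd k (pdbar j f) x"
    using assms x by (intro pd_pdbar_commute[of S]) (auto simp: holomorphic_in_def)
  also have "\<dots> = pd k (\<lambda>_. 0) x"
    by (rule pd_cong_open[OF assms(1) x]) (use assms in \<open>simp add: holomorphic_in_def\<close>)
  finally show "pdbar j (pd k f) x = 0" by (simp add: pd_const)
qed

lemma holomorphic_in_divide:
  assumes "open S" "holomorphic_in f S" "holomorphic_in g S" and nz: "\<And>x. x \<in> S \<Longrightarrow> g x \<noteq> 0"
  shows "holomorphic_in (\<lambda>x. f x / g x) S"
  unfolding holomorphic_in_def
proof (intro conjI ballI allI)
  have sm: "smooth_on f S" "smooth_on g S" using assms by (auto simp: holomorphic_in_def)
  show sq: "smooth_on (\<lambda>x. f x / g x) S" using assms sm by (intro smooth_on_divide) auto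
  fix x k assume x: "x \<in> S"
  have "pdbar k f x = pdbar k (\<lambda>x. (f x / g x) * g x) x"
    by (rule pd_cong_open[OF assms(1) x]) (simp add: nz)
  also have "\<dots> = pdbar k (\<lambda>x. f x / g x) x * g x + f x / g x * pdbar k g x"
    by (rule pd_mult) (use sm sq x smooth_on_differentiable in blast)+
  \<comment> \<open>The product rule for \<open>f = (f / g) g\<close>, solved for the derivative of the quotient.\<close>
  finally show "pdbar k (\<lambda>x. f x / g x) x = 0"
    using assms(2,3) nz[OF x] x by (simp add: holomorphic_in_def)
qed

lemma has_derivative_ln_sum_squares:
  fixes r s :: "'a::real_normed_vector \<Rightarrow> real"
  assumes "(r has_derivative R) (at x)" "(s has_derivative S) (at x)" "0 < (r x)\<^sup>2 + (s x)\<^sup>2"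
  shows "((\<lambda>x. ln ((r x)\<^sup>2 + (s x)\<^sup>2)) has_derivative
      (\<lambda>v. (2 * r x * R v + 2 * s x * S v) / ((r x)\<^sup>2 + (s x)\<^sup>2))) (at x)"
  using assms by (auto intro!: derivative_eq_intros simp: field_simps)

text \<open>
  \<open>ln |g|\<^sup>2\<close> is pluriharmonic: its \<open>\<partial>\<close>-bar derivatives are the conjugates of the holomorphic functions
  \<open>\<partial>g / g\<close>.
\<close>

lemma pdbar_ln_cmod:
  assumes "open S" "holomorphic_in g S" and nz: "\<And>x. x \<in> S \<Longrightarrow> g x \<noteq> 0" and x: "x \<in> S"
  shows "pdbar k (\<lambda>x. of_real (ln ((cmod (g x))\<^sup>2))) x = cnj (pd k g x / g x)"
    and "(\<lambda>x. of_real (ln ((cmod (g x))\<^sup>2)) :: complex) differentiable at x"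
proof -
  define G where "G = frechet_derivative g (at x)"
  have G: "(g has_derivative G) (at x)"
    unfolding G_def using smooth_on_has_derivative[OF holomorphic_in_smooth[OF assms(2)] x] .
  have Gi: "G (axis k \<i>) = \<i> * G (axis k 1)"
    using holomorphic_in_pdbar[OF assms(2) x, of k] unfolding pd_has_derivative[OF G]
    by (simp add: complex_eq_iff algebra_simps)
  have pdg: "pd k g x = G (axis k 1)"
    unfolding pd_has_derivative[OF G] Gi by simp
  have gp: "0 < (Re (g x))\<^sup>2 + (Im (g x))\<^sup>2"
    using nz[OF x] by (simp add: complex_eq_iff sum_power2_gt_zero_iff)
  have R: "((\<lambda>x. Re (g x)) has_derivative (\<lambda>v. Re (G v))) (at x)"
    and I: "((\<lambda>x. Im (g x)) has_derivative (\<lambda>v. Im (G v))) (at x)"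
    using G by (auto intro!: derivative_eq_intros)
  have "((\<lambda>x. ln ((Re (g x))\<^sup>2 + (Im (g x))\<^sup>2)) has_derivative
      (\<lambda>v. (2 * Re (g x) * Re (G v) + 2 * Im (g x) * Im (G v)) / ((Re (g x))\<^sup>2 + (Im (g x))\<^sup>2))) (at x)"
    by (rule has_derivative_ln_sum_squares[OF R I gp])
  moreover have log_deriv: "complex_of_real ((2 * Re (g x) * Re w + 2 * Im (g x) * Im w) / ((Re (g x))\<^sup>2 + (Im (g x))\<^sup>2))
      = w / g x + cnj (w / g x)" for w
  proof -
    have n: "complex_of_real ((Re (g x))\<^sup>2 + (Im (g x))\<^sup>2) = g x * cnj (g x)"
      by (simp add: complex_mult_cnj)
    have "complex_of_real (2 * Re (g x) * Re w + 2 * Im (g x) * Im w) = w * cnj (g x) + g x * cnj w"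
      by (simp add: complex_eq_iff)
    then show ?thesis
      unfolding of_real_divide n using nz[OF x] by (simp add: field_simps)
  qed
  ultimately have L: "((\<lambda>x. of_real (ln ((cmod (g x))\<^sup>2)) :: complex) has_derivative
      (\<lambda>v. of_real ((2 * Re (g x) * Re (G v) + 2 * Im (g x) * Im (G v)) / ((Re (g x))\<^sup>2 + (Im (g x))\<^sup>2)))) (at x)"
    unfolding cmod_power2 by (intro has_derivative_of_real)
  then show "(\<lambda>x. of_real (ln ((cmod (g x))\<^sup>2)) :: complex) differentiable at x"
    using differentiableI by blast
  show "pdbar k (\<lambda>x. of_real (ln ((cmod (g x))\<^sup>2))) x = cnj (pd k g x / g x)"
    unfolding pd_has_derivative[OF L] pdg Gi log_deriv using nz[OF x] by (simp add: field_simps)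
qed

lemma levi_ln_cmod:
  assumes "open S" "holomorphic_in g S" and nz: "\<And>x. x \<in> S \<Longrightarrow> g x \<noteq> 0" and x: "x \<in> S"
  shows "pd j (pdbar k (\<lambda>x. of_real (ln ((cmod (g x))\<^sup>2)))) x = 0"
    and "pdbar k (\<lambda>x. of_real (ln ((cmod (g x))\<^sup>2))) differentiable at x"
proof -
  have q: "holomorphic_in (\<lambda>x. pd k g x / g x) S"
    by (intro holomorphic_in_divide holomorphic_in_pd assms)
  have d: "(\<lambda>x. pd k g x / g x) differentiable at x"
    using smooth_on_differentiable[OF holomorphic_in_smooth[OF q] x] .
  have "pd j (pdbar k (\<lambda>x. of_real (ln ((cmod (g x))\<^sup>2)))) x = pd j (\<lambda>x. cnj (pd k g x / g x)) x"
    by (rule pd_cong_open[OF assms(1) x]) (rule pdbar_ln_cmod[OF assms(1-3)])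
  also have "\<dots> = 0"
    by (simp only: pd_cnj[OF d] holomorphic_in_pdbar[OF q x]) simp
  finally show "pd j (pdbar k (\<lambda>x. of_real (ln ((cmod (g x))\<^sup>2)))) x = 0" .
  have "(\<lambda>x. cnj (pd k g x / g x)) differentiable at x"
    using d has_derivative_cnj unfolding differentiable_def by blast
  then show "pdbar k (\<lambda>x. of_real (ln ((cmod (g x))\<^sup>2))) differentiable at x"
    unfolding differentiable_def
    using has_derivative_transform_within_open[OF _ assms(1) x] pdbar_ln_cmod(1)[OF assms(1-3)]
    by (metis (no_types, lifting))
qed

section \<open>The covector norm of a Hermitian matrix\<close>

definition herm_pos :: "complex^'n::finite^'n \<Rightarrow> bool" where
  "herm_pos H \<longleftrightarrow> (\<forall>w. w \<noteq> 0 \<longrightarrow> 0 < Re (\<Sum>j\<in>UNIV. \<Sum>k\<in>UNIV. H $ j $ k * w $ j * cnj (w $ k)))"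

lemma herm_pos_invertible:
  assumes "herm_pos H"
  shows "invertible H"
proof -
  have "x = 0" if "H *v x = 0" for x
  proof (rule ccontr)
    assume "x \<noteq> 0"
    \<comment> \<open>The form conjugates its second argument, so a kernel vector \<open>x\<close> is tested with its conjugate.\<close>
    define w where "w = (\<chi> j. cnj (x $ j))"
    have "w \<noteq> 0" using \<open>x \<noteq> 0\<close> by (simp add: w_def Finite_Cartesian_Product.vec_eq_iff)
    then have "0 < Re (\<Sum>j\<in>UNIV. \<Sum>k\<in>UNIV. H $ j $ k * w $ j * cnj (w $ k))"
      using assms unfolding herm_pos_def by blast
    also have "(\<Sum>j\<in>UNIV. \<Sum>k\<in>UNIV. H $ j $ k * w $ j * cnj (w $ k))
        = (\<Sum>j\<in>UNIV. w $ j * (\<Sum>k\<in>UNIV. H $ j $ k * x $ k))"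
      unfolding sum_distrib_left by (intro sum.cong refl) (simp add: w_def)
    finally have "0 < Re (\<Sum>j\<in>UNIV. w $ j * (\<Sum>k\<in>UNIV. H $ j $ k * x $ k))" .
    moreover have "(\<Sum>k\<in>UNIV. H $ j $ k * x $ k) = 0" for j
      using that by (simp add: Finite_Cartesian_Product.vec_eq_iff matrix_vector_mult_def)
    ultimately show False by simp
  qed
  then show ?thesis
    by (metis invertible_left_inverse matrix_left_invertible_ker)
qed

lemma matrix_inv_left_right:
  assumes "invertible H"
  shows "H ** matrix_inv H = Finite_Cartesian_Product.mat 1" "matrix_inv H ** H = Finite_Cartesian_Product.mat 1"
  using assms someI_ex[of "\<lambda>B. H ** B = Finite_Cartesian_Product.mat 1 \<and> B ** H = Finite_Cartesian_Product.mat 1"]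
  unfolding invertible_def matrix_inv_def by blast+

text \<open>
  Cramer's rule writes the entries of the inverse as rational functions of the entries of \<open>H\<close>; this is what makes them
  smooth functions of the point.
\<close>

lemma matrix_inv_cramer:
  fixes H :: "complex^'n^'n"
  assumes "invertible H"
  shows "matrix_inv H $ a $ b =
    Determinants.det (\<chi> i j. if j = a then (if i = b then 1 else 0) else H $ i $ j) / Determinants.det H"
proof -
  have "Determinants.det H \<noteq> 0" using assms by (simp add: invertible_det_nz)
  moreover have "H *v (matrix_inv H *v axis b 1) = axis b 1"
    by (simp add: matrix_vector_mul_assoc matrix_inv_left_right[OF assms])
  ultimately have "matrix_inv H *v axis b 1
      = (\<chi> k. Determinants.det(\<chi> i j. if j=k then axis b 1 $ i else H $ i $ j) / Determinants.det H)"
    using cramer by blast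
  then have "(matrix_inv H *v axis b 1) $ a
      = Determinants.det(\<chi> i j. if j=a then axis b 1 $ i else H $ i $ j) / Determinants.det H"
    by simp
  moreover have "(matrix_inv H *v axis b 1) $ a = matrix_inv H $ a $ b"
    by (simp add: matrix_vector_mult_def axis_def if_distrib cong: if_cong)
  ultimately show ?thesis by (simp add: axis_def eq_commute[of b] cong: if_cong)
qed

lemma smooth_on_det:
  fixes H :: "'a::euclidean_space \<Rightarrow> complex^'n^'n"
  assumes "open S" "\<And>i j. smooth_on (\<lambda>x. H x $ i $ j) S"
  shows "smooth_on (\<lambda>x. Determinants.det (H x)) S"
  unfolding Determinants.det_def
  by (intro smooth_on_sum smooth_on_mult smooth_on_prod smooth_on_const assms)

lemma smooth_on_matrix_inv:
  fixes H :: "'a::euclidean_space \<Rightarrow> complex^'n^'n"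
  assumes "open S" "\<And>i j. smooth_on (\<lambda>x. H x $ i $ j) S" "\<And>x. x \<in> S \<Longrightarrow> invertible (H x)"
  shows "smooth_on (\<lambda>x. matrix_inv (H x) $ a $ b) S"
proof (rule smooth_on_cong_open[OF assms(1)])
  show "smooth_on (\<lambda>x. Determinants.det (\<chi> i j. if j = a then (if i = b then 1 else 0) else H x $ i $ j) / Determinants.det (H x)) S"
  proof (intro smooth_on_divide smooth_on_det assms(1,2))
    show "smooth_on (\<lambda>x. (\<chi> i j. if j = a then if i = b then 1 else 0 else H x $ i $ j) $ i $ j) S" for i j
      by (cases "j = a"; cases "i = b") (simp_all add: smooth_on_const assms(2))
  qed (use assms(3) in \<open>auto simp: invertible_det_nz\<close>)
qed (simp add: matrix_inv_cramer[OF assms(3)])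

text \<open>
  The polarisation of \<^const>\<open>covector_sq\<close>, symmetrised so that it is symmetric for every matrix \<open>H\<close>.
\<close>

definition covector_ip :: "complex^'n^'n \<Rightarrow> complex^'n::finite \<Rightarrow> complex^'n \<Rightarrow> real" where
  "covector_ip H \<alpha> \<beta> = Re (\<Sum>j\<in>UNIV. \<Sum>k\<in>UNIV.
     matrix_inv H $ k $ j * (\<alpha> $ k * cnj (\<beta> $ j) + \<beta> $ k * cnj (\<alpha> $ j))) / 2"

lemma covector_ip_commute: "covector_ip H \<alpha> \<beta> = covector_ip H \<beta> \<alpha>"
  by (simp add: covector_ip_def add.commute)

lemma covector_ip_same: "covector_ip H \<alpha> \<alpha> = covector_sq H \<alpha>"
proof -
  have "(\<Sum>j\<in>UNIV. \<Sum>k\<in>UNIV. matrix_inv H $ k $ j * (\<alpha> $ k * cnj (\<alpha> $ j) + \<alpha> $ k * cnj (\<alpha> $ j)))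
    = 2 * (\<Sum>j\<in>UNIV. \<Sum>k\<in>UNIV. matrix_inv H $ k $ j * \<alpha> $ k * cnj (\<alpha> $ j))"
    unfolding sum_distrib_left by (intro sum.cong refl) (simp add: algebra_simps)
  then show ?thesis by (simp add: covector_ip_def covector_sq_def)
qed

lemma covector_ip_left:
  assumes "\<And>k. \<gamma> $ k = of_real a * \<alpha> $ k + of_real b * \<beta> $ k"
  shows "covector_ip H \<gamma> \<kappa> = a * covector_ip H \<alpha> \<kappa> + b * covector_ip H \<beta> \<kappa>"
proof -
  have "(\<Sum>j\<in>UNIV. \<Sum>k\<in>UNIV. matrix_inv H $ k $ j * (\<gamma> $ k * cnj (\<kappa> $ j) + \<kappa> $ k * cnj (\<gamma> $ j)))
    = of_real a * (\<Sum>j\<in>UNIV. \<Sum>k\<in>UNIV. matrix_inv H $ k $ j * (\<alpha> $ k * cnj (\<kappa> $ j) + \<kappa> $ k * cnj (\<alpha> $ j)))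
    + of_real b * (\<Sum>j\<in>UNIV. \<Sum>k\<in>UNIV. matrix_inv H $ k $ j * (\<beta> $ k * cnj (\<kappa> $ j) + \<kappa> $ k * cnj (\<beta> $ j)))"
    unfolding assms sum_distrib_left sum.distrib[symmetric]
    by (intro sum.cong refl) (simp add: algebra_simps)
  then show ?thesis by (simp add: covector_ip_def field_simps)
qed

lemma covector_sq_scale: "covector_sq H (\<chi> k. \<alpha> $ k * c) = covector_sq H \<alpha> * (cmod c)\<^sup>2"
proof -
  have "(\<Sum>j\<in>UNIV. \<Sum>k\<in>UNIV. matrix_inv H $ k $ j * (\<alpha> $ k * c) * cnj (\<alpha> $ j * c))
      = (\<Sum>j\<in>UNIV. \<Sum>k\<in>UNIV. matrix_inv H $ k $ j * \<alpha> $ k * cnj (\<alpha> $ j)) * of_real ((cmod c)\<^sup>2)"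
    unfolding sum_distrib_right complex_norm_square
    by (intro sum.cong refl) (simp add: algebra_simps)
  then show ?thesis by (simp add: covector_sq_def)
qed

text \<open>
  The covector norm is the pairing of \<open>\<alpha>\<close> with the vector dual to it, and that vector transforms
  contragrediently; so the norm does not depend on the coordinates.
\<close>

lemma covector_sq_pairing:
  assumes "invertible H" and "H *v \<beta> = (\<chi> j. cnj (\<alpha> $ j))"
  shows "covector_sq H \<alpha> = Re (\<Sum>k\<in>UNIV. \<alpha> $ k * \<beta> $ k)"
proof -
  have "\<beta> = matrix_inv H *v (\<chi> j. cnj (\<alpha> $ j))"
    using assms(2) matrix_inv_left_right[OF assms(1)] by (metis matrix_vector_mul_assoc matrix_vector_mul_lid)
  then have "\<beta> $ k = (\<Sum>j\<in>UNIV. matrix_inv H $ k $ j * cnj (\<alpha> $ j))" for k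
    by (simp add: matrix_vector_mult_def)
  then have "(\<Sum>k\<in>UNIV. \<alpha> $ k * \<beta> $ k) = (\<Sum>k\<in>UNIV. \<Sum>j\<in>UNIV. matrix_inv H $ k $ j * \<alpha> $ k * cnj (\<alpha> $ j))"
    by (simp add: sum_distrib_left algebra_simps)
  then show ?thesis
    unfolding covector_sq_def by (subst sum.swap) simp
qed

lemma covector_sq_transform:
  fixes A H H' :: "complex^'n^'n"
  assumes "invertible H" "invertible H'"
    and H': "\<And>k l. H' $ k $ l = (\<Sum>a\<in>UNIV. \<Sum>b\<in>UNIV. H $ a $ b * A $ a $ k * cnj (A $ b $ l))"
    and \<alpha>': "\<And>k. \<alpha>' $ k = (\<Sum>b\<in>UNIV. \<alpha> $ b * cnj (A $ b $ k))"
  shows "covector_sq H' \<alpha>' = covector_sq H \<alpha>"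
proof -
  define cA where "cA = (\<chi> a b. cnj (A $ a $ b))"
  have fac: "H' = transpose A ** (H ** cA)"
    unfolding Finite_Cartesian_Product.vec_eq_iff
    by (simp add: H' cA_def matrix_matrix_mult_def transpose_def sum_distrib_left algebra_simps)
  have detA: "Determinants.det A \<noteq> 0"
    using assms(2) unfolding fac invertible_det_nz by (auto simp: det_mul)
  define \<beta>' where "\<beta>' = matrix_inv H' *v (\<chi> j. cnj (\<alpha>' $ j))"
  define \<beta> where "\<beta> = cA *v \<beta>'"
  have b': "H' *v \<beta>' = (\<chi> j. cnj (\<alpha>' $ j))"
    by (simp add: \<beta>'_def matrix_vector_mul_assoc matrix_inv_left_right[OF assms(2)])
  have "transpose A *v (H *v \<beta>) = transpose A *v (\<chi> j. cnj (\<alpha> $ j))"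
  proof -
    have "transpose A *v (H *v \<beta>) = H' *v \<beta>'"
      by (simp add: fac \<beta>_def matrix_vector_mul_assoc matrix_mul_assoc)
    also have "\<dots> = transpose A *v (\<chi> j. cnj (\<alpha> $ j))"
      unfolding b' by (simp add: Finite_Cartesian_Product.vec_eq_iff \<alpha>' matrix_vector_mult_def transpose_def mult.commute)
    finally show ?thesis .
  qed
  moreover have "invertible (transpose A)" using detA by (simp add: invertible_det_nz Determinants.det_transpose)
  ultimately have b: "H *v \<beta> = (\<chi> j. cnj (\<alpha> $ j))"
    by (metis matrix_inv_left_right(2) matrix_vector_mul_assoc matrix_vector_mul_lid)
  have "covector_sq H \<alpha> = Re (\<Sum>k\<in>UNIV. \<alpha> $ k * \<beta> $ k)"
    by (rule covector_sq_pairing[OF assms(1) b])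
  also have "(\<Sum>k\<in>UNIV. \<alpha> $ k * \<beta> $ k) = (\<Sum>k\<in>UNIV. \<Sum>l\<in>UNIV. \<alpha> $ k * cnj (A $ k $ l) * \<beta>' $ l)"
    by (simp add: \<beta>_def cA_def matrix_vector_mult_def sum_distrib_left algebra_simps)
  also have "\<dots> = (\<Sum>l\<in>UNIV. \<alpha>' $ l * \<beta>' $ l)"
    by (subst sum.swap) (simp add: \<alpha>' sum_distrib_right)
  also have "Re \<dots> = covector_sq H' \<alpha>'"
    by (rule covector_sq_pairing[OF assms(2) b', symmetric])
  finally show ?thesis by simp
qed

section \<open>Charts, the Levi form and its transformation law\<close>

locale compact_line_bundle =
  fixes X :: "('z::t2_space, 'n::finite, 'i) line_bundle"
  assumes compact_space: "compact (UNIV :: 'z set)"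
    and manifold: "complex_manifold X"
    and holo_bundle: "holomorphic_line_bundle X"
begin

abbreviation V :: "'i \<Rightarrow> (complex^'n) set" where "V i \<equiv> chart X i ` cdom X i"

lemma open_cdom: "open (cdom X i)"
  and open_V: "open (V i)"
  and chart_homeo: "homeomorphism (cdom X i) (V i) (chart X i) (chart_inv X i)"
  using manifold unfolding complex_manifold_def by blast+

lemma chart_inv_chart: "p \<in> cdom X i \<Longrightarrow> chart_inv X i (chart X i p) = p"
  using chart_homeo[of i] unfolding homeomorphism_def by blast

lemma chart_chart_inv: "x \<in> V i \<Longrightarrow> chart X i (chart_inv X i x) = x"
  using chart_homeo[of i] unfolding homeomorphism_def by blast

lemma chart_inv_in: "x \<in> V i \<Longrightarrow> chart_inv X i x \<in> cdom X i"
  using chart_homeo[of i] unfolding homeomorphism_def by blast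

lemma continuous_chart_inv: "continuous_on (V i) (chart_inv X i)"
  and continuous_chart: "continuous_on (cdom X i) (chart X i)"
  using chart_homeo[of i] unfolding homeomorphism_def by blast+

lemma cdom_cover: obtains i where "p \<in> cdom X i"
proof -
  have "p \<in> (\<Union>i. cdom X i)" using manifold unfolding complex_manifold_def by auto
  then show ?thesis using that by blast
qed

lemma open_overlap: "open (chart X i ` (cdom X j \<inter> cdom X i))"
proof -
  have "openin (top_of_set (cdom X i)) (cdom X j \<inter> cdom X i)"
    using open_cdom by (auto intro: open_subset)
  then have "openin (top_of_set (V i)) (chart X i ` (cdom X j \<inter> cdom X i))"
    using homeomorphism_imp_open_map[OF chart_homeo] by blast
  then show ?thesis using open_V openin_open_trans by blast
qed

lemma transition:
  "holomorphic_in (\<lambda>x. chart X j (chart_inv X i x) $ k) (chart X i ` (cdom X j \<inter> cdom X i))"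
  using manifold unfolding complex_manifold_def by blast

lemma metrics_smooth: "\<phi> \<in> metrics X \<Longrightarrow> smooth_on (\<lambda>x. \<phi> i (chart_inv X i x)) (V i)"
  by (simp add: metrics_def)

lemma levi_at: "x \<in> V i \<Longrightarrow> levi X \<phi> i (chart_inv X i x) $ j $ k
    = pd j (pdbar k (\<lambda>x. of_real (\<phi> i (chart_inv X i x)))) x"
  by (simp add: levi_def chart_chart_inv)

lemma smooth_on_levi:
  assumes "\<phi> \<in> metrics X"
  shows "smooth_on (\<lambda>x. levi X \<phi> i (chart_inv X i x) $ j $ k) (V i)"
proof (rule smooth_on_cong_open[OF open_V])
  show "smooth_on (pd j (pdbar k (\<lambda>x. of_real (\<phi> i (chart_inv X i x))))) (V i)"
    by (intro smooth_on_pd open_V smooth_on_of_real metrics_smooth assms)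
qed (simp add: levi_at)

lemma smooth_functionsD: "\<mu> \<in> smooth_functions X \<Longrightarrow> smooth_on (\<lambda>x. \<mu> (chart_inv X i x)) (V i)"
  by (simp add: smooth_functions_def)

lemma dbar_fun_at: "x \<in> V i \<Longrightarrow> dbar_fun X \<mu> i (chart_inv X i x) $ k
    = pdbar k (\<lambda>x. of_real (\<mu> (chart_inv X i x))) x"
  by (simp add: dbar_fun_def chart_chart_inv)

lemma smooth_on_dbar_fun:
  assumes "\<mu> \<in> smooth_functions X"
  shows "smooth_on (\<lambda>x. dbar_fun X \<mu> i (chart_inv X i x) $ k) (V i)"
proof (rule smooth_on_cong_open[OF open_V])
  show "smooth_on (pdbar k (\<lambda>x. of_real (\<mu> (chart_inv X i x)))) (V i)"
    by (intro smooth_on_pd open_V smooth_on_of_real smooth_functionsD assms)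
qed (simp add: dbar_fun_at)

text \<open>
  In the overlap the weights are related by \<open>\<phi>\<^sub>i = \<phi>\<^sub>j - ln |g\<^sub>j\<^sub>i|\<^sup>2\<close>; the last term is pluriharmonic, and the
  second derivatives of the holomorphic transition map do not enter \<open>\<partial>\<partial>\<close>-bar of a composition.
\<close>

lemma levi_transform:
  assumes \<phi>: "\<phi> \<in> metrics X" and p: "p \<in> cdom X i" "p \<in> cdom X j"
  shows "levi X \<phi> i p $ k $ l = (\<Sum>a\<in>UNIV. \<Sum>b\<in>UNIV. levi X \<phi> j p $ a $ b *
    jacobian X j i p $ a $ k * cnj (jacobian X j i p $ b $ l))"
proof -
  define W where "W = chart X i ` (cdom X j \<inter> cdom X i)"
  define g where "g x = chart X j (chart_inv X i x)" for x
  define c where "c x = cocycle X j i (chart_inv X i x)" for x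
  define f where "f x = complex_of_real (\<phi> j (chart_inv X j x))" for x
  define x where "x = chart X i p"
  have W: "open W" "x \<in> W" using open_overlap p by (auto simp: W_def x_def)
  have inW: "chart_inv X i y \<in> cdom X j \<inter> cdom X i" "g y \<in> V j" "chart_inv X j (g y) = chart_inv X i y"
    if "y \<in> W" for y
    using that chart_inv_chart by (auto simp: W_def g_def)
  have hg: "holomorphic_in (\<lambda>x. g x $ b) W" for b
    using transition by (simp add: g_def W_def)
  have hc: "holomorphic_in c W"
    using holo_bundle unfolding holomorphic_line_bundle_def by (simp add: c_def[abs_def] W_def)
  have nz: "c y \<noteq> 0" if "y \<in> W" for y
    using holo_bundle inW(1)[OF that] unfolding holomorphic_line_bundle_def by (auto simp: c_def)
  define m where "m x = complex_of_real (ln ((cmod (c x))\<^sup>2))" for x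
  have sf: "smooth_on f (V j)"
    unfolding f_def[abs_def] by (intro smooth_on_of_real open_V metrics_smooth \<phi>)
  have eq: "complex_of_real (\<phi> i (chart_inv X i y)) = f (g y) - m y" if "y \<in> W" for y
  proof -
    have "\<phi> j (chart_inv X i y) = \<phi> i (chart_inv X i y) + ln ((cmod (c y))\<^sup>2)"
      using \<phi> inW(1)[OF that] unfolding metrics_def c_def by blast
    then show ?thesis using inW(3)[OF that] by (simp add: f_def m_def)
  qed
  have gd: "(\<lambda>y. g y $ b) differentiable at y" "pdbar l (\<lambda>y. g y $ b) y = 0" if "y \<in> W" for y b l
    using hg that by (auto intro: smooth_on_differentiable holomorphic_in_smooth holomorphic_in_pdbar)
  define G where "G b l = pd l (\<lambda>y. g y $ b)" for b l
  have hG: "holomorphic_in (G b l) W" for b l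
    unfolding G_def by (intro holomorphic_in_pd W hg)
  have Gd: "G b l differentiable at y" if "y \<in> W" for y b l
    using hG that by (auto intro: smooth_on_differentiable holomorphic_in_smooth)
  have Gdc: "(\<lambda>y. cnj (G b l y)) differentiable at y" if "y \<in> W" for y b l
    using Gd[OF that] has_derivative_cnj unfolding differentiable_def by blast
  have first: "pdbar l (\<lambda>y. complex_of_real (\<phi> i (chart_inv X i y))) y
      = (\<Sum>b\<in>UNIV. pdbar b f (g y) * cnj (G b l y)) - pdbar l m y" if y: "y \<in> W" for y
  proof -
    have "f differentiable at (g y)"
      using smooth_on_differentiable[OF sf inW(2)[OF y]] .
    note ch = pd_compose_holomorphic[OF this gd[OF y]]
    have md: "m differentiable at y"
      unfolding m_def[abs_def] using pdbar_ln_cmod(2)[OF W(1) hc nz y] by simp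
    have "pdbar l (\<lambda>y. complex_of_real (\<phi> i (chart_inv X i y))) y = pdbar l (\<lambda>y. f (g y) - m y) y"
      by (rule pd_cong_open(2)[OF W(1) y eq])
    also have "\<dots> = pdbar l (\<lambda>y. f (g y)) y - pdbar l m y"
      by (rule pd_diff(2)[OF ch(3) md])
    also have "\<dots> = (\<Sum>b\<in>UNIV. pdbar b f (g y) * cnj (G b l y)) - pdbar l m y"
      by (simp add: ch(2) G_def)
    finally show ?thesis .
  qed
  have d1: "pdbar b f differentiable at (g x)" for b
    using smooth_on_differentiable[OF smooth_on_pd(2)[OF open_V sf] inW(2)[OF W(2)]] .
  note ch1 = pd_compose_holomorphic[OF d1 gd[OF W(2)]]
  have d2: "(\<lambda>y. pdbar b f (g y) * cnj (G b l y)) differentiable at x" for b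
    using ch1(3) Gdc[OF W(2)] by (intro differentiable_mult)
  have m2: "pd k (pdbar l m) x = 0" "pdbar l m differentiable at x"
    unfolding m_def[abs_def] using levi_ln_cmod[OF W(1) hc nz W(2)] by auto
  have "levi X \<phi> i p $ k $ l = pd k (pdbar l (\<lambda>y. complex_of_real (\<phi> i (chart_inv X i y)))) x"
    by (simp add: levi_def x_def)
  also have "\<dots> = pd k (\<lambda>y. (\<Sum>b\<in>UNIV. pdbar b f (g y) * cnj (G b l y)) - pdbar l m y) x"
    by (rule pd_cong_open(1)[OF W first])
  also have "\<dots> = (\<Sum>b\<in>UNIV. pd k (\<lambda>y. pdbar b f (g y) * cnj (G b l y)) x)"
    using d2 m2 by (simp add: pd_diff differentiable_sum pd_sum)
  also have "\<dots> = (\<Sum>b\<in>UNIV. \<Sum>a\<in>UNIV. pd a (pdbar b f) (g x) * G a k x * cnj (G b l x))"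
  proof (rule sum.cong[OF refl])
    fix b
    have "pd k (\<lambda>y. cnj (G b l y)) x = 0"
      by (simp add: pd_cnj(1)[OF Gd[OF W(2)]] holomorphic_in_pdbar[OF hG W(2)])
    then show "pd k (\<lambda>y. pdbar b f (g y) * cnj (G b l y)) x
      = (\<Sum>a\<in>UNIV. pd a (pdbar b f) (g x) * G a k x * cnj (G b l x))"
      using pd_mult(1)[OF ch1(3) Gdc[OF W(2)], of k b b l]
      by (simp add: ch1(1) G_def sum_distrib_right)
  qed
  also have "\<dots> = (\<Sum>a\<in>UNIV. \<Sum>b\<in>UNIV. pd a (pdbar b f) (g x) * G a k x * cnj (G b l x))"
    by (rule sum.swap)
  also have "\<dots> = (\<Sum>a\<in>UNIV. \<Sum>b\<in>UNIV. levi X \<phi> j p $ a $ b *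
      jacobian X j i p $ a $ k * cnj (jacobian X j i p $ b $ l))"
    using p by (simp add: levi_def jacobian_def G_def g_def[abs_def] f_def[abs_def] x_def chart_inv_chart)
  finally show ?thesis .
qed

lemma dbar_fun_transform:
  assumes \<mu>: "\<mu> \<in> smooth_functions X" and p: "p \<in> cdom X i" "p \<in> cdom X j"
  shows "dbar_fun X \<mu> i p $ k = (\<Sum>b\<in>UNIV. dbar_fun X \<mu> j p $ b * cnj (jacobian X j i p $ b $ k))"
proof -
  define W where "W = chart X i ` (cdom X j \<inter> cdom X i)"
  define g where "g x = chart X j (chart_inv X i x)" for x
  define f where "f x = complex_of_real (\<mu> (chart_inv X j x))" for x
  define x where "x = chart X i p"
  have W: "open W" "x \<in> W" using open_overlap p by (auto simp: W_def x_def)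
  have inW: "g y \<in> V j" "chart_inv X j (g y) = chart_inv X i y" if "y \<in> W" for y
    using that chart_inv_chart by (auto simp: W_def g_def)
  have hg: "holomorphic_in (\<lambda>x. g x $ b) W" for b
    using transition by (simp add: g_def W_def)
  have sf: "smooth_on f (V j)"
    unfolding f_def[abs_def] by (intro smooth_on_of_real open_V smooth_functionsD \<mu>)
  have gd: "(\<lambda>y. g y $ b) differentiable at x" "pdbar l (\<lambda>y. g y $ b) x = 0" for b l
    using hg W(2) by (auto intro: smooth_on_differentiable holomorphic_in_smooth holomorphic_in_pdbar)
  have "dbar_fun X \<mu> i p $ k = pdbar k (\<lambda>y. complex_of_real (\<mu> (chart_inv X i y))) x"
    by (simp add: dbar_fun_def x_def)
  also have "\<dots> = pdbar k (\<lambda>y. f (g y)) x"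
    by (rule pd_cong_open(2)[OF W]) (simp add: f_def inW)
  also have "\<dots> = (\<Sum>b\<in>UNIV. pdbar b f (g x) * cnj (pd k (\<lambda>y. g y $ b) x))"
    by (rule pd_compose_holomorphic(2)[OF smooth_on_differentiable[OF sf inW(1)[OF W(2)]] gd])
  also have "\<dots> = (\<Sum>b\<in>UNIV. dbar_fun X \<mu> j p $ b * cnj (jacobian X j i p $ b $ k))"
    using p by (simp add: dbar_fun_def jacobian_def g_def[abs_def] f_def[abs_def] x_def chart_inv_chart)
  finally show ?thesis .
qed

lemma pos_metrics_iff: "\<phi> \<in> pos_metrics X \<longleftrightarrow>
    \<phi> \<in> metrics X \<and> (\<forall>i. \<forall>p\<in>cdom X i. herm_pos (levi X \<phi> i p))"
  by (simp add: pos_metrics_def herm_pos_def)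

lemma levi_invertible: "\<phi> \<in> pos_metrics X \<Longrightarrow> p \<in> cdom X i \<Longrightarrow> invertible (levi X \<phi> i p)"
  by (simp add: pos_metrics_iff herm_pos_invertible)

text \<open>
  The chart in the definition of \<^const>\<open>dbar_sq\<close> is chosen separately at each point. By the transformation laws the value is
  the same in every chart, which is why \<^const>\<open>dbar_sq\<close> is smooth.
\<close>

lemma dbar_sq_chart:
  assumes \<phi>: "\<phi> \<in> pos_metrics X" and \<mu>: "\<mu> \<in> smooth_functions X" and p: "p \<in> cdom X i"
  shows "dbar_sq X \<phi> \<mu> p = covector_sq (levi X \<phi> i p) (dbar_fun X \<mu> i p)"
proof -
  define j where "j = (SOME j. p \<in> cdom X j)"
  have j: "p \<in> cdom X j" unfolding j_def by (rule cdom_cover[of p]) (rule someI)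
  have m: "\<phi> \<in> metrics X" using \<phi> by (simp add: pos_metrics_iff)
  have "covector_sq (levi X \<phi> i p) (dbar_fun X \<mu> i p) = covector_sq (levi X \<phi> j p) (dbar_fun X \<mu> j p)"
    by (rule covector_sq_transform[where A = "jacobian X j i p"])
      (use levi_invertible[OF \<phi>] p j levi_transform[OF m p j] dbar_fun_transform[OF \<mu> p j] in auto)
  then show ?thesis by (simp add: dbar_sq_def j_def Let_def)
qed

lemma smooth_on_covector_ip:
  assumes \<phi>: "\<phi> \<in> pos_metrics X" and \<mu>: "\<mu> \<in> smooth_functions X" "\<nu> \<in> smooth_functions X"
  shows "smooth_on (\<lambda>x. covector_ip (levi X \<phi> i (chart_inv X i x))
    (dbar_fun X \<mu> i (chart_inv X i x)) (dbar_fun X \<nu> i (chart_inv X i x))) (V i)"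
proof -
  have m: "\<phi> \<in> metrics X" using \<phi> by (simp add: pos_metrics_iff)
  show ?thesis
    unfolding covector_ip_def
    by (intro smooth_on_divide smooth_on_Re smooth_on_sum smooth_on_mult smooth_on_add smooth_on_cnj
        smooth_on_const smooth_on_matrix_inv smooth_on_levi smooth_on_dbar_fun open_V \<mu> m
        levi_invertible[OF \<phi>] chart_inv_in) simp
qed

lemma dbar_sq_smooth:
  assumes \<phi>: "\<phi> \<in> pos_metrics X" and \<mu>: "\<mu> \<in> smooth_functions X"
  shows "dbar_sq X \<phi> \<mu> \<in> smooth_functions X"
  unfolding smooth_functions_def
proof (intro CollectI allI)
  fix i
  show "smooth_on (\<lambda>x. dbar_sq X \<phi> \<mu> (chart_inv X i x)) (V i)"
    by (rule smooth_on_cong_open[OF open_V _ smooth_on_covector_ip[OF \<phi> \<mu> \<mu>]])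
      (simp add: dbar_sq_chart[OF \<phi> \<mu> chart_inv_in] covector_ip_same)
qed

text \<open>
  Positivity at a point can be checked in any one chart: the two Levi forms differ by the Jacobian of the transition map,
  and this is injective because a vector in its kernel would be a null vector of the positive form \<open>levi X \<phi> i p\<close>.
\<close>

lemma herm_pos_transfer:
  assumes \<phi>: "\<phi> \<in> metrics X" and \<phi>': "\<phi>' \<in> metrics X" and p: "p \<in> cdom X i" "p \<in> cdom X j"
    and pos: "herm_pos (levi X \<phi> i p)" and pos': "herm_pos (levi X \<phi>' j p)"
  shows "herm_pos (levi X \<phi>' i p)"
  unfolding herm_pos_def
proof (intro allI impI)
  fix w :: "complex^'n" assume w: "w \<noteq> 0"
  define A where "A = jacobian X j i p"
  have form: "(\<Sum>k\<in>UNIV. \<Sum>l\<in>UNIV. levi X \<phi> i p $ k $ l * w $ k * cnj (w $ l))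
     = (\<Sum>a\<in>UNIV. \<Sum>b\<in>UNIV. levi X \<phi> j p $ a $ b * (A *v w) $ a * cnj ((A *v w) $ b))"
    if \<phi>: "\<phi> \<in> metrics X" for \<phi>
  proof -
    have "(\<Sum>k\<in>UNIV. \<Sum>l\<in>UNIV. levi X \<phi> i p $ k $ l * w $ k * cnj (w $ l))
      = (\<Sum>k\<in>UNIV. \<Sum>l\<in>UNIV. \<Sum>a\<in>UNIV. \<Sum>b\<in>UNIV.
          levi X \<phi> j p $ a $ b * (A $ a $ k * w $ k) * (cnj (A $ b $ l) * cnj (w $ l)))"
      unfolding levi_transform[OF \<phi> p] A_def sum_distrib_right
      by (intro sum.cong refl) (simp add: algebra_simps)
    also have "\<dots> = (\<Sum>k\<in>UNIV. \<Sum>a\<in>UNIV. \<Sum>b\<in>UNIV. \<Sum>l\<in>UNIV.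
          levi X \<phi> j p $ a $ b * (A $ a $ k * w $ k) * (cnj (A $ b $ l) * cnj (w $ l)))"
      by (rule sum.cong[OF refl], rule trans[OF sum.swap], rule sum.cong[OF refl], rule sum.swap)
    also have "\<dots> = (\<Sum>a\<in>UNIV. \<Sum>b\<in>UNIV. \<Sum>k\<in>UNIV. \<Sum>l\<in>UNIV.
          levi X \<phi> j p $ a $ b * (A $ a $ k * w $ k) * (cnj (A $ b $ l) * cnj (w $ l)))"
      by (rule trans[OF sum.swap], rule sum.cong[OF refl], rule sum.swap)
    also have "\<dots> = (\<Sum>a\<in>UNIV. \<Sum>b\<in>UNIV. levi X \<phi> j p $ a $ b * (A *v w) $ a * cnj ((A *v w) $ b))"
      by (rule sum.cong[OF refl], rule sum.cong[OF refl], rule trans[OF sum.swap])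
        (simp add: matrix_vector_mult_def sum_distrib_left sum_distrib_right mult.assoc)
    finally show ?thesis .
  qed
  have "0 < Re (\<Sum>k\<in>UNIV. \<Sum>l\<in>UNIV. levi X \<phi> i p $ k $ l * w $ k * cnj (w $ l))"
    using pos w unfolding herm_pos_def by blast
  then have "A *v w \<noteq> 0" unfolding form[OF \<phi>] by auto
  then show "0 < Re (\<Sum>k\<in>UNIV. \<Sum>l\<in>UNIV. levi X \<phi>' i p $ k $ l * w $ k * cnj (w $ l))"
    using pos' unfolding form[OF \<phi>'] herm_pos_def by blast
qed

end

section \<open>Integration of top degree forms\<close>

lemma set_integrable_continuous_compact:
  fixes f :: "'a::euclidean_space \<Rightarrow> 'b::{banach, second_countable_topology}"
  shows "compact K \<Longrightarrow> continuous_on K f \<Longrightarrow> set_integrable lborel K f"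
  unfolding set_integrable_def by (rule borel_integrable_compact)

text \<open>
  By the mean value theorem the error of the first order expansion of \<open>f\<close> is at most \<open>|s - s0|\<close> times the oscillation of \<open>f'\<close>
  in \<open>s\<close>, which is uniformly small on \<open>K\<close> by uniform continuity on a compact neighbourhood.
\<close>

lemma set_integral_has_vector_derivative:
  fixes f f' :: "real \<Rightarrow> 'a::euclidean_space \<Rightarrow> complex"
  assumes K: "compact K" and J: "open J" "s0 \<in> J"
    and cf: "\<And>s. s \<in> J \<Longrightarrow> continuous_on K (f s)"
    and cf': "continuous_on (J \<times> K) (\<lambda>(s, y). f' s y)"
    and df: "\<And>s y. s \<in> J \<Longrightarrow> y \<in> K \<Longrightarrow> ((\<lambda>s. f s y) has_vector_derivative f' s y) (at s)"
  shows "((\<lambda>s. LINT y:K|lborel. f s y) has_vector_derivative (LINT y:K|lborel. f' s0 y)) (at s0)"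
  unfolding has_vector_derivative_def has_derivative_at_alt
proof (intro conjI allI impI)
  show "bounded_linear (\<lambda>x. x *\<^sub>R (LINT y:K|lborel. f' s0 y))" by (rule bounded_linear_scaleR_left)
  fix e :: real assume e: "e > 0"
  define m where "m = measure lborel K"
  have m: "m \<ge> 0" by (simp add: m_def)
  define e' where "e' = e / (m + 1)"
  have e': "e' > 0" "m * e' \<le> e" using e m by (auto simp: e'_def field_simps)
  obtain r where r: "r > 0" "cball s0 r \<subseteq> J" using J open_contains_cball by blast
  have "compact (cball s0 r \<times> K)" by (intro compact_Times compact_cball K)
  moreover have "continuous_on (cball s0 r \<times> K) (\<lambda>(s, y). f' s y)"
    by (rule continuous_on_subset[OF cf']) (use r in auto)
  ultimately have "uniformly_continuous_on (cball s0 r \<times> K) (\<lambda>(s, y). f' s y)"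
    by (rule compact_uniformly_continuous[rotated])
  then obtain d where d: "d > 0" "\<And>x x'. x \<in> cball s0 r \<times> K \<Longrightarrow> x' \<in> cball s0 r \<times> K \<Longrightarrow>
      dist x' x < d \<Longrightarrow> dist ((\<lambda>(s, y). f' s y) x') ((\<lambda>(s, y). f' s y) x) < e'"
    unfolding uniformly_continuous_on_def using e'(1) by meson
  have f'b: "norm (f' s y - f' s0 y) \<le> e'" if "\<bar>s - s0\<bar> < min d r" "y \<in> K" for s y
    using d(2)[of "(s0, y)" "(s, y)"] that r by (auto simp: dist_Pair_Pair dist_norm abs_minus_commute)
  have f'c: "continuous_on K (f' s0)"
    using continuous_on_compose2[OF cf' continuous_on_Pair[OF continuous_on_const[of K s0] continuous_on_id[of K]]] J(2)
    by auto
  show "\<exists>d>0. \<forall>s. norm (s - s0) < d \<longrightarrow>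
      norm ((LINT y:K|lborel. f s y) - (LINT y:K|lborel. f s0 y) - (s - s0) *\<^sub>R (LINT y:K|lborel. f' s0 y))
      \<le> e * norm (s - s0)"
  proof (intro exI[of _ "min d r"] conjI allI impI)
    show "min d r > 0" using d r by simp
    fix s assume "norm (s - s0) < min d r"
    then have s: "\<bar>s - s0\<bar> < min d r" by simp
    define S where "S = ball s0 (min d r)"
    have SJ: "S \<subseteq> J" "s \<in> S" "s0 \<in> S" using r s d by (auto simp: S_def dist_real_def)
    have bound: "norm (f s y - f s0 y - (s - s0) *\<^sub>R f' s0 y) \<le> norm (s - s0) * e'" if y: "y \<in> K" for y
    proof (rule vector_differentiable_bound_linearization[where S = S])
      show "((\<lambda>s. f s y) has_vector_derivative f' t y) (at t within S)" if "t \<in> S" for t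
        using df[of t y] that SJ y by (auto intro: has_vector_derivative_at_within)
      show "closed_segment s0 s \<subseteq> S" using SJ unfolding S_def by (intro closed_segment_subset) auto
      show "norm (f' t y - f' s0 y) \<le> e'" if "t \<in> S" for t
        by (rule f'b) (use that y in \<open>auto simp: S_def dist_real_def\<close>)
    qed (use SJ in auto)
    have c: "continuous_on K (f s)" "continuous_on K (f s0)" using cf SJ by auto
    have c2: "continuous_on K (\<lambda>y. f s y - f s0 y - (s - s0) *\<^sub>R f' s0 y)"
      by (intro continuous_intros c f'c)
    have "(LINT y:K|lborel. f s y) - (LINT y:K|lborel. f s0 y) - (s - s0) *\<^sub>R (LINT y:K|lborel. f' s0 y)
        = (LINT y:K|lborel. f s y - f s0 y - (s - s0) *\<^sub>R f' s0 y)"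
      using c f'c K by (simp add: set_integral_diff set_integrable_continuous_compact continuous_intros)
    also have "norm \<dots> \<le> (LINT y:K|lborel. norm (f s y - f s0 y - (s - s0) *\<^sub>R f' s0 y))"
      by (intro set_integral_norm_bound set_integrable_continuous_compact K c2)
    also have "\<dots> \<le> (LINT y:K|lborel. norm (s - s0) * e')"
      using bound by (intro set_integral_mono set_integrable_continuous_compact K continuous_intros c f'c) auto
    also have "\<dots> = m * (norm (s - s0) * e')"
      using emeasure_compact_finite[OF K] K by (subst set_integral_const) (auto simp: m_def compact_imp_closed)
    also have "\<dots> \<le> e * norm (s - s0)"
      using mult_right_mono[OF e'(2), of "norm (s - s0)"] by (simp add: mult.commute mult.left_commute)
    finally show "norm ((LINT y:K|lborel. f s y) - (LINT y:K|lborel. f s0 y)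
        - (s - s0) *\<^sub>R (LINT y:K|lborel. f' s0 y)) \<le> e * norm (s - s0)" .
  qed
qed

context compact_line_bundle
begin

text \<open>
  A tent function in the coordinates of a chart, extended by zero. The extension is continuous because the preimage of a
  closed coordinate ball is compact, hence closed in the Hausdorff space.
\<close>

lemma ex_bump:
  fixes p :: 'z
  obtains i b C where "p \<in> cdom X i" "continuous_on UNIV b" "\<And>q. 0 \<le> b q" "0 < (b p :: real)"
    "closed C" "C \<subseteq> cdom X i" "{q. b q \<noteq> 0} \<subseteq> C"
proof -
  obtain i where p: "p \<in> cdom X i" by (rule cdom_cover)
  obtain r where r: "r > 0" "cball (chart X i p) r \<subseteq> V i"
    using open_V open_contains_cball p by blast
  define C where "C = chart_inv X i ` cball (chart X i p) r"
  define b where "b q = (if q \<in> cdom X i then max 0 (r - dist (chart X i q) (chart X i p)) else 0)" for q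
  have "compact C"
    unfolding C_def by (intro compact_continuous_image continuous_on_subset[OF continuous_chart_inv] r compact_cball)
  then have C: "closed C" by (rule compact_imp_closed)
  have Csub: "C \<subseteq> cdom X i" unfolding C_def using r(2) chart_inv_in by blast
  have zero: "b q = 0" if "q \<notin> C" for q
  proof (cases "q \<in> cdom X i")
    case True
    have "chart X i q \<notin> cball (chart X i p) r"
      using that chart_inv_chart[OF True] unfolding C_def by (metis imageI)
    then show ?thesis using True by (simp add: b_def dist_commute)
  qed (simp add: b_def)
  have "continuous_on (cdom X i) b"
    by (subst continuous_on_cong[OF refl, of _ _ "\<lambda>q. max 0 (r - dist (chart X i q) (chart X i p))"])
      (auto simp: b_def intro!: continuous_intros continuous_chart)
  moreover have "continuous_on (- C) b"
    by (subst continuous_on_cong[OF refl, of _ _ "\<lambda>_. 0"]) (auto simp: zero)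
  ultimately have "continuous_on (cdom X i \<union> - C) b"
    using open_cdom C by (intro continuous_on_open_Un) auto
  moreover have "cdom X i \<union> - C = UNIV" using Csub by blast
  ultimately have "continuous_on UNIV b" by simp
  moreover have "0 \<le> b q" for q by (simp add: b_def)
  moreover have "0 < b p" using r(1) p by (simp add: b_def)
  moreover have "{q. b q \<noteq> 0} \<subseteq> C" using zero by blast
  ultimately show ?thesis using that[OF p _ _ _ C Csub] by blast
qed

text \<open>
  By compactness finitely many tents have a positive sum. Since the partition is indexed by charts, tents that belong to the
  same chart are added up.
\<close>

lemma ex_partition_of_unity: "\<exists>P. partition_of_unity X P"
proof -
  have "\<forall>p. \<exists>i b C. p \<in> cdom X i \<and> continuous_on UNIV b \<and> (\<forall>q. 0 \<le> b q) \<and> 0 < (b p :: real) \<and>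
      closed C \<and> C \<subseteq> cdom X i \<and> {q. b q \<noteq> 0} \<subseteq> C"
    using ex_bump by metis
  then obtain i b C where B: "\<And>p. p \<in> cdom X (i p)" "\<And>p. continuous_on UNIV (b p)" "\<And>p q. 0 \<le> b p q"
     "\<And>p. 0 < (b p p :: real)" "\<And>p. closed (C p)" "\<And>p. C p \<subseteq> cdom X (i p)" "\<And>p. {q. b p q \<noteq> 0} \<subseteq> C p"
    by metis
  have op: "open {q. 0 < b p q}" for p
    by (intro open_Collect_less continuous_on_const B(2))
  have cov: "UNIV \<subseteq> (\<Union>p\<in>UNIV. {q. 0 < b p q})" using B(4) by auto
  obtain P where P: "finite P" "UNIV \<subseteq> (\<Union>p\<in>P. {q. 0 < b p q})"
    by (rule compactE_image[OF compact_space op cov])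
  define s where "s q = (\<Sum>p\<in>P. b p q)" for q
  have s: "s q > 0" for q
  proof -
    obtain p where "p \<in> P" "0 < b p q" using P(2) by blast
    then show ?thesis unfolding s_def using P(1) B(3) by (intro sum_pos2) auto
  qed
  define \<eta> where "\<eta> j q = (\<Sum>p\<in>{p\<in>P. i p = j}. b p q) / s q" for j q
  have "partition_of_unity X (i ` P, \<eta>)"
    unfolding partition_of_unity_def prod.case
  proof (intro conjI ballI allI)
    show "finite (i ` P)" using P by simp
    show "continuous_on UNIV (\<eta> j)" for j
      unfolding \<eta>_def s_def[abs_def] using s
      by (intro continuous_intros B(2)) (simp add: s_def less_imp_neq[symmetric])
    show "0 \<le> \<eta> j q" for j q
      unfolding \<eta>_def using s[of q] B(3) by (intro divide_nonneg_pos sum_nonneg) auto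
    show "closure {p. \<eta> j p \<noteq> 0} \<subseteq> cdom X j" for j
    proof -
      have "{q. \<eta> j q \<noteq> 0} \<subseteq> (\<Union>p\<in>{p\<in>P. i p = j}. C p)"
      proof
        fix q assume "q \<in> {q. \<eta> j q \<noteq> 0}"
        then have "(\<Sum>p\<in>{p\<in>P. i p = j}. b p q) \<noteq> 0" by (auto simp: \<eta>_def)
        then obtain p where "p \<in> P" "i p = j" "b p q \<noteq> 0" by (metis (mono_tags, lifting) mem_Collect_eq sum.neutral)
        then show "q \<in> (\<Union>p\<in>{p\<in>P. i p = j}. C p)" using B(7) by blast
      qed
      moreover have "closed (\<Union>p\<in>{p\<in>P. i p = j}. C p)" using P(1) B(5) by (intro closed_UN) auto
      ultimately have "closure {q. \<eta> j q \<noteq> 0} \<subseteq> (\<Union>p\<in>{p\<in>P. i p = j}. C p)" by (rule closure_minimal)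
      then show ?thesis using B(6) by blast
    qed
    show "(\<Sum>j\<in>i ` P. \<eta> j q) = 1" for q
    proof -
      have "(\<Sum>j\<in>i ` P. \<eta> j q) = (\<Sum>j\<in>i ` P. \<Sum>p\<in>{p\<in>P. i p = j}. b p q) / s q"
        by (simp add: \<eta>_def sum_divide_distrib)
      also have "(\<Sum>j\<in>i ` P. \<Sum>p\<in>{p\<in>P. i p = j}. b p q) = s q"
        unfolding s_def by (rule sum.image_gen[OF P(1), symmetric])
      finally show ?thesis using s[of q] by simp
    qed
  qed
  then show ?thesis ..
qed

definition pou_index :: "'i set" where "pou_index = fst (SOME P. partition_of_unity X P)"
definition pou :: "'i \<Rightarrow> 'z \<Rightarrow> real" where "pou = snd (SOME P. partition_of_unity X P)"

lemma pou_partition: "partition_of_unity X (pou_index, pou)"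
  unfolding pou_index_def pou_def prod.collapse by (rule someI_ex[OF ex_partition_of_unity])

lemma finite_pou_index: "finite pou_index"
  and continuous_pou: "i \<in> pou_index \<Longrightarrow> continuous_on UNIV (pou i)"
  and pou_nonneg: "i \<in> pou_index \<Longrightarrow> 0 \<le> pou i p"
  and closure_pou: "i \<in> pou_index \<Longrightarrow> closure {p. pou i p \<noteq> 0} \<subseteq> cdom X i"
  and sum_pou: "(\<Sum>i\<in>pou_index. pou i p) = 1"
  using pou_partition unfolding partition_of_unity_def by auto

text \<open>
  The partition function of a chart has compact support in the chart domain. All integrals are therefore over
  compact subsets of \<open>\<complex>\<^sup>n\<close>, on which continuous integrands are integrable and can be differentiated under the integral.
\<close>

definition pou_supp :: "'i \<Rightarrow> (complex^'n) set" where
  "pou_supp i = chart X i ` closure {p. pou i p \<noteq> 0}"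

definition pou_weight :: "'i \<Rightarrow> complex^'n \<Rightarrow> real" where
  "pou_weight i x = 2 ^ CARD('n) * pou i (chart_inv X i x)"

lemma compact_pou_supp:
  assumes "i \<in> pou_index"
  shows "compact (pou_supp i)"
proof -
  have "compact (closure {p. pou i p \<noteq> 0})"
    using compact_Int_closed[OF compact_space closed_closure[of "{p. pou i p \<noteq> 0}"]] by simp
  then show ?thesis
    unfolding pou_supp_def
    by (rule compact_continuous_image[OF continuous_on_subset[OF continuous_chart closure_pou[OF assms]]])
qed

lemma pou_supp_subset: "i \<in> pou_index \<Longrightarrow> pou_supp i \<subseteq> V i"
  unfolding pou_supp_def using closure_pou by blast

lemma continuous_pou_weight: "i \<in> pou_index \<Longrightarrow> continuous_on (V i) (pou_weight i)"
  unfolding pou_weight_def[abs_def]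
  by (intro continuous_intros continuous_on_compose2[OF continuous_pou continuous_chart_inv]) auto

lemma pou_weight_zero:
  assumes "i \<in> pou_index" "x \<in> V i" "x \<notin> pou_supp i"
  shows "pou_weight i x = 0"
proof -
  have "chart_inv X i x \<notin> closure {p. pou i p \<noteq> 0}"
  proof
    assume "chart_inv X i x \<in> closure {p. pou i p \<noteq> 0}"
    then have "chart X i (chart_inv X i x) \<in> pou_supp i" unfolding pou_supp_def by (rule imageI)
    then show False using assms(2,3) by (simp add: chart_chart_inv)
  qed
  then have "chart_inv X i x \<notin> {p. pou i p \<noteq> 0}"
    using closure_subset[of "{p. pou i p \<noteq> 0}"] by blast
  then show ?thesis by (simp add: pou_weight_def)
qed

lemma form_integral_eq:
  "form_integral X \<rho> = (\<Sum>i\<in>pou_index. LINT x:pou_supp i|lborel. of_real (pou_weight i x) * \<rho> i (chart_inv X i x))"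
proof -
  have "form_integral X \<rho> = (\<Sum>i\<in>pou_index. LINT x:V i|lborel. of_real (pou_weight i x) * \<rho> i (chart_inv X i x))"
    by (simp add: form_integral_def pou_index_def pou_def pou_weight_def split_beta)
  also have "\<dots> = (\<Sum>i\<in>pou_index. LINT x:pou_supp i|lborel. of_real (pou_weight i x) * \<rho> i (chart_inv X i x))"
  proof (rule sum.cong[OF refl])
    fix i assume i: "i \<in> pou_index"
    have "indicator (V i) x *\<^sub>R (of_real (pou_weight i x) * \<rho> i (chart_inv X i x))
        = indicator (pou_supp i) x *\<^sub>R (of_real (pou_weight i x) * \<rho> i (chart_inv X i x))" for x
      using pou_weight_zero[OF i, of x] pou_supp_subset[OF i] by (auto simp: indicator_def)
    then show "(LINT x:V i|lborel. of_real (pou_weight i x) * \<rho> i (chart_inv X i x))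
      = (LINT x:pou_supp i|lborel. of_real (pou_weight i x) * \<rho> i (chart_inv X i x))"
      unfolding set_lebesgue_integral_def by (simp only:)
  qed
  finally show ?thesis .
qed

definition chart_continuous :: "('i \<Rightarrow> 'z \<Rightarrow> complex) \<Rightarrow> bool" where
  "chart_continuous \<rho> \<longleftrightarrow> (\<forall>i. continuous_on (V i) (\<lambda>x. \<rho> i (chart_inv X i x)))"

lemma chart_continuous_mult:
  "chart_continuous \<rho> \<Longrightarrow> chart_continuous \<sigma> \<Longrightarrow> chart_continuous (\<lambda>i p. \<rho> i p * \<sigma> i p)"
  unfolding chart_continuous_def by (intro allI continuous_intros) auto

lemma chart_continuous_const: "chart_continuous (\<lambda>i p. c)"
  unfolding chart_continuous_def by (intro allI continuous_intros)

lemma chart_continuous_cnj: "chart_continuous \<rho> \<Longrightarrow> chart_continuous (\<lambda>i p. cnj (\<rho> i p))"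
  unfolding chart_continuous_def by (intro allI continuous_intros) auto

lemma chart_continuous_sum:
  "(\<And>j. j \<in> A \<Longrightarrow> chart_continuous (\<rho> j)) \<Longrightarrow> chart_continuous (\<lambda>i p. \<Sum>j\<in>A. \<rho> j i p)"
  unfolding chart_continuous_def by (intro allI continuous_intros) auto

lemma form_integrand_integrable:
  assumes "i \<in> pou_index" "chart_continuous \<rho>"
  shows "set_integrable lborel (pou_supp i) (\<lambda>x. of_real (pou_weight i x) * \<rho> i (chart_inv X i x))"
proof (intro set_integrable_continuous_compact compact_pou_supp assms(1) continuous_intros)
  show "continuous_on (pou_supp i) (pou_weight i)" "continuous_on (pou_supp i) (\<lambda>x. \<rho> i (chart_inv X i x))"
    using assms continuous_on_subset[OF _ pou_supp_subset] continuous_pou_weight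
    unfolding chart_continuous_def by blast+
qed

lemma form_integral_cong:
  assumes "\<And>i p. p \<in> cdom X i \<Longrightarrow> \<rho> i p = \<sigma> i p"
  shows "form_integral X \<rho> = form_integral X \<sigma>"
  unfolding form_integral_eq
proof (rule sum.cong[OF refl], rule set_lebesgue_integral_cong)
  fix i assume i: "i \<in> pou_index"
  show "pou_supp i \<in> sets lborel" using compact_pou_supp[OF i] by (simp add: compact_imp_closed)
  show "\<forall>x. x \<in> pou_supp i \<longrightarrow> complex_of_real (pou_weight i x) * \<rho> i (chart_inv X i x)
      = complex_of_real (pou_weight i x) * \<sigma> i (chart_inv X i x)"
    using assms chart_inv_in pou_supp_subset[OF i] by fastforce
qed

lemma form_integral_add:
  assumes "chart_continuous \<rho>" "chart_continuous \<sigma>"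
  shows "form_integral X (\<lambda>i p. \<rho> i p + \<sigma> i p) = form_integral X \<rho> + form_integral X \<sigma>"
  unfolding form_integral_eq sum.distrib[symmetric]
  by (rule sum.cong[OF refl]) (simp add: distrib_left set_integral_add form_integrand_integrable assms)

lemma form_integral_cmult: "form_integral X (\<lambda>i p. c * \<rho> i p) = c * form_integral X \<rho>"
  unfolding form_integral_eq sum_distrib_left
  by (rule sum.cong[OF refl]) (simp add: mult.left_commute[of _ c])

lemma form_integral_zero: "form_integral X (\<lambda>i p. 0) = 0"
  by (simp add: form_integral_eq set_lebesgue_integral_def)

lemma form_integral_sum:
  assumes "\<And>j. j \<in> A \<Longrightarrow> chart_continuous (\<rho> j)"
  shows "form_integral X (\<lambda>i p. \<Sum>j\<in>A. \<rho> j i p) = (\<Sum>j\<in>A. form_integral X (\<rho> j))"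
  using assms
  by (induction A rule: infinite_finite_induct)
    (simp_all add: form_integral_zero form_integral_add chart_continuous_sum)

lemma form_integral_cnj: "form_integral X (\<lambda>i p. cnj (\<rho> i p)) = cnj (form_integral X \<rho>)"
proof -
  have "(LINT x:pou_supp i|lborel. of_real (pou_weight i x) * cnj (\<rho> i (chart_inv X i x)))
    = cnj (LINT x:pou_supp i|lborel. of_real (pou_weight i x) * \<rho> i (chart_inv X i x))" for i
    unfolding set_lebesgue_integral_def by (subst Bochner_Integration.integral_cnj[symmetric]) simp
  then show ?thesis unfolding form_integral_eq by simp
qed

lemma form_integral_of_real:
  "form_integral X (\<lambda>i p. of_real (r i p)) = of_real (\<Sum>i\<in>pou_index. LINT x:pou_supp i|lborel. pou_weight i x * r i (chart_inv X i x))"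
  unfolding form_integral_eq of_real_sum
  by (rule sum.cong[OF refl]) (simp flip: set_integral_complex_of_real of_real_mult)

text \<open>
  If the integral vanishes, then so does each continuous integrand \<open>\<eta>\<^sub>i r\<^sub>i\<close>; at every point some \<open>\<eta>\<^sub>i\<close> is positive, and there \<open>r\<^sub>i\<close>
  is zero.
\<close>

lemma
  assumes "chart_continuous (\<lambda>i p. of_real (r i p))" and r: "\<And>i p. 0 \<le> r i p"
  shows form_integral_nonneg: "0 \<le> Re (form_integral X (\<lambda>i p. of_real (r i p)))"
    and form_integral_eq_0: "form_integral X (\<lambda>i p. of_real (r i p)) = 0 \<Longrightarrow> \<exists>i. p \<in> cdom X i \<and> r i p = 0"
proof -
  define T where "T i = (LINT x:pou_supp i|lborel. pou_weight i x * r i (chart_inv X i x))" for i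
  have rc: "continuous_on (V i) (\<lambda>x. r i (chart_inv X i x))" for i
    using continuous_on_Re[of "V i" "\<lambda>x. of_real (r i (chart_inv X i x))"] assms(1)
    unfolding chart_continuous_def by simp
  have gc: "continuous_on (V i) (\<lambda>x. pou_weight i x * r i (chart_inv X i x))" if "i \<in> pou_index" for i
    by (intro continuous_intros continuous_pou_weight[OF that] rc)
  have gi: "integrable lborel (\<lambda>x. indicator (pou_supp i) x *\<^sub>R (pou_weight i x * r i (chart_inv X i x)))" if "i \<in> pou_index" for i
    using borel_integrable_compact[OF compact_pou_supp[OF that] continuous_on_subset[OF gc pou_supp_subset]] that by blast
  have g0: "0 \<le> indicator (pou_supp i) x *\<^sub>R (pou_weight i x * r i (chart_inv X i x))" if "i \<in> pou_index" for i x
    using r pou_nonneg[OF that] by (simp add: pou_weight_def)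
  have T0: "0 \<le> T i" if "i \<in> pou_index" for i
    unfolding T_def set_lebesgue_integral_def using g0[OF that] by (intro Bochner_Integration.integral_nonneg) auto
  have eq: "form_integral X (\<lambda>i p. of_real (r i p)) = of_real (\<Sum>i\<in>pou_index. T i)"
    by (simp add: form_integral_of_real T_def)
  show "0 \<le> Re (form_integral X (\<lambda>i p. of_real (r i p)))"
    unfolding eq using T0 by (simp add: sum_nonneg)
  assume "form_integral X (\<lambda>i p. of_real (r i p)) = 0"
  then have "(\<Sum>i\<in>pou_index. T i) = 0" unfolding eq by (simp flip: of_real_sum)
  then have Tz: "T i = 0" if "i \<in> pou_index" for i
    using T0 that finite_pou_index by (simp add: sum_nonneg_eq_0_iff)
  have "(\<Sum>i\<in>pou_index. pou i p) \<noteq> 0" using sum_pou by simp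
  then obtain i where i: "i \<in> pou_index" "pou i p \<noteq> 0" by (meson sum.neutral)
  have p: "p \<in> cdom X i" using closure_pou[OF i(1)] closure_subset[of "{p. pou i p \<noteq> 0}"] i(2) by blast
  define S where "S = {x \<in> V i. pou_weight i x * r i (chart_inv X i x) \<in> - {0}}"
  have "S = V i \<inter> (\<lambda>x. pou_weight i x * r i (chart_inv X i x)) -` (- {0})" by (auto simp: S_def)
  then have "open S"
    using continuous_open_preimage[OF gc[OF i(1)] open_V open_Compl[OF closed_singleton]] by metis
  have "AE x in lborel. indicator (pou_supp i) x *\<^sub>R (pou_weight i x * r i (chart_inv X i x)) = 0"
    using Tz[OF i(1)] integral_nonneg_eq_0_iff_AE[OF gi[OF i(1)]] g0[OF i(1)]
    unfolding T_def set_lebesgue_integral_def by auto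
  then have "AE x in lborel. x \<notin> S"
  proof eventually_elim
    case (elim x)
    then show ?case using pou_weight_zero[OF i(1)] by (auto simp: S_def indicator_def split: if_splits)
  qed
  then have "S \<in> null_sets lborel" using AE_iff_null_sets[of S lborel] \<open>open S\<close> by simp
  then have "negligible S" by (simp add: negligible_iff_null_sets null_sets_completionI)
  then have "S = {}" using open_not_negligible[OF \<open>open S\<close>] by blast
  then have "pou_weight i (chart X i p) * r i (chart_inv X i (chart X i p)) = 0"
    using p unfolding S_def by blast
  then have "r i p = 0" using i(2) chart_inv_chart[OF p] by (simp add: pou_weight_def)
  then show "\<exists>i. p \<in> cdom X i \<and> r i p = 0" using p by blast
qed

lemma form_integral_has_vector_derivative:
  assumes J: "open J" "s0 \<in> J"
    and c: "\<And>s. s \<in> J \<Longrightarrow> chart_continuous (\<rho> s)"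
    and c': "\<And>i. continuous_on (J \<times> V i) (\<lambda>(s, x). \<rho>' s i (chart_inv X i x))"
    and d: "\<And>s i p. s \<in> J \<Longrightarrow> p \<in> cdom X i \<Longrightarrow> ((\<lambda>s. \<rho> s i p) has_vector_derivative \<rho>' s i p) (at s)"
  shows "((\<lambda>s. form_integral X (\<rho> s)) has_vector_derivative form_integral X (\<rho>' s0)) (at s0)"
  unfolding form_integral_eq
proof (rule has_vector_derivative_sum, rule set_integral_has_vector_derivative)
  fix i assume i: "i \<in> pou_index"
  show "compact (pou_supp i)" by (rule compact_pou_supp[OF i])
  show "open J" "s0 \<in> J" by (fact J)+
  have w: "continuous_on (pou_supp i) (pou_weight i)"
    using continuous_on_subset[OF continuous_pou_weight[OF i] pou_supp_subset[OF i]] .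
  show "continuous_on (pou_supp i) (\<lambda>x. of_real (pou_weight i x) * \<rho> s i (chart_inv X i x))" if "s \<in> J" for s
    using c[OF that] continuous_on_subset[OF _ pou_supp_subset[OF i]]
    by (intro continuous_intros w) (auto simp: chart_continuous_def)
  have "continuous_on (J \<times> pou_supp i) (\<lambda>z. pou_weight i (snd z))"
    by (rule continuous_on_compose2[OF w continuous_on_snd[OF continuous_on_id]]) auto
  moreover have "continuous_on (J \<times> pou_supp i) (\<lambda>(s, x). \<rho>' s i (chart_inv X i x))"
    by (rule continuous_on_subset[OF c']) (use pou_supp_subset[OF i] in auto)
  ultimately show "continuous_on (J \<times> pou_supp i) (\<lambda>(s, x). of_real (pou_weight i x) * \<rho>' s i (chart_inv X i x))"
    unfolding split_beta by (intro continuous_intros)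
  show "((\<lambda>s. of_real (pou_weight i x) * \<rho> s i (chart_inv X i x)) has_vector_derivative
      of_real (pou_weight i x) * \<rho>' s i (chart_inv X i x)) (at s)" if "s \<in> J" "x \<in> pou_supp i" for s x
    using d[OF that(1)] chart_inv_in pou_supp_subset[OF i] that(2)
    by (intro has_vector_derivative_mult_right) blast
qed

end

section \<open>Derivatives of determinants and inverse matrices\<close>

abbreviation fmat :: "nat \<Rightarrow> (nat \<Rightarrow> nat \<Rightarrow> 'a) \<Rightarrow> 'a Matrix.mat" where
  "fmat N G \<equiv> Matrix.mat N N (\<lambda>(j, k). G j k)"

definition fmat_inv :: "nat \<Rightarrow> (nat \<Rightarrow> nat \<Rightarrow> complex) \<Rightarrow> nat \<Rightarrow> nat \<Rightarrow> complex" where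
  "fmat_inv N G j k = cofactor (fmat N G) k j / Determinant.det (fmat N G)"

lemma det_fmat: "Determinant.det (fmat N G) =
    (\<Sum>p | p permutes {0..<N}. signof p * (\<Prod>i=0..<N. G i (p i)))"
  unfolding Determinant.det_def by (auto intro!: sum.cong prod.cong simp: permutes_in_image)

lemma fmat_inv_left:
  assumes "Determinant.det (fmat N G) \<noteq> 0" "j < N" "l < N"
  shows "(\<Sum>k<N. fmat_inv N G j k * G k l) = (if j = l then 1 else 0)"
proof -
  have A: "fmat N G \<in> carrier_mat N N" by simp
  have "(adj_mat (fmat N G) * fmat N G) $$ (j, l) = (Determinant.det (fmat N G) \<cdot>\<^sub>m 1\<^sub>m N) $$ (j, l)"
    by (simp only: adj_mat(3)[OF A])
  then have "(\<Sum>k<N. cofactor (fmat N G) k j * G k l) = (if j = l then Determinant.det (fmat N G) else 0)"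
    using assms by (simp add: adj_mat_def times_mat_def scalar_prod_def atLeast0LessThan)
  then show ?thesis
    using assms(1) by (simp add: fmat_inv_def flip: sum_divide_distrib)
qed

lemma fmat_inv_one:
  assumes "Determinant.det (fmat N G) \<noteq> 0"
    and one: "\<And>j k. j < N \<Longrightarrow> k < N \<Longrightarrow> G j k = (if j = k then 1 else 0)" and jl: "j < N" "l < N"
  shows "fmat_inv N G j l = (if j = l then 1 else 0)"
proof -
  have "(\<Sum>k<N. fmat_inv N G j k * G k l) = (\<Sum>k<N. if k = l then fmat_inv N G j l else 0)"
    using jl by (intro sum.cong) (auto simp: one)
  also have "\<dots> = fmat_inv N G j l" using jl by simp
  finally show ?thesis using fmat_inv_left[OF assms(1) jl] by simp
qed

text \<open>
  Jacobi's formula: by the product rule in Leibniz' formula the derivative is the sum of the determinants in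
  which one row has been differentiated, and each of these is expanded along that row.
\<close>

lemma det_has_vector_derivative:
  fixes G :: "real \<Rightarrow> nat \<Rightarrow> nat \<Rightarrow> complex"
  assumes G: "\<And>j k. j < N \<Longrightarrow> k < N \<Longrightarrow> ((\<lambda>s. G s j k) has_vector_derivative G' j k) (at x)"
  shows "((\<lambda>s. Determinant.det (fmat N (G s))) has_vector_derivative
      (\<Sum>i<N. \<Sum>j<N. G' i j * cofactor (fmat N (G x)) i j)) (at x)"
proof -
  define P where "P = {p. p permutes {0..<N}}"
  define R where "R i = fmat N (\<lambda>a b. if a = i then G' i b else G x a b)" for i
  have p_lt: "p i < N" if "p \<in> P" "i < N" for p i
    using that permutes_in_image[of p "{0..<N}" i] by (auto simp: P_def)
  have detR: "Determinant.det (R i) = (\<Sum>p\<in>P. signof p * (G' i (p i) * (\<Prod>a\<in>{0..<N} - {i}. G x a (p a))))"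
    if i: "i < N" for i
    unfolding R_def det_fmat P_def
  proof (intro sum.cong refl arg_cong2[of _ _ _ _ "(*)"])
    fix p
    have "(\<Prod>a = 0..<N. if a = i then G' i (p a) else G x a (p a))
      = (if i = i then G' i (p i) else G x i (p i)) * (\<Prod>a\<in>{0..<N} - {i}. if a = i then G' i (p a) else G x a (p a))"
      by (rule prod.remove) (use i in auto)
    also have "\<dots> = G' i (p i) * (\<Prod>a\<in>{0..<N} - {i}. G x a (p a))"
      by (auto intro!: prod.cong)
    finally show "(\<Prod>a = 0..<N. if a = i then G' i (p a) else G x a (p a))
      = G' i (p i) * (\<Prod>a\<in>{0..<N} - {i}. G x a (p a))" .
  qed
  have lap: "Determinant.det (R i) = (\<Sum>j<N. G' i j * cofactor (fmat N (G x)) i j)" if i: "i < N" for i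
  proof -
    have "Determinant.det (R i) = (\<Sum>j<N. R i $$ (i, j) * cofactor (R i) i j)"
      by (rule laplace_expansion_row) (use i in \<open>auto simp: R_def\<close>)
    also have "\<dots> = (\<Sum>j<N. G' i j * cofactor (fmat N (G x)) i j)"
    proof (rule sum.cong[OF refl])
      fix j assume j: "j \<in> {..<N}"
      have "mat_delete (R i) i j = mat_delete (fmat N (G x)) i j"
        by (rule eq_matI) (use i j in \<open>auto simp: mat_delete_def R_def\<close>)
      then show "R i $$ (i, j) * cofactor (R i) i j = G' i j * cofactor (fmat N (G x)) i j"
        using i j by (simp add: cofactor_def) (simp add: R_def)
    qed
    finally show ?thesis .
  qed
  have "((\<lambda>s. \<Sum>p\<in>P. signof p * (\<Prod>i=0..<N. G s i (p i))) has_vector_derivative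
     (\<Sum>p\<in>P. signof p * (\<Sum>i=0..<N. G' i (p i) * (\<Prod>a\<in>{0..<N} - {i}. G x a (p a))))) (at x)"
  proof (intro has_vector_derivative_sum has_vector_derivative_mult_right)
    fix p assume p: "p \<in> P"
    have "((\<lambda>s. \<Prod>i=0..<N. G s i (p i)) has_derivative
        (\<lambda>y. \<Sum>i=0..<N. y *\<^sub>R G' i (p i) * (\<Prod>a\<in>{0..<N} - {i}. G x a (p a)))) (at x)"
      by (rule has_derivative_prod) (use G p_lt[OF p] in \<open>auto simp: has_vector_derivative_def\<close>)
    then show "((\<lambda>s. \<Prod>i=0..<N. G s i (p i)) has_vector_derivative
        (\<Sum>i=0..<N. G' i (p i) * (\<Prod>a\<in>{0..<N} - {i}. G x a (p a)))) (at x)"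
      by (simp add: has_vector_derivative_def scaleR_sum_right)
  qed
  moreover have "(\<Sum>p\<in>P. signof p * (\<Sum>i=0..<N. G' i (p i) * (\<Prod>a\<in>{0..<N} - {i}. G x a (p a))))
      = (\<Sum>i=0..<N. \<Sum>p\<in>P. signof p * (G' i (p i) * (\<Prod>a\<in>{0..<N} - {i}. G x a (p a))))"
    unfolding sum_distrib_left by (rule sum.swap)
  moreover have "\<dots> = (\<Sum>i<N. \<Sum>j<N. G' i j * cofactor (fmat N (G x)) i j)"
  proof (rule sum.cong)
    fix i assume "i \<in> {..<N}"
    then show "(\<Sum>p\<in>P. signof p * (G' i (p i) * (\<Prod>a\<in>{0..<N} - {i}. G x a (p a))))
        = (\<Sum>j<N. G' i j * cofactor (fmat N (G x)) i j)"
      using detR[of i] lap[of i] by simp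
  qed auto
  ultimately show ?thesis
    unfolding det_fmat P_def by simp
qed

lemma det_has_vector_derivative_trace:
  fixes G :: "real \<Rightarrow> nat \<Rightarrow> nat \<Rightarrow> complex"
  assumes "\<And>j k. j < N \<Longrightarrow> k < N \<Longrightarrow> ((\<lambda>s. G s j k) has_vector_derivative G' j k) (at x)"
    and "Determinant.det (fmat N (G x)) \<noteq> 0"
  shows "((\<lambda>s. Determinant.det (fmat N (G s))) has_vector_derivative
      Determinant.det (fmat N (G x)) * (\<Sum>i<N. \<Sum>j<N. G' i j * fmat_inv N (G x) j i)) (at x)"
proof -
  have "(\<Sum>i<N. \<Sum>j<N. G' i j * cofactor (fmat N (G x)) i j)
     = Determinant.det (fmat N (G x)) * (\<Sum>i<N. \<Sum>j<N. G' i j * fmat_inv N (G x) j i)"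
    unfolding sum_distrib_left using assms(2) by (simp add: fmat_inv_def)
  then show ?thesis using det_has_vector_derivative[of N G G' x, OF assms(1)] by simp
qed

text \<open>
  The cofactors are determinants of submatrices, indexed through the maps \<open>\<sigma>\<close> that skip the deleted row or column.
\<close>

lemma fmat_inv_differentiable:
  fixes G :: "real \<Rightarrow> nat \<Rightarrow> nat \<Rightarrow> complex"
  assumes G: "\<And>j k. j < N \<Longrightarrow> k < N \<Longrightarrow> ((\<lambda>s. G s j k) has_vector_derivative G' j k) (at x)"
    and nz: "Determinant.det (fmat N (G x)) \<noteq> 0" and "j < N" "k < N"
  shows "(\<lambda>s. fmat_inv N (G s) j k) differentiable (at x)"
proof -
  define \<sigma> where "\<sigma> m i = (if i < m then i else Suc i)" for m i :: nat
  have \<sigma>: "\<sigma> m i < N" if "i < N - 1" for m i using that by (auto simp: \<sigma>_def)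
  have "mat_delete (fmat N (G s)) k j = fmat (N - 1) (\<lambda>a b. G s (\<sigma> k a) (\<sigma> j b))" for s
    by (rule eq_matI) (auto simp: mat_delete_def \<sigma>_def)
  moreover have "(\<lambda>s. Determinant.det (fmat (N - 1) (\<lambda>a b. G s (\<sigma> k a) (\<sigma> j b)))) differentiable (at x)"
    by (rule differentiableI_vector, rule det_has_vector_derivative[where G' = "\<lambda>a b. G' (\<sigma> k a) (\<sigma> j b)"])
      (intro G \<sigma>)
  moreover have "(\<lambda>s. Determinant.det (fmat N (G s))) differentiable (at x)"
    by (rule differentiableI_vector, rule det_has_vector_derivative[of N G G' x, OF G])
  ultimately show ?thesis
    unfolding fmat_inv_def cofactor_def using nz by (auto intro!: differentiable_divide differentiable_mult)
qed

text \<open>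
  Differentiate \<open>G\<^sup>-\<^sup>1 G = 1\<close> where \<open>G = 1\<close>.
\<close>

lemma fmat_inv_derivative_at_one:
  fixes G :: "real \<Rightarrow> nat \<Rightarrow> nat \<Rightarrow> complex"
  assumes J: "open J" "x \<in> J" and nz: "\<And>s. s \<in> J \<Longrightarrow> Determinant.det (fmat N (G s)) \<noteq> 0"
    and G: "\<And>j k. j < N \<Longrightarrow> k < N \<Longrightarrow> ((\<lambda>s. G s j k) has_vector_derivative G' j k) (at x)"
    and one: "\<And>j k. j < N \<Longrightarrow> k < N \<Longrightarrow> G x j k = (if j = k then 1 else 0)" and jl: "j < N" "l < N"
  shows "((\<lambda>s. fmat_inv N (G s) j l) has_vector_derivative - G' j l) (at x)"
    and "fmat_inv N (G x) j l = (if j = l then 1 else 0)"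
proof -
  note inv1 = fmat_inv_one[OF nz[OF J(2)] one]
  show "fmat_inv N (G x) j l = (if j = l then 1 else 0)" by (rule inv1[OF _ _ jl])
  define D where "D k = vector_derivative (\<lambda>s. fmat_inv N (G s) j k) (at x)" for k
  have D: "((\<lambda>s. fmat_inv N (G s) j k) has_vector_derivative D k) (at x)" if "k < N" for k
    using fmat_inv_differentiable[OF G nz[OF J(2)] jl(1) that] unfolding D_def
    by (simp add: vector_derivative_works)
  have "((\<lambda>s. \<Sum>k<N. fmat_inv N (G s) j k * G s k l) has_vector_derivative
      (\<Sum>k<N. fmat_inv N (G x) j k * G' k l + D k * G x k l)) (at x)"
    by (intro has_vector_derivative_sum has_vector_derivative_mult D G jl) auto
  moreover have "((\<lambda>s. \<Sum>k<N. fmat_inv N (G s) j k * G s k l) has_vector_derivative 0) (at x)"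
    by (rule has_vector_derivative_transform_within_open[OF has_vector_derivative_const[of "if j = l then 1 else 0"] J])
      (simp add: fmat_inv_left[OF nz jl])
  ultimately have "(\<Sum>k<N. fmat_inv N (G x) j k * G' k l + D k * G x k l) = 0"
    by (rule vector_derivative_unique_at)
  moreover have "(\<Sum>k<N. fmat_inv N (G x) j k * G' k l + D k * G x k l)
      = (\<Sum>k<N. (if k = j then G' j l else 0) + (if k = l then D l else 0))"
    using jl by (intro sum.cong) (auto simp: one inv1)
  ultimately have "G' j l + D l = 0" using jl by (simp add: sum.distrib)
  then have "D l = - G' j l" by (simp add: add_eq_0_iff)
  then show "((\<lambda>s. fmat_inv N (G s) j l) has_vector_derivative - G' j l) (at x)" using D[OF jl(2)] by simp
qed

section \<open>The Hermitian form on sections and orthonormal bases\<close>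

definition mult_form :: "('z \<Rightarrow> real) \<Rightarrow> ('z, 'i) n0form \<Rightarrow> ('z, 'i) n0form" where
  "mult_form \<mu> u = (\<lambda>i p. of_real (\<mu> p) * u i p)"

context compact_line_bundle
begin

lemma n0_smooth: "u \<in> n0_forms X \<Longrightarrow> smooth_on (\<lambda>x. u i (chart_inv X i x)) (V i)"
  and n0_transform: "u \<in> n0_forms X \<Longrightarrow> p \<in> cdom X i \<Longrightarrow> p \<in> cdom X j \<Longrightarrow>
    u i p = cocycle X i j p * Determinants.det (jacobian X j i p) * u j p"
  and n0_outside: "u \<in> n0_forms X \<Longrightarrow> p \<notin> cdom X i \<Longrightarrow> u i p = 0"
  unfolding n0_forms_def by blast+

lemma n0_formsI:
  assumes "\<And>i. smooth_on (\<lambda>x. u i (chart_inv X i x)) (V i)"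
    and "\<And>i j p. p \<in> cdom X i \<Longrightarrow> p \<in> cdom X j \<Longrightarrow>
      u i p = cocycle X i j p * Determinants.det (jacobian X j i p) * u j p"
    and "\<And>i p. p \<notin> cdom X i \<Longrightarrow> u i p = 0"
  shows "u \<in> n0_forms X"
  using assms unfolding n0_forms_def by blast

lemma n0_add:
  assumes "u \<in> n0_forms X" "v \<in> n0_forms X"
  shows "(\<lambda>i p. u i p + v i p) \<in> n0_forms X"
proof (rule n0_formsI)
  show "smooth_on (\<lambda>x. u i (chart_inv X i x) + v i (chart_inv X i x)) (V i)" for i
    by (intro smooth_on_add open_V n0_smooth assms)
  fix i j p assume p: "p \<in> cdom X i" "p \<in> cdom X j"
  show "u i p + v i p = cocycle X i j p * Determinants.det (jacobian X j i p) * (u j p + v j p)"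
    unfolding n0_transform[OF assms(1) p] n0_transform[OF assms(2) p] by (simp add: distrib_left)
qed (simp add: n0_outside[OF assms(1)] n0_outside[OF assms(2)])

lemma n0_scale:
  assumes "u \<in> n0_forms X"
  shows "(\<lambda>i p. c * u i p) \<in> n0_forms X"
proof (rule n0_formsI)
  show "smooth_on (\<lambda>x. c * u i (chart_inv X i x)) (V i)" for i
    by (intro smooth_on_mult smooth_on_const open_V n0_smooth assms)
  fix i j p assume p: "p \<in> cdom X i" "p \<in> cdom X j"
  show "c * u i p = cocycle X i j p * Determinants.det (jacobian X j i p) * (c * u j p)"
    unfolding n0_transform[OF assms(1) p] by simp
qed (simp add: n0_outside[OF assms(1)])

lemma n0_zero: "(\<lambda>i p. 0) \<in> n0_forms X"
  by (intro n0_formsI smooth_on_const) auto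

lemma n0_mult_form:
  assumes "\<mu> \<in> smooth_functions X" "u \<in> n0_forms X"
  shows "mult_form \<mu> u \<in> n0_forms X"
  unfolding mult_form_def
proof (rule n0_formsI)
  show "smooth_on (\<lambda>x. of_real (\<mu> (chart_inv X i x)) * u i (chart_inv X i x)) (V i)" for i
    by (intro smooth_on_mult smooth_on_of_real open_V smooth_functionsD n0_smooth assms)
  fix i j p assume p: "p \<in> cdom X i" "p \<in> cdom X j"
  show "of_real (\<mu> p) * u i p = cocycle X i j p * Determinants.det (jacobian X j i p) * (of_real (\<mu> p) * u j p)"
    unfolding n0_transform[OF assms(2) p] by simp
qed (simp add: n0_outside[OF assms(2)])

lemma H0_iff: "u \<in> H0 X \<longleftrightarrow> u \<in> n0_forms X \<and> (\<forall>i. \<forall>x\<in>V i. \<forall>k. pdbar k (\<lambda>x. u i (chart_inv X i x)) x = 0)"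
  unfolding H0_def holomorphic_in_def using n0_smooth by blast

lemma H0_n0: "u \<in> H0 X \<Longrightarrow> u \<in> n0_forms X"
  by (simp add: H0_iff)

lemma n0_differentiable: "u \<in> n0_forms X \<Longrightarrow> x \<in> V i \<Longrightarrow> (\<lambda>x. u i (chart_inv X i x)) differentiable at x"
  using smooth_on_differentiable n0_smooth by blast

lemma H0_add: "u \<in> H0 X \<Longrightarrow> v \<in> H0 X \<Longrightarrow> (\<lambda>i p. u i p + v i p) \<in> H0 X"
  by (simp add: H0_iff n0_add pd_add n0_differentiable)

lemma H0_scale: "u \<in> H0 X \<Longrightarrow> (\<lambda>i p. c * u i p) \<in> H0 X"
  by (simp add: H0_iff n0_scale pd_cmult n0_differentiable)

lemma n0_diff: "u \<in> n0_forms X \<Longrightarrow> v \<in> n0_forms X \<Longrightarrow> (\<lambda>i p. u i p - v i p) \<in> n0_forms X"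
  using n0_add[of u "\<lambda>i p. (-1) * v i p"] n0_scale[of v "-1"] by simp

lemma H0_diff: "u \<in> H0 X \<Longrightarrow> v \<in> H0 X \<Longrightarrow> (\<lambda>i p. u i p - v i p) \<in> H0 X"
  using H0_add[of u "\<lambda>i p. (-1) * v i p"] H0_scale[of v "-1"] by simp

lemma H0_zero: "(\<lambda>i p. 0) \<in> H0 X"
  by (simp add: H0_iff n0_zero pd_const)

lemma H0_sum: "(\<And>j. j \<in> A \<Longrightarrow> u j \<in> H0 X) \<Longrightarrow> (\<lambda>i p. \<Sum>j\<in>A. u j i p) \<in> H0 X"
  by (induction A rule: infinite_finite_induct) (auto intro: H0_zero H0_add)

lemma H0_lin_comb: "(\<And>j. j < N \<Longrightarrow> h j \<in> H0 X) \<Longrightarrow> lin_comb N h c \<in> H0 X"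
  unfolding lin_comb_def by (intro H0_sum H0_scale) auto

lemma n0_chart_continuous: "u \<in> n0_forms X \<Longrightarrow> chart_continuous u"
  unfolding chart_continuous_def using n0_smooth smooth_on_imp_continuous_on by blast

lemma weight_continuous: "\<phi> \<in> metrics X \<Longrightarrow> chart_continuous (\<lambda>i p. of_real (exp (- \<phi> i p)))"
  unfolding chart_continuous_def
  by (intro allI continuous_intros smooth_on_imp_continuous_on[OF metrics_smooth])

lemma ip_continuous:
  assumes "\<phi> \<in> metrics X" "u \<in> n0_forms X" "v \<in> n0_forms X"
  shows "chart_continuous (\<lambda>i p. u i p * cnj (v i p) * of_real (exp (- \<phi> i p)))"
  by (intro chart_continuous_mult chart_continuous_cnj n0_chart_continuous weight_continuous assms)

lemma ip_add_left:
  assumes "\<phi> \<in> metrics X" "u \<in> n0_forms X" "u' \<in> n0_forms X" "v \<in> n0_forms X"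
  shows "ip X \<phi> (\<lambda>i p. u i p + u' i p) v = ip X \<phi> u v + ip X \<phi> u' v"
  unfolding ip_def distrib_right by (rule form_integral_add) (intro ip_continuous assms)+

lemma ip_scale_left: "ip X \<phi> (\<lambda>i p. c * u i p) v = c * ip X \<phi> u v"
  unfolding ip_def form_integral_cmult[symmetric] by (simp add: mult.assoc)

lemma ip_diff_left:
  assumes "\<phi> \<in> metrics X" "u \<in> n0_forms X" "u' \<in> n0_forms X" "v \<in> n0_forms X"
  shows "ip X \<phi> (\<lambda>i p. u i p - u' i p) v = ip X \<phi> u v - ip X \<phi> u' v"
  using ip_add_left[OF assms(1,2) n0_scale[OF assms(3), of "-1"] assms(4)] ip_scale_left[of \<phi> "-1" u' v]
  by simp

lemma ip_cnj: "ip X \<phi> v u = cnj (ip X \<phi> u v)"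
  unfolding ip_def form_integral_cnj[symmetric] by (simp add: mult.commute)

lemma ip_zero_left: "ip X \<phi> (\<lambda>i p. 0) v = 0"
  by (simp add: ip_def form_integral_zero)

lemma n0_sum: "(\<And>j. j \<in> A \<Longrightarrow> u j \<in> n0_forms X) \<Longrightarrow> (\<lambda>i p. \<Sum>j\<in>A. u j i p) \<in> n0_forms X"
  by (induction A rule: infinite_finite_induct) (auto intro: n0_zero n0_add)

lemma ip_sum_left:
  assumes "\<phi> \<in> metrics X" "v \<in> n0_forms X" "\<And>j. j \<in> A \<Longrightarrow> u j \<in> n0_forms X"
  shows "ip X \<phi> (\<lambda>i p. \<Sum>j\<in>A. u j i p) v = (\<Sum>j\<in>A. ip X \<phi> (u j) v)"
  using assms(3)
  by (induction A rule: infinite_finite_induct) (simp_all add: ip_zero_left ip_add_left assms(1,2) n0_sum)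

lemma ip_lin_comb_left:
  assumes "\<phi> \<in> metrics X" "v \<in> n0_forms X" "\<And>j. j < N \<Longrightarrow> u j \<in> n0_forms X"
  shows "ip X \<phi> (lin_comb N u c) v = (\<Sum>j<N. c j * ip X \<phi> (u j) v)"
proof -
  have "ip X \<phi> (lin_comb N u c) v = (\<Sum>j<N. ip X \<phi> (\<lambda>i p. c j * u j i p) v)"
    unfolding lin_comb_def by (rule ip_sum_left[OF assms(1,2)]) (simp add: n0_scale assms(3))
  then show ?thesis by (simp add: ip_scale_left)
qed

lemma ip_lin_comb_right:
  assumes "\<phi> \<in> metrics X" "v \<in> n0_forms X" "\<And>j. j < N \<Longrightarrow> u j \<in> n0_forms X"
  shows "ip X \<phi> v (lin_comb N u c) = (\<Sum>j<N. cnj (c j) * ip X \<phi> v (u j))"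
proof -
  have "ip X \<phi> v (lin_comb N u c) = cnj (\<Sum>j<N. c j * ip X \<phi> (u j) v)"
    by (subst ip_cnj) (simp add: ip_lin_comb_left assms)
  also have "\<dots> = (\<Sum>j<N. cnj (c j) * cnj (ip X \<phi> (u j) v))" by simp
  finally show ?thesis by (simp only: ip_cnj[symmetric])
qed

lemma ip_add_right:
  assumes "\<phi> \<in> metrics X" "u \<in> n0_forms X" "u' \<in> n0_forms X" "v \<in> n0_forms X"
  shows "ip X \<phi> v (\<lambda>i p. u i p + u' i p) = ip X \<phi> v u + ip X \<phi> v u'"
  by (subst (1 2 3) ip_cnj) (simp add: ip_add_left assms)

lemma ip_scale_right: "ip X \<phi> v (\<lambda>i p. c * u i p) = cnj c * ip X \<phi> v u"
  by (subst (1 2) ip_cnj) (simp add: ip_scale_left)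

text \<open>
  For definiteness: a section of norm zero has at each point one vanishing local representative, and then all of them vanish
  by the transformation rule.
\<close>

lemma
  assumes "\<phi> \<in> metrics X" "u \<in> n0_forms X"
  shows ip_self_real: "ip X \<phi> u u = of_real (norm_sq_n0 X \<phi> u)"
    and norm_sq_n0_nonneg: "0 \<le> norm_sq_n0 X \<phi> u"
    and norm_sq_n0_eq_0: "norm_sq_n0 X \<phi> u = 0 \<Longrightarrow> u = (\<lambda>i p. 0)"
proof -
  have eq: "u i p * cnj (u i p) * of_real (exp (- \<phi> i p)) = of_real ((cmod (u i p))\<^sup>2 * exp (- \<phi> i p))" for i p
    unfolding of_real_mult complex_norm_square ..
  have ip: "ip X \<phi> u u = form_integral X (\<lambda>i p. of_real ((cmod (u i p))\<^sup>2 * exp (- \<phi> i p)))"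
    unfolding ip_def eq ..
  have cc: "chart_continuous (\<lambda>i p. of_real ((cmod (u i p))\<^sup>2 * exp (- \<phi> i p)))"
    using ip_continuous[OF assms(1,2,2)] unfolding eq .
  show r: "ip X \<phi> u u = of_real (norm_sq_n0 X \<phi> u)"
    unfolding norm_sq_n0_def ip form_integral_of_real by simp
  show "0 \<le> norm_sq_n0 X \<phi> u"
    unfolding norm_sq_n0_def ip by (rule form_integral_nonneg[OF cc]) simp
  assume "norm_sq_n0 X \<phi> u = 0"
  then have z: "form_integral X (\<lambda>i p. of_real ((cmod (u i p))\<^sup>2 * exp (- \<phi> i p))) = 0"
    using r ip by simp
  show "u = (\<lambda>i p. 0)"
  proof (intro ext)
    fix i p
    obtain j where j: "p \<in> cdom X j" "(cmod (u j p))\<^sup>2 * exp (- \<phi> j p) = 0"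
      using form_integral_eq_0[OF cc _ z, of p] by auto
    then show "u i p = 0"
      using n0_transform[OF assms(2) _ j(1), of i] n0_outside[OF assms(2)] by (cases "p \<in> cdom X i") auto
  qed
qed

lemma basis_H0: "is_basis X N h \<Longrightarrow> j < N \<Longrightarrow> h j \<in> H0 X"
  by (simp add: is_basis_def)

lemma basis_expand:
  assumes "is_basis X N h" "u \<in> H0 X"
  obtains c where "u = lin_comb N h c"
  using assms unfolding is_basis_def by blast

lemma basis_unique:
  assumes h: "is_basis X N h" and eq: "lin_comb N h c = lin_comb N h d" and "j < N"
  shows "c j = d j"
proof -
  define r where "r c j = (if j < N then c j else 0)" for c :: "nat \<Rightarrow> complex" and j
  have r: "lin_comb N h (r c) = lin_comb N h c" for c
    unfolding lin_comb_def r_def by simp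
  have "lin_comb N h c \<in> H0 X" by (intro H0_lin_comb basis_H0[OF h])
  then have "\<exists>!e. (\<forall>j\<ge>N. e j = 0) \<and> lin_comb N h c = lin_comb N h e"
    using h unfolding is_basis_def by blast
  then obtain e where e: "\<And>f. (\<forall>j\<ge>N. f j = 0) \<and> lin_comb N h c = lin_comb N h f \<Longrightarrow> f = e"
    by (elim ex1E) blast
  have "r c = e" by (rule e) (simp add: r, simp add: r_def)
  moreover have "r d = e" by (rule e) (simp add: r eq, simp add: r_def)
  ultimately have "r c = r d" by simp
  then show ?thesis using assms(3) unfolding r_def by meson
qed

lemma coord_lin_comb:
  assumes h: "is_basis X N h" and "j < N"
  shows "coord N h (lin_comb N h c) j = c j"
proof -
  have "lin_comb N h c \<in> H0 X" by (intro H0_lin_comb basis_H0[OF h])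
  then have ex: "\<exists>!d. (\<forall>j\<ge>N. d j = 0) \<and> lin_comb N h c = lin_comb N h d"
    using h unfolding is_basis_def by blast
  have "lin_comb N h (coord N h (lin_comb N h c)) = lin_comb N h c"
    using theI'[OF ex] unfolding coord_def by simp
  then show ?thesis by (rule basis_unique[OF h _ assms(2)])
qed

lemma lin_comb_cong: "(\<And>j. j < N \<Longrightarrow> c j = d j) \<Longrightarrow> (\<And>j. j < N \<Longrightarrow> u j = v j) \<Longrightarrow> lin_comb N u c = lin_comb N v d"
  by (simp add: lin_comb_def)

lemma lin_comb_lin_comb:
  "lin_comb M (\<lambda>j. lin_comb N h (a j)) c = lin_comb N h (\<lambda>k. \<Sum>j<M. c j * a j k)"
proof -
  have "(\<Sum>j<M. c j * (\<Sum>k<N. a j k * h k i p)) = (\<Sum>k<N. (\<Sum>j<M. c j * a j k) * h k i p)" for i p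
    unfolding sum_distrib_left sum_distrib_right by (subst sum.swap) (simp add: mult.assoc)
  then show ?thesis by (simp add: lin_comb_def)
qed

text \<open>Gram-Schmidt; the two span conditions make each step possible and the result a basis.\<close>

lemma ex_orthonormal_basis:
  assumes \<phi>: "\<phi> \<in> metrics X" and h: "is_basis X N h"
  shows "\<exists>u. orthonormal_basis X \<phi> N u"
proof -
  have gs: "\<exists>u. (\<forall>j<m. u j \<in> H0 X) \<and> (\<forall>j<m. \<forall>k<m. ip X \<phi> (u j) (u k) = (if j = k then 1 else 0)) \<and>
      (\<forall>j<m. \<exists>c. h j = lin_comb m u c) \<and> (\<forall>j<m. \<exists>c. u j = lin_comb m h c)" if "m \<le> N" for m
    using that
  proof (induction m)
    case 0
    then show ?case by simp
  next
    case (Suc m)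
    then obtain u where u: "\<And>j. j < m \<Longrightarrow> u j \<in> H0 X"
      "\<And>j k. j < m \<Longrightarrow> k < m \<Longrightarrow> ip X \<phi> (u j) (u k) = (if j = k then 1 else 0)"
      "\<And>j. j < m \<Longrightarrow> \<exists>c. h j = lin_comb m u c" "\<And>j. j < m \<Longrightarrow> \<exists>c. u j = lin_comb m h c"
      by auto
    obtain b where b: "\<And>j. j < m \<Longrightarrow> u j = lin_comb m h (b j)" using u(4) by metis
    have mN: "m < N" using Suc.prems by simp
    note hm = basis_H0[OF h mN]
    define a where "a j = ip X \<phi> (h m) (u j)" for j
    define pr where "pr = lin_comb m u a"
    define r where "r = (\<lambda>i p. h m i p - pr i p)"
    have prH: "pr \<in> H0 X" unfolding pr_def by (intro H0_lin_comb u(1))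
    have rH: "r \<in> H0 X" unfolding r_def by (intro H0_diff prH hm)
    have r_orth: "ip X \<phi> r (u k) = 0" if k: "k < m" for k
    proof -
      have "ip X \<phi> r (u k) = ip X \<phi> (h m) (u k) - ip X \<phi> pr (u k)"
        unfolding r_def using \<phi> hm prH u(1)[OF k] by (intro ip_diff_left H0_n0)
      also have "ip X \<phi> pr (u k) = (\<Sum>j<m. a j * (if j = k then 1 else 0))"
        unfolding pr_def using \<phi> u k by (simp add: ip_lin_comb_left H0_n0)
      also have "\<dots> = a k" using k by (simp add: if_distrib cong: if_cong)
      finally show ?thesis by (simp add: a_def)
    qed
    have pr_h: "pr = lin_comb m h (\<lambda>k. \<Sum>j<m. a j * b j k)"
      unfolding pr_def lin_comb_lin_comb[symmetric] by (rule lin_comb_cong) (simp_all add: b)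
    have "r \<noteq> (\<lambda>i p. 0)"
    proof
      assume "r = (\<lambda>i p. 0)"
      then have "r i p = 0" for i p by (simp add: fun_eq_iff)
      then have hp: "h m i p = pr i p" for i p by (simp add: r_def)
      define c where "c k = (if k < m then \<Sum>j<m. a j * b j k else 0)" for k
      have "lin_comb N h c = pr"
      proof -
        have "(\<Sum>k<N. c k * h k i p) = (\<Sum>k<m. c k * h k i p)" for i p
          by (rule sum.mono_neutral_right) (use mN in \<open>auto simp: c_def\<close>)
        then show ?thesis unfolding pr_h lin_comb_def c_def by simp
      qed
      moreover have "lin_comb N h (\<lambda>k. if k = m then 1 else 0) = h m"
        using mN by (simp add: lin_comb_def if_distrib[where f="\<lambda>c. c * _"] cong: if_cong)
      moreover have "pr = h m" using hp by (intro ext) simp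
      ultimately have "c m = (if m = m then 1 else 0)"
        using basis_unique[OF h _ mN, of c "\<lambda>k. if k = m then 1 else 0"] by simp
      then show False by (simp add: c_def)
    qed
    define n where "n = sqrt (norm_sq_n0 X \<phi> r)"
    have n: "n > 0" "n\<^sup>2 = norm_sq_n0 X \<phi> r"
      using norm_sq_n0_nonneg[OF \<phi> H0_n0[OF rH]] norm_sq_n0_eq_0[OF \<phi> H0_n0[OF rH]] \<open>r \<noteq> (\<lambda>i p. 0)\<close>
      unfolding n_def by (auto simp: order_less_le)
    define e where "e = (\<lambda>i p. of_real (1 / n) * r i p)"
    have eH: "e \<in> H0 X" unfolding e_def by (intro H0_scale rH)
    define u' where "u' = u(m := e)"
    have ee: "ip X \<phi> e e = 1"
    proof -
      have "ip X \<phi> e e = of_real (1 / n) * (of_real (1 / n) * of_real (n\<^sup>2))"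
        unfolding e_def ip_scale_left ip_scale_right n(2) ip_self_real[OF \<phi> H0_n0[OF rH]] by simp
      then show ?thesis using n(1) by (simp add: power2_eq_square)
    qed
    have eu: "ip X \<phi> e (u k) = 0" "ip X \<phi> (u k) e = 0" if "k < m" for k
    proof -
      show 1: "ip X \<phi> e (u k) = 0" unfolding e_def ip_scale_left using r_orth[OF that] by simp
      show "ip X \<phi> (u k) e = 0" by (subst ip_cnj) (simp add: 1)
    qed
    show ?case
    proof (intro exI[of _ u'] conjI allI impI)
      fix j assume j: "j < Suc m"
      show "u' j \<in> H0 X" using u(1) eH j by (auto simp: u'_def less_Suc_eq)
      show "ip X \<phi> (u' j) (u' k) = (if j = k then 1 else 0)" if "k < Suc m" for k
        using j that u(2) ee eu by (auto simp: u'_def less_Suc_eq)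
      show "\<exists>c. h j = lin_comb (Suc m) u' c"
      proof (cases "j < m")
        case True
        then obtain c where "h j = lin_comb m u c" using u(3) by blast
        then have "h j = lin_comb (Suc m) u' (c(m := 0))" by (simp add: lin_comb_def u'_def)
        then show ?thesis by blast
      next
        case False
        then have "j = m" using j by simp
        have "h m i p = lin_comb (Suc m) u' (a(m := of_real n)) i p" for i p
          using n(1) by (simp add: lin_comb_def u'_def e_def r_def pr_def)
        then have "h j = lin_comb (Suc m) u' (a(m := of_real n))" unfolding \<open>j = m\<close> by (intro ext)
        then show ?thesis by blast
      qed
      show "\<exists>c. u' j = lin_comb (Suc m) h c"
      proof (cases "j < m")
        case True
        then have "u' j = lin_comb (Suc m) h ((b j)(m := 0))" using b by (simp add: lin_comb_def u'_def)
        then show ?thesis by blast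
      next
        case False
        then have "j = m" using j by simp
        have "e i p = lin_comb (Suc m) h ((\<lambda>k. - of_real (1 / n) * (\<Sum>j<m. a j * b j k))(m := of_real (1 / n))) i p" for i p
          by (simp add: e_def r_def pr_h lin_comb_def algebra_simps sum_distrib_left sum_negf)
        then have "u' j = lin_comb (Suc m) h ((\<lambda>k. - of_real (1 / n) * (\<Sum>j<m. a j * b j k))(m := of_real (1 / n)))"
          unfolding \<open>j = m\<close> u'_def fun_upd_same by (intro ext)
        then show ?thesis by blast
      qed
    qed
  qed
  obtain u where u0: "(\<forall>j<N. u j \<in> H0 X) \<and> (\<forall>j<N. \<forall>k<N. ip X \<phi> (u j) (u k) = (if j = k then 1 else 0)) \<and>
      (\<forall>j<N. \<exists>c. h j = lin_comb N u c) \<and> (\<forall>j<N. \<exists>c. u j = lin_comb N h c)"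
    using gs[OF order_refl] by (rule exE)
  then have u: "\<And>j. j < N \<Longrightarrow> u j \<in> H0 X"
      "\<And>j k. j < N \<Longrightarrow> k < N \<Longrightarrow> ip X \<phi> (u j) (u k) = (if j = k then 1 else 0)"
      "\<And>j. j < N \<Longrightarrow> \<exists>c. h j = lin_comb N u c"
    by simp_all
  obtain a where a: "\<And>j. j < N \<Longrightarrow> h j = lin_comb N u (a j)" using u(3) by metis
  have coeff: "ip X \<phi> (lin_comb N u c) (u k) = c k" if "k < N" for c k
  proof -
    have "ip X \<phi> (lin_comb N u c) (u k) = (\<Sum>j<N. c j * (if j = k then 1 else 0))"
      using \<phi> u that by (simp add: ip_lin_comb_left H0_n0)
    then show ?thesis using that by (simp add: if_distrib cong: if_cong)
  qed
  have "is_basis X N u"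
    unfolding is_basis_def
  proof (intro conjI allI impI ballI)
    fix w assume "w \<in> H0 X"
    then obtain c where "w = lin_comb N h c" using basis_expand[OF h] by blast
    also have "\<dots> = lin_comb N u (\<lambda>k. \<Sum>j<N. c j * a j k)"
      unfolding lin_comb_lin_comb[symmetric] by (rule lin_comb_cong) (simp_all add: a)
    finally obtain d where d: "w = lin_comb N u d" by blast
    show "\<exists>!c. (\<forall>j\<ge>N. c j = 0) \<and> w = lin_comb N u c"
    proof (rule ex1I)
      show "(\<forall>j\<ge>N. (if j < N then d j else 0) = 0) \<and> w = lin_comb N u (\<lambda>j. if j < N then d j else 0)"
        using d by (simp add: lin_comb_def)
      fix c assume c: "(\<forall>j\<ge>N. c j = 0) \<and> w = lin_comb N u c"
      show "c = (\<lambda>j. if j < N then d j else 0)"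
      proof
        fix j show "c j = (if j < N then d j else 0)"
          using c d coeff[of j c] coeff[of j d] by auto
      qed
    qed
  qed (use u in auto)
  then show ?thesis using u(2) unfolding orthonormal_basis_def by blast
qed

abbreviation gram :: "nat \<Rightarrow> (nat \<Rightarrow> ('z, 'i) n0form) \<Rightarrow> ('z, 'i) weight \<Rightarrow> nat \<Rightarrow> nat \<Rightarrow> complex" where
  "gram N h \<phi> j k \<equiv> ip X \<phi> (h j) (h k)"

abbreviation gram_det :: "nat \<Rightarrow> (nat \<Rightarrow> ('z, 'i) n0form) \<Rightarrow> ('z, 'i) weight \<Rightarrow> complex" where
  "gram_det N h \<phi> \<equiv> Determinant.det (fmat N (gram N h \<phi>))"

text \<open>
  If \<open>h = A u\<close> then the Gram matrices are related by \<open>G\<^sub>h = A G\<^sub>u A\<^sup>*\<close>, with \<open>A\<close> independent of the metric.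
\<close>

lemma gram_change_of_basis:
  assumes h: "is_basis X N h" and u: "is_basis X N u"
  shows "\<exists>c>0. \<forall>\<phi>\<in>metrics X. gram_det N h \<phi> = of_real c * gram_det N u \<phi>"
proof -
  have "\<exists>c. h j = lin_comb N u c" if "j < N" for j
    by (rule basis_expand[OF u basis_H0[OF h that]]) blast
  moreover have "\<exists>c. u j = lin_comb N h c" if "j < N" for j
    by (rule basis_expand[OF h basis_H0[OF u that]]) blast
  ultimately obtain a b where a: "\<And>j. j < N \<Longrightarrow> h j = lin_comb N u (a j)"
    and b: "\<And>j. j < N \<Longrightarrow> u j = lin_comb N h (b j)"
    by metis
  define A where "A = fmat N a"
  have AB: "fmat N a * fmat N b = 1\<^sub>m N"
  proof (rule eq_matI)
    fix j l assume "j < dim_row (1\<^sub>m N)" "l < dim_col (1\<^sub>m N)"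
    then have jl: "j < N" "l < N" by auto
    have "lin_comb N h (\<lambda>k. if k = j then 1 else 0) = h j"
      using jl by (simp add: lin_comb_def if_distrib[where f="\<lambda>c. c * _"] cong: if_cong)
    also have "h j = lin_comb N h (\<lambda>k. \<Sum>m<N. a j m * b m k)"
      unfolding lin_comb_lin_comb[symmetric] a[OF jl(1)] by (rule lin_comb_cong) (simp_all add: b)
    finally have "(if l = j then 1 else 0) = (\<Sum>m<N. a j m * b m l)"
      by (rule basis_unique[OF h _ jl(2)])
    then show "(fmat N a * fmat N b) $$ (j, l) = 1\<^sub>m N $$ (j, l)"
      using jl by (simp add: times_mat_def scalar_prod_def atLeast0LessThan eq_commute)
  qed auto
  have "Determinant.det (fmat N a) * Determinant.det (fmat N b) = 1"
    using det_mult[of "fmat N a" N "fmat N b"] AB by simp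
  then have nz: "Determinant.det A \<noteq> 0" unfolding A_def by auto
  have "gram_det N h \<phi> = of_real ((cmod (Determinant.det A))\<^sup>2) * gram_det N u \<phi>"
    if \<phi>: "\<phi> \<in> metrics X" for \<phi>
  proof -
    define M where "M = fmat N (gram N u \<phi>)"
    define A' where "A' = transpose_mat (map_mat cnj A)"
    have c: "A \<in> carrier_mat N N" "M \<in> carrier_mat N N" "A' \<in> carrier_mat N N"
      by (auto simp: A_def M_def A'_def)
    have gram: "ip X \<phi> (h j) (h l) = (\<Sum>m<N. (\<Sum>k<N. a j k * ip X \<phi> (u k) (u m)) * cnj (a l m))" if "j < N" "l < N" for j l
      unfolding a[OF that(1)] a[OF that(2)] using \<phi> basis_H0[OF u]
      by (simp add: ip_lin_comb_right ip_lin_comb_left H0_n0 H0_lin_comb mult.commute)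
    have "fmat N (gram N h \<phi>) = A * M * A'"
      by (rule eq_matI)
        (auto simp: gram A_def M_def A'_def times_mat_def scalar_prod_def atLeast0LessThan)
    then have "gram_det N h \<phi> = Determinant.det A * Determinant.det M * Determinant.det A'"
      using c by (simp add: det_mult[of _ N])
    also have "Determinant.det A' = cnj (Determinant.det A)"
    proof -
      interpret cnj: comm_ring_hom cnj by unfold_locales auto
      show ?thesis unfolding A'_def using c by (subst Determinant.det_transpose[of _ N]) auto
    qed
    finally show ?thesis by (simp only: M_def complex_norm_square mult_ac)
  qed
  then show ?thesis using nz by (intro exI[of _ "(cmod (Determinant.det A))\<^sup>2"]) auto
qed

lemma gram_orthonormal:
  assumes "orthonormal_basis X \<phi> N u"
  shows "gram_det N u \<phi> = 1"
proof -
  have "fmat N (gram N u \<phi>) = 1\<^sub>m N"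
    by (rule eq_matI) (use assms in \<open>auto simp: orthonormal_basis_def\<close>)
  then show ?thesis by simp
qed

lemma gram_det_pos:
  assumes h: "is_basis X N h" and \<phi>: "\<phi> \<in> metrics X"
  obtains d where "d > 0" "gram_det N h \<phi> = of_real d"
proof -
  obtain u where u: "orthonormal_basis X \<phi> N u" using ex_orthonormal_basis[OF \<phi> h] by blast
  then obtain c where "c > 0" "gram_det N h \<phi> = of_real c * gram_det N u \<phi>"
    using gram_change_of_basis[OF h, of u] \<phi> unfolding orthonormal_basis_def by blast
  then show ?thesis using that[of c] gram_orthonormal[OF u] by simp
qed

text \<open>
  This allows all derivatives of \<open>\<L>\<close> to be computed in a basis that is orthonormal at the point in question.
\<close>

lemma functional_L_change_of_basis:
  assumes h: "is_basis X N h" and u: "is_basis X N u"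
  obtains c where "\<And>\<phi>. \<phi> \<in> metrics X \<Longrightarrow> functional_L X N h \<phi> = functional_L X N u \<phi> + c"
proof -
  obtain c where c: "c > 0" "\<And>\<phi>. \<phi> \<in> metrics X \<Longrightarrow> gram_det N h \<phi> = of_real c * gram_det N u \<phi>"
    using gram_change_of_basis[OF h u] by blast
  have "functional_L X N h \<phi> = functional_L X N u \<phi> + - ln c" if \<phi>: "\<phi> \<in> metrics X" for \<phi>
  proof -
    obtain d where "d > 0" "gram_det N u \<phi> = of_real d" by (rule gram_det_pos[OF u \<phi>])
    then show ?thesis unfolding functional_L_def c(2)[OF \<phi>] using c(1) by (simp add: ln_mult)
  qed
  then show ?thesis by (rule that)
qed

end

section \<open>Curves of metrics\<close>

lemma has_derivative_Re_part:
  assumes "open U" "t \<in> U" "\<And>\<tau>. \<tau> \<in> U \<Longrightarrow> F \<tau> = f (Re \<tau>)" "(f has_vector_derivative d) (at (Re t))"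
  shows "(F has_derivative (\<lambda>v. Re v *\<^sub>R d)) (at t)"
proof -
  have "((\<lambda>\<tau>. f (Re \<tau>)) has_derivative (\<lambda>v. Re v *\<^sub>R d)) (at t)"
    using diff_chain_at[OF bounded_linear_imp_has_derivative[OF bounded_linear_Re] assms(4)[unfolded has_vector_derivative_def]]
    by (simp add: o_def)
  then show ?thesis
    by (rule has_derivative_transform_within_open[OF _ assms(1,2)]) (simp add: assms(3))
qed

text \<open>
  Functions of \<open>Re t\<close> do not distinguish \<open>\<partial>\<^sub>t\<close> from \<open>\<partial>\<^sub>t\<close>-bar; this reduces the calculus along curves to one real variable.
\<close>

lemma dt_Re_part:
  assumes "open U" "t \<in> U" "\<And>\<tau>. \<tau> \<in> U \<Longrightarrow> F \<tau> = f (Re \<tau>)" "(f has_vector_derivative d) (at (Re t))"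
  shows "dt F t = d / 2" "dtbar F t = d / 2"
proof -
  have "(F has_derivative (\<lambda>v. Re v *\<^sub>R d)) (at t)"
    by (rule has_derivative_Re_part[where f = f, OF assms])
  from frechet_derivative_at[OF this, symmetric] show "dt F t = d / 2" "dtbar F t = d / 2"
    by (simp_all add: dt_def dtbar_def)
qed

lemma dt_add_const:
  assumes "open U" "t \<in> U" "\<And>\<tau>. \<tau> \<in> U \<Longrightarrow> F \<tau> = G \<tau> + c"
  shows "dt F t = dt G t" "dtbar F t = dtbar G t"
proof -
  have "(F has_derivative D) (at t) \<longleftrightarrow> (G has_derivative D) (at t)" for D
  proof
    assume "(G has_derivative D) (at t)"
    then have "((\<lambda>\<tau>. G \<tau> + c) has_derivative D) (at t)"
      using has_derivative_add[OF _ has_derivative_const[of c]] by fastforce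
    then show "(F has_derivative D) (at t)"
      by (rule has_derivative_transform_within_open[OF _ assms(1,2)]) (simp add: assms(3))
  next
    assume "(F has_derivative D) (at t)"
    then have "((\<lambda>\<tau>. F \<tau> - c) has_derivative D) (at t)"
      using has_derivative_diff[OF _ has_derivative_const[of c]] by fastforce
    then show "(G has_derivative D) (at t)"
      by (rule has_derivative_transform_within_open[OF _ assms(1,2)]) (simp add: assms(3))
  qed
  then show "dt F t = dt G t" "dtbar F t = dtbar G t"
    by (simp_all add: dt_def dtbar_def frechet_derivative_def)
qed

lemma has_vector_derivative_of_real:
  "(f has_vector_derivative d) F \<Longrightarrow> ((\<lambda>s. of_real (f s) :: 'b::real_normed_algebra_1) has_vector_derivative of_real d) F"
  unfolding has_vector_derivative_def using has_derivative_of_real by (fastforce simp: of_real_def)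

lemma compact_pos_lower_bound:
  fixes q :: "'a::topological_space \<Rightarrow> real"
  assumes "compact S" "continuous_on S q" "\<And>x. x \<in> S \<Longrightarrow> 0 < q x"
  obtains m where "m > 0" "\<And>x. x \<in> S \<Longrightarrow> m \<le> q x"
proof (cases "S = {}")
  case False
  then obtain y where "y \<in> S" "\<And>x. x \<in> S \<Longrightarrow> q y \<le> q x"
    using continuous_attains_inf[OF assms(1) _ assms(2)] by blast
  then show ?thesis using that[of "q y"] assms(3) by blast
qed (use that[of 1] in auto)


lemma smooth_on_real_slice:
  fixes g :: "complex \<times> 'a::euclidean_space \<Rightarrow> 'b::real_normed_vector"
  assumes g: "smooth_on g (U \<times> W)" and s: "of_real s \<in> U" and x: "x \<in> W"
  shows "((\<lambda>s. g (of_real s, x)) has_vector_derivative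
    frechet_derivative g (at (of_real s, x)) (1, 0)) (at s)"
proof -
  have D: "(g has_derivative frechet_derivative g (at (of_real s, x))) (at (of_real s, x))"
    using smooth_on_has_derivative[OF g] s x by blast
  have p: "((\<lambda>s. (complex_of_real s, x)) has_derivative (\<lambda>h. h *\<^sub>R (1, 0))) (at s)"
    by (rule has_derivative_eq_rhs, rule has_derivative_Pair)
      (auto intro!: derivative_eq_intros simp: of_real_def)
  show ?thesis
    using diff_chain_at[OF p D]
    by (simp add: has_vector_derivative_def o_def flip: linear_scale[OF has_derivative_linear[OF D]])
qed

lemma smooth_on_slice:
  fixes g :: "'c::euclidean_space \<times> 'a::euclidean_space \<Rightarrow> 'b::real_normed_vector"
  assumes g: "smooth_on g (U \<times> W)" and "open U" "open W" "t \<in> U"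
  shows "smooth_on (\<lambda>x. g (t, x)) W"
proof -
  have L: "bounded_linear (\<lambda>x::'a. (0::'c, x))"
    by (intro bounded_linear_Pair bounded_linear_zero bounded_linear_ident)
  have "smooth_on (\<lambda>x. g ((t, 0) + (0, x))) W"
    by (rule smooth_on_affine[OF open_Times[OF assms(2,3)] assms(3) L _ g]) (simp add: assms(4))
  then show ?thesis by simp
qed

context compact_line_bundle
begin

text \<open>
  Smoothness in the point for each parameter, and joint continuity in the charts, which is what differentiation under the
  integral sign requires.
\<close>

definition chart_smooth_in :: "real set \<Rightarrow> (real \<Rightarrow> 'z \<Rightarrow> real) \<Rightarrow> bool" where
  "chart_smooth_in J w \<longleftrightarrow> (\<forall>s\<in>J. w s \<in> smooth_functions X) \<and>
     (\<forall>i. continuous_on (J \<times> V i) (\<lambda>(s, x). w s (chart_inv X i x)))"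

text \<open>
  A curve that does not depend on \<open>Im t\<close> is determined by its restriction \<open>w\<close> to the real axis; two derivatives are
  carried along because the connection uses the first and the curvature the second.
\<close>

definition real_curve :: "real set \<Rightarrow> ('z, 'i) weight \<Rightarrow> (real \<Rightarrow> 'z \<Rightarrow> real) \<Rightarrow>
    (real \<Rightarrow> 'z \<Rightarrow> real) \<Rightarrow> (real \<Rightarrow> 'z \<Rightarrow> real) \<Rightarrow> bool" where
  "real_curve J \<phi>0 w w1 w2 \<longleftrightarrow> open J \<and> \<phi>0 \<in> metrics X \<and>
     (\<forall>s\<in>J. shift \<phi>0 (w s) \<in> pos_metrics X) \<and>
     (\<forall>s\<in>J. \<forall>p. ((\<lambda>s. w s p) has_vector_derivative w1 s p) (at s) \<and>
        ((\<lambda>s. w1 s p) has_vector_derivative w2 s p) (at s)) \<and>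
     chart_smooth_in J w \<and> chart_smooth_in J w1 \<and> chart_smooth_in J w2"

lemma chart_smooth_in_slice:
  assumes "open J" and g: "\<And>i. smooth_on (g i) ({t. Re t \<in> J} \<times> V i)"
    and eq: "\<And>s i x. s \<in> J \<Longrightarrow> x \<in> V i \<Longrightarrow> g i (of_real s, x) = w s (chart_inv X i x)"
  shows "chart_smooth_in J w"
  unfolding chart_smooth_in_def smooth_functions_def
proof (intro conjI ballI allI CollectI)
  have U: "open {t. Re t \<in> J}"
    using open_vimage[OF assms(1) continuous_on_Re[OF continuous_on_id]] by (simp add: vimage_def)
  fix i
  show "smooth_on (\<lambda>x. w s (chart_inv X i x)) (V i)" if "s \<in> J" for s
    by (rule smooth_on_cong_open[OF open_V eq[OF that] smooth_on_slice[OF g U open_V]]) (use that in auto)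
  have "continuous_on (J \<times> V i) (\<lambda>z. g i (of_real (fst z), snd z))"
    by (rule continuous_on_compose2[OF smooth_on_imp_continuous_on[OF g]])
      (auto intro!: continuous_intros)
  then show "continuous_on (J \<times> V i) (\<lambda>(s, x). w s (chart_inv X i x))"
    by (rule continuous_on_eq) (auto simp: eq)
qed

lemma curve_real_curve:
  assumes c: "curve X U \<phi>0 \<psi>"
  obtains J w1 w2 where "U = {t. Re t \<in> J}" "open U" "\<forall>t\<in>U. \<psi> t = \<psi> (of_real (Re t))"
    and "real_curve J \<phi>0 (\<lambda>s. \<psi> (of_real s)) w1 w2"
proof -
  obtain J where J: "open J" "U = {t. Re t \<in> J}"
    using c unfolding curve_def strip_def by blast
  have U: "open U"
    using open_vimage[OF J(1) continuous_on_Re[OF continuous_on_id]] by (simp add: vimage_def J(2))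
  have sm: "smooth_on (\<lambda>(t, x). \<psi> t (chart_inv X i x)) (U \<times> V i)" for i
    using c unfolding curve_def by blast
  define F where "F i = (\<lambda>(t, x). \<psi> t (chart_inv X i x))" for i
  define F1 where "F1 i z = frechet_derivative (F i) (at z) (1, 0)" for i z
  define F2 where "F2 i z = frechet_derivative (F1 i) (at z) (1, 0)" for i z
  have s0: "smooth_on (F i) (U \<times> V i)" for i using sm by (simp add: F_def)
  have s1: "smooth_on (F1 i) (U \<times> V i)" for i
    unfolding F1_def[abs_def] by (rule smooth_on_frechet[OF s0])
  have s2: "smooth_on (F2 i) (U \<times> V i)" for i
    unfolding F2_def[abs_def] by (rule smooth_on_frechet[OF s1])
  define w where "w s = \<psi> (of_real s)" for s :: real
  \<comment> \<open>Defined without charts, so that they are functions on \<open>Z\<close>; in each chart they are the slices of \<open>F1\<close> and \<open>F2\<close>.\<close>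
  define w1 where "w1 s p = vector_derivative (\<lambda>s. w s p) (at s)" for s p
  define w2 where "w2 s p = vector_derivative (\<lambda>s. w1 s p) (at s)" for s p
  have d0: "((\<lambda>s. w s p) has_vector_derivative F1 i (of_real s, chart X i p)) (at s)"
    if "s \<in> J" "p \<in> cdom X i" for s p i
    using smooth_on_real_slice[OF s0, of s "chart X i p" i] that
    by (simp add: J(2) F_def F1_def w_def chart_inv_chart)
  have w1: "w1 s p = F1 i (of_real s, chart X i p)" if "s \<in> J" "p \<in> cdom X i" for s p i
    unfolding w1_def using d0[OF that] by (rule vector_derivative_at)
  have d1: "((\<lambda>s. w1 s p) has_vector_derivative F2 i (of_real s, chart X i p)) (at s)"
    if "s \<in> J" "p \<in> cdom X i" for s p i
  proof (rule has_vector_derivative_transform_within_open[OF _ J(1) that(1)])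
    show "((\<lambda>s. F1 i (of_real s, chart X i p)) has_vector_derivative F2 i (of_real s, chart X i p)) (at s)"
      using smooth_on_real_slice[OF s1, of s "chart X i p" i] that by (simp add: J(2) F2_def)
  qed (rule w1[OF _ that(2), symmetric])
  have w2: "w2 s p = F2 i (of_real s, chart X i p)" if "s \<in> J" "p \<in> cdom X i" for s p i
    unfolding w2_def using d1[OF that] by (rule vector_derivative_at)
  have "chart_smooth_in J w"
    by (rule chart_smooth_in_slice[OF J(1) s0[unfolded J(2)]]) (simp add: F_def w_def)
  moreover have "chart_smooth_in J w1"
  proof (rule chart_smooth_in_slice[OF J(1) s1[unfolded J(2)]])
    fix s i x assume "s \<in> J" "x \<in> V i"
    then show "F1 i (of_real s, x) = w1 s (chart_inv X i x)"
      using w1[OF _ chart_inv_in, of s x i] by (simp add: chart_chart_inv)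
  qed
  moreover have "chart_smooth_in J w2"
  proof (rule chart_smooth_in_slice[OF J(1) s2[unfolded J(2)]])
    fix s i x assume "s \<in> J" "x \<in> V i"
    then show "F2 i (of_real s, x) = w2 s (chart_inv X i x)"
      using w2[OF _ chart_inv_in, of s x i] by (simp add: chart_chart_inv)
  qed
  moreover have "((\<lambda>s. w s p) has_vector_derivative w1 s p) (at s) \<and>
      ((\<lambda>s. w1 s p) has_vector_derivative w2 s p) (at s)" if s: "s \<in> J" for s p
  proof -
    obtain i where i: "p \<in> cdom X i" by (rule cdom_cover)
    show ?thesis using d0[OF s i] d1[OF s i] by (simp add: w1[OF s i] w2[OF s i])
  qed
  moreover have "\<phi>0 \<in> metrics X" "\<forall>s\<in>J. shift \<phi>0 (w s) \<in> pos_metrics X"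
    using c unfolding curve_def by (auto simp: J(2) w_def)
  ultimately have "real_curve J \<phi>0 w w1 w2"
    unfolding real_curve_def using J(1) by blast
  moreover have "\<psi> t = \<psi> (of_real (Re t))" if "t \<in> U" for t
  proof -
    have "of_real (Re t) \<in> U" using that by (simp add: J(2))
    then show ?thesis using c that unfolding curve_def by (metis Re_complex_of_real)
  qed
  ultimately show ?thesis using that[OF J(2) U] unfolding w_def by blast
qed

lemma real_curveD:
  assumes "real_curve J \<phi>0 w w1 w2"
  shows "open J" "\<phi>0 \<in> metrics X" "s \<in> J \<Longrightarrow> shift \<phi>0 (w s) \<in> pos_metrics X"
    "s \<in> J \<Longrightarrow> ((\<lambda>s. w s p) has_vector_derivative w1 s p) (at s)"
    "s \<in> J \<Longrightarrow> ((\<lambda>s. w1 s p) has_vector_derivative w2 s p) (at s)"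
    "chart_smooth_in J w" "chart_smooth_in J w1" "chart_smooth_in J w2"
  using assms unfolding real_curve_def by blast+

lemma chart_smooth_inD:
  "chart_smooth_in J w \<Longrightarrow> s \<in> J \<Longrightarrow> w s \<in> smooth_functions X"
  "chart_smooth_in J w \<Longrightarrow> continuous_on (J \<times> V i) (\<lambda>z. w (fst z) (chart_inv X i (snd z)))"
  unfolding chart_smooth_in_def by (auto simp: split_beta)

lemma chart_smooth_in_const: "chart_smooth_in J (\<lambda>s p. c)"
  unfolding chart_smooth_in_def smooth_functions_def by (auto simp: smooth_on_const split_beta intro!: continuous_intros)

lemma smooth_functions_mult:
  "\<mu> \<in> smooth_functions X \<Longrightarrow> \<nu> \<in> smooth_functions X \<Longrightarrow> (\<lambda>p. \<mu> p * \<nu> p) \<in> smooth_functions X"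
  unfolding smooth_functions_def by (auto intro!: smooth_on_mult open_V)

lemma smooth_functions_add:
  "\<mu> \<in> smooth_functions X \<Longrightarrow> \<nu> \<in> smooth_functions X \<Longrightarrow> (\<lambda>p. \<mu> p + \<nu> p) \<in> smooth_functions X"
  unfolding smooth_functions_def by (auto intro!: smooth_on_add open_V)

lemma smooth_functions_const: "(\<lambda>p. c) \<in> smooth_functions X"
  unfolding smooth_functions_def by (auto intro!: smooth_on_const)

lemma pos_metrics_metrics: "\<phi> \<in> pos_metrics X \<Longrightarrow> \<phi> \<in> metrics X"
  by (simp add: pos_metrics_def)

text \<open>
  The product rule under the integral sign: the weight \<open>e\<^sup>-\<^sup>\<phi>\<close> contributes the factor \<open>-\<phi>'\<close>. The form of the statement, with a
  varying multiplier \<open>a\<close>, allows it to be applied twice.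
\<close>

lemma ip_curve_derivative:
  assumes c: "real_curve J \<phi>0 w w1 w2" and a: "chart_smooth_in J a" and a1: "chart_smooth_in J a1"
    and d: "\<And>s p. s \<in> J \<Longrightarrow> ((\<lambda>s. a s p) has_vector_derivative a1 s p) (at s)"
    and u: "u \<in> n0_forms X" and v: "v \<in> n0_forms X" and s0: "s0 \<in> J"
  shows "((\<lambda>s. ip X (shift \<phi>0 (w s)) (mult_form (a s) u) v) has_vector_derivative
     ip X (shift \<phi>0 (w s0)) (mult_form (\<lambda>p. a1 s0 p - a s0 p * w1 s0 p) u) v) (at s0)"
  unfolding ip_def
proof (rule form_integral_has_vector_derivative[OF real_curveD(1)[OF c] s0])
  show "chart_continuous (\<lambda>i p. mult_form (a s) u i p * cnj (v i p) * complex_of_real (exp (- shift \<phi>0 (w s) i p)))"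
    if "s \<in> J" for s
    by (intro ip_continuous n0_mult_form chart_smooth_inD(1)[OF a that] u v
        pos_metrics_metrics[OF real_curveD(3)[OF c that]])
  show "continuous_on (J \<times> V i) (\<lambda>(s, x). mult_form (\<lambda>p. a1 s p - a s p * w1 s p) u i (chart_inv X i x) *
      cnj (v i (chart_inv X i x)) * complex_of_real (exp (- shift \<phi>0 (w s) i (chart_inv X i x))))" for i
  proof -
    have sn: "continuous_on (J \<times> V i) (\<lambda>z. f (snd z))" if "continuous_on (V i) f" for f :: "complex^'n \<Rightarrow> 'c::topological_space"
      by (rule continuous_on_compose2[OF that continuous_on_snd[OF continuous_on_id]]) auto
    note cont = chart_smooth_inD(2)[OF a] chart_smooth_inD(2)[OF a1]
      chart_smooth_inD(2)[OF real_curveD(6)[OF c]] chart_smooth_inD(2)[OF real_curveD(7)[OF c]]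
      sn[OF smooth_on_imp_continuous_on[OF n0_smooth[OF u]]] sn[OF smooth_on_imp_continuous_on[OF n0_smooth[OF v]]]
      sn[OF smooth_on_imp_continuous_on[OF metrics_smooth[OF real_curveD(2)[OF c]]]]
    show ?thesis
      unfolding split_beta mult_form_def shift_def by (intro continuous_intros cont)
  qed
  fix s i p assume s: "s \<in> J"
  have "((\<lambda>s. a s p * exp (- (\<phi>0 i p + w s p))) has_vector_derivative
      (a1 s p - a s p * w1 s p) * exp (- (\<phi>0 i p + w s p))) (at s)"
    using d[OF s, of p] real_curveD(4)[OF c s, of p]
    unfolding has_real_derivative_iff_has_vector_derivative[symmetric]
    by (auto intro!: derivative_eq_intros simp: algebra_simps)
  from has_vector_derivative_mult_left[OF has_vector_derivative_of_real[OF this], of "u i p * cnj (v i p)"]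
  show "((\<lambda>s. mult_form (a s) u i p * cnj (v i p) * complex_of_real (exp (- shift \<phi>0 (w s) i p)))
      has_vector_derivative mult_form (\<lambda>p. a1 s p - a s p * w1 s p) u i p * cnj (v i p) *
      complex_of_real (exp (- shift \<phi>0 (w s) i p))) (at s)"
    by (simp add: mult_form_def shift_def mult_ac)
qed

lemma mult_form_one: "mult_form (\<lambda>p. 1) u = u"
  by (simp add: mult_form_def)

abbreviation gram1 :: "(nat \<Rightarrow> ('z, 'i) n0form) \<Rightarrow> ('z, 'i) weight \<Rightarrow> ('z \<Rightarrow> real) \<Rightarrow> nat \<Rightarrow> nat \<Rightarrow> complex" where
  "gram1 h \<phi> \<mu> j k \<equiv> ip X \<phi> (mult_form \<mu> (h j)) (h k)"

lemma gram_derivative: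
  assumes c: "real_curve J \<phi>0 w w1 w2" and u: "u \<in> n0_forms X" and v: "v \<in> n0_forms X" and s: "s \<in> J"
  shows "((\<lambda>s. ip X (shift \<phi>0 (w s)) u v) has_vector_derivative
      ip X (shift \<phi>0 (w s)) (mult_form (\<lambda>p. - w1 s p) u) v) (at s)"
    and "((\<lambda>s. ip X (shift \<phi>0 (w s)) (mult_form (\<lambda>p. - w1 s p) u) v) has_vector_derivative
      ip X (shift \<phi>0 (w s)) (mult_form (\<lambda>p. w1 s p * w1 s p - w2 s p) u) v) (at s)"
proof -
  have "((\<lambda>s. ip X (shift \<phi>0 (w s)) (mult_form (\<lambda>p. 1) u) v) has_vector_derivative
      ip X (shift \<phi>0 (w s)) (mult_form (\<lambda>p. 0 - 1 * w1 s p) u) v) (at s)"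
    by (rule ip_curve_derivative[OF c _ _ _ u v s]) (auto intro: chart_smooth_in_const)
  then show "((\<lambda>s. ip X (shift \<phi>0 (w s)) u v) has_vector_derivative
      ip X (shift \<phi>0 (w s)) (mult_form (\<lambda>p. - w1 s p) u) v) (at s)"
    by (simp add: mult_form_one)
  have neg: "chart_smooth_in J (\<lambda>s p. - a s p)" if "chart_smooth_in J a" for a
    using that unfolding chart_smooth_in_def smooth_functions_def
    by (auto simp: split_beta intro!: smooth_on_minus open_V continuous_intros)
  have "((\<lambda>s. ip X (shift \<phi>0 (w s)) (mult_form (\<lambda>p. - w1 s p) u) v) has_vector_derivative
      ip X (shift \<phi>0 (w s)) (mult_form (\<lambda>p. - w2 s p - (- w1 s p) * w1 s p) u) v) (at s)"
    by (rule ip_curve_derivative[OF c neg[OF real_curveD(7)[OF c]] neg[OF real_curveD(8)[OF c]] _ u v s])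
      (intro has_vector_derivative_minus real_curveD(5)[OF c])
  then show "((\<lambda>s. ip X (shift \<phi>0 (w s)) (mult_form (\<lambda>p. - w1 s p) u) v) has_vector_derivative
      ip X (shift \<phi>0 (w s)) (mult_form (\<lambda>p. w1 s p * w1 s p - w2 s p) u) v) (at s)"
    by simp
qed

text \<open>With \<open>\<mu> = - \<phi>'\<close> this is \<open>tr (G\<^sup>-\<^sup>1 G')\<close>, the logarithmic derivative of the Gram determinant.\<close>

definition log_gram_deriv :: "nat \<Rightarrow> (nat \<Rightarrow> ('z, 'i) n0form) \<Rightarrow> ('z, 'i) weight \<Rightarrow> ('z \<Rightarrow> real) \<Rightarrow> complex" where
  "log_gram_deriv N h \<phi> \<mu> = (\<Sum>i<N. \<Sum>j<N. gram1 h \<phi> \<mu> i j * fmat_inv N (gram N h \<phi>) j i)"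

lemma gram_det_nz: "is_basis X N h \<Longrightarrow> \<phi> \<in> metrics X \<Longrightarrow> gram_det N h \<phi> \<noteq> 0"
  by (rule gram_det_pos) auto

text \<open>
  The Gram determinant is real and positive at every parameter, so its logarithmic derivative \<open>tr (G\<^sup>-\<^sup>1 G')\<close> is real and is the
  derivative of the logarithm of its real part.
\<close>

lemma functional_L_derivative:
  assumes c: "real_curve J \<phi>0 w w1 w2" and h: "is_basis X N h" and s: "s \<in> J"
  defines "tr \<equiv> log_gram_deriv N h (shift \<phi>0 (w s)) (\<lambda>p. - w1 s p)"
  shows "((\<lambda>s. functional_L X N h (shift \<phi>0 (w s))) has_vector_derivative - Re tr) (at s)"
    and "tr = of_real (Re tr)"
proof -
  define D where "D s = Determinant.det (fmat N (gram N h (shift \<phi>0 (w s))))" for s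
  have m: "shift \<phi>0 (w s) \<in> metrics X" if "s \<in> J" for s
    by (rule pos_metrics_metrics[OF real_curveD(3)[OF c that]])
  have hn: "h j \<in> n0_forms X" if "j < N" for j using basis_H0[OF h that] by (rule H0_n0)
  have D': "(D has_vector_derivative D s * tr) (at s)"
    unfolding D_def tr_def log_gram_deriv_def
    by (rule det_has_vector_derivative_trace[where G = "\<lambda>s. gram N h (shift \<phi>0 (w s))", OF _ gram_det_nz[OF h m[OF s]]])
      (intro gram_derivative(1)[OF c _ _ s] hn)
  have real: "D s = of_real (Re (D s))" "Re (D s) > 0" if sJ: "s \<in> J" for s
  proof -
    obtain d where "d > 0" "D s = of_real d" unfolding D_def by (rule gram_det_pos[OF h m[OF sJ]])
    then show "D s = of_real (Re (D s))" "Re (D s) > 0" by auto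
  qed
  have R: "((\<lambda>s. Re (D s)) has_vector_derivative Re (D s * tr)) (at s)"
    using D' by (rule bounded_linear.has_vector_derivative[OF bounded_linear_Re])
  have "(D has_vector_derivative of_real (Re (D s * tr))) (at s)"
    by (rule has_vector_derivative_transform_within_open[OF has_vector_derivative_of_real[OF R] real_curveD(1)[OF c] s])
      (simp add: real(1)[symmetric])
  then have eq: "D s * tr = of_real (Re (D s * tr))"
    using D' vector_derivative_unique_at by blast
  have Dre: "Re (D s * tr) = Re (D s) * Re tr" by (subst real(1)[OF s]) simp
  have "of_real (Re (D s)) * tr = of_real (Re (D s)) * of_real (Re tr)"
    using eq unfolding Dre using real(1)[OF s] by (metis of_real_mult)
  then show "tr = of_real (Re tr)" using real(2)[OF s] by simp
  have R': "((\<lambda>s. Re (D s)) has_real_derivative Re (D s) * Re tr) (at s)"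
    using R unfolding Dre has_real_derivative_iff_has_vector_derivative .
  have "((\<lambda>s. - ln (Re (D s))) has_real_derivative - (1 / Re (D s) * (Re (D s) * Re tr))) (at s)"
    by (rule DERIV_minus[OF DERIV_chain2[OF DERIV_ln_divide[OF real(2)[OF s]] R']])
  then have "((\<lambda>s. - ln (Re (D s))) has_vector_derivative - Re tr) (at s)"
    using real(2)[OF s] by (simp add: has_real_derivative_iff_has_vector_derivative)
  then show "((\<lambda>s. functional_L X N h (shift \<phi>0 (w s))) has_vector_derivative - Re tr) (at s)"
    by (simp add: functional_L_def D_def)
qed

lemma log_gram_deriv_differentiable:
  assumes c: "real_curve J \<phi>0 w w1 w2" and h: "is_basis X N h" and s: "s \<in> J" and "j < N" "k < N" "l < N"
  shows "(\<lambda>s. gram1 h (shift \<phi>0 (w s)) (\<lambda>p. - w1 s p) j l * fmat_inv N (gram N h (shift \<phi>0 (w s))) l k)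
     differentiable (at s)"
proof (rule differentiable_mult)
  have hn: "h j \<in> n0_forms X" if "j < N" for j using basis_H0[OF h that] by (rule H0_n0)
  show "(\<lambda>s. gram1 h (shift \<phi>0 (w s)) (\<lambda>p. - w1 s p) j l) differentiable at s"
    using gram_derivative(2)[OF c hn hn s] assms(4,6) differentiableI_vector by blast
  show "(\<lambda>s. fmat_inv N (gram N h (shift \<phi>0 (w s))) l k) differentiable at s"
    by (rule fmat_inv_differentiable[where G = "\<lambda>s. gram N h (shift \<phi>0 (w s))", OF gram_derivative(1)[OF c _ _ s]])
      (use hn gram_det_nz[OF h pos_metrics_metrics[OF real_curveD(3)[OF c s]]] assms in auto)
qed

abbreviation L_curve :: "nat \<Rightarrow> (nat \<Rightarrow> ('z, 'i) n0form) \<Rightarrow> ('z, 'i) weight \<Rightarrow> (complex \<Rightarrow> 'z \<Rightarrow> real) \<Rightarrow>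
    complex \<Rightarrow> complex" where
  "L_curve N h \<phi>0 \<psi> \<equiv> (\<lambda>\<tau>. of_real (functional_L X N h (shift \<phi>0 (\<psi> \<tau>))))"

lemma functional_L_dt:
  assumes h: "is_basis X N h" and t: "t \<in> U"
    and UJ: "U = {t. Re t \<in> J}" "open U" "\<forall>t\<in>U. \<psi> t = \<psi> (of_real (Re t))"
    and rc: "real_curve J \<phi>0 (\<lambda>s. \<psi> (of_real s)) w1 w2"
  shows "(\<lambda>\<tau>. functional_L X N h (shift \<phi>0 (\<psi> \<tau>))) differentiable (at t)"
    and "dt (L_curve N h \<phi>0 \<psi>) t
      = - log_gram_deriv N h (shift \<phi>0 (\<psi> t)) (\<lambda>p. - w1 (Re t) p) / 2"
    and "dtbar (L_curve N h \<phi>0 \<psi>) t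
      = - log_gram_deriv N h (shift \<phi>0 (\<psi> t)) (\<lambda>p. - w1 (Re t) p) / 2"
proof -
  define L where "L s = functional_L X N h (shift \<phi>0 (\<psi> (of_real s)))" for s :: real
  define tr where "tr = log_gram_deriv N h (shift \<phi>0 (\<psi> (of_real (Re t)))) (\<lambda>p. - w1 (Re t) p)"
  have s: "Re t \<in> J" using t UJ(1) by simp
  have L': "(L has_vector_derivative - Re tr) (at (Re t))" and re: "tr = of_real (Re tr)"
    using functional_L_derivative[OF rc h s] unfolding L_def[abs_def] tr_def by auto
  have eq: "functional_L X N h (shift \<phi>0 (\<psi> \<tau>)) = L (Re \<tau>)" if "\<tau> \<in> U" for \<tau>
    using bspec[OF UJ(3) that] by (simp add: L_def)
  show "(\<lambda>\<tau>. functional_L X N h (shift \<phi>0 (\<psi> \<tau>))) differentiable (at t)"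
    using has_derivative_Re_part[OF UJ(2) t eq L'] differentiableI by blast
  note d = dt_Re_part[OF UJ(2) t _ has_vector_derivative_of_real[OF L']]
  have tr: "tr = log_gram_deriv N h (shift \<phi>0 (\<psi> t)) (\<lambda>p. - w1 (Re t) p)"
    using bspec[OF UJ(3) t] by (simp add: tr_def)
  show "dt (L_curve N h \<phi>0 \<psi>) t
      = - log_gram_deriv N h (shift \<phi>0 (\<psi> t)) (\<lambda>p. - w1 (Re t) p) / 2"
    "dtbar (L_curve N h \<phi>0 \<psi>) t
      = - log_gram_deriv N h (shift \<phi>0 (\<psi> t)) (\<lambda>p. - w1 (Re t) p) / 2"
    unfolding tr[symmetric] by (subst d; simp add: eq re[symmetric])+
qed

lemma functional_L_dt_dtbar:
  assumes h: "is_basis X N h" and t: "t \<in> U"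
    and UJ: "U = {t. Re t \<in> J}" "open U" "\<forall>t\<in>U. \<psi> t = \<psi> (of_real (Re t))"
    and rc: "real_curve J \<phi>0 (\<lambda>s. \<psi> (of_real s)) w1 w2"
    and d: "((\<lambda>s. log_gram_deriv N h (shift \<phi>0 (\<psi> (of_real s))) (\<lambda>p. - w1 s p)) has_vector_derivative d) (at (Re t))"
  shows "dtbar (L_curve N h \<phi>0 \<psi>) differentiable (at t)"
    and "dt (dtbar (L_curve N h \<phi>0 \<psi>)) t = - d / 4"
proof -
  define M where "M s = - log_gram_deriv N h (shift \<phi>0 (\<psi> (of_real s))) (\<lambda>p. - w1 s p) / 2" for s
  have eq: "dtbar (L_curve N h \<phi>0 \<psi>) \<tau> = M (Re \<tau>)" if "\<tau> \<in> U" for \<tau>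
    using functional_L_dt(3)[OF h that UJ rc] bspec[OF UJ(3) that] by (simp add: M_def)
  have M': "(M has_vector_derivative - d / 2) (at (Re t))"
    unfolding M_def[abs_def] by (intro has_vector_derivative_divide has_vector_derivative_minus d)
  show "dtbar (L_curve N h \<phi>0 \<psi>) differentiable (at t)"
    using has_derivative_Re_part[OF UJ(2) t eq M'] differentiableI by blast
  show "dt (dtbar (L_curve N h \<phi>0 \<psi>)) t = - d / 4"
    by (subst dt_Re_part(1)[OF UJ(2) t eq M']) simp_all
qed

section \<open>The Chern curvature\<close>

text \<open>
  The Chern connection is defined by duality; by definiteness of \<open>H\<^sub>\<phi>\<close> a section with the required pairings is the
  only one.
\<close>

lemma riesz_unique:
  assumes \<phi>: "\<phi> \<in> metrics X" and w: "w \<in> H0 X" and eq: "\<And>v. v \<in> H0 X \<Longrightarrow> ip X \<phi> w v = f v"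
  shows "(THE w. w \<in> H0 X \<and> (\<forall>v\<in>H0 X. ip X \<phi> w v = f v)) = w"
proof (rule the_equality)
  fix w' assume w': "w' \<in> H0 X \<and> (\<forall>v\<in>H0 X. ip X \<phi> w' v = f v)"
  define r where "r = (\<lambda>i p. w' i p - w i p)"
  have r: "r \<in> H0 X" unfolding r_def using w w' by (intro H0_diff) auto
  have "ip X \<phi> r r = ip X \<phi> w' r - ip X \<phi> w r"
    unfolding r_def using w w' \<phi> H0_n0 r[unfolded r_def] by (intro ip_diff_left) auto
  then have "ip X \<phi> r r = 0" using w' eq r by simp
  then have "r = (\<lambda>i p. 0)" using norm_sq_n0_eq_0[OF \<phi> H0_n0[OF r]] by (simp add: norm_sq_n0_def)
  then have "r i p = 0" for i p by (simp add: fun_eq_iff)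
  then show "w' = w" by (intro ext) (simp add: r_def)
qed (use w eq in auto)

text \<open>
  In the basis \<open>h\<close> the Chern connection form is \<open>G\<^sub>t G\<^sup>-\<^sup>1\<close>, so the curvature is \<open>-\<partial>\<^sub>t\<close>-bar of it and its trace is
  \<open>-\<partial>\<^sub>t\<close>-bar \<open>\<partial>\<^sub>t ln det G\<close>.
\<close>

lemma trace_chern_curvature:
  assumes c: "curve X U \<phi>0 \<psi>" and h: "is_basis X N h" and t: "t \<in> U"
  shows "dt (dtbar (L_curve N h \<phi>0 \<psi>)) t
      = endo_trace N h (chern_curvature X (\<lambda>\<tau>. shift \<phi>0 (\<psi> \<tau>)) t)"
proof -
  obtain J w1 w2 where UJ: "U = {t. Re t \<in> J}" "open U" "\<forall>t\<in>U. \<psi> t = \<psi> (of_real (Re t))"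
    and rc: "real_curve J \<phi>0 (\<lambda>s. \<psi> (of_real s)) w1 w2"
    using curve_real_curve[OF c] by blast
  define \<phi> where "\<phi> s = shift \<phi>0 (\<psi> (of_real s))" for s :: real
  define G1 where "G1 s j k = gram1 h (\<phi> s) (\<lambda>p. - w1 s p) j k" for s j k
  define I where "I s j k = fmat_inv N (gram N h (\<phi> s)) j k" for s j k
  define C where "C s j k = (\<Sum>l<N. G1 s j l * I s l k) / 2" for s j k
  define C1 where "C1 j k = vector_derivative (\<lambda>s. C s j k) (at (Re t))" for j k
  have ReJ: "Re \<tau> \<in> J" if "\<tau> \<in> U" for \<tau> using that UJ(1) by simp
  have m: "\<phi> s \<in> metrics X" if "s \<in> J" for s
    unfolding \<phi>_def by (rule pos_metrics_metrics[OF real_curveD(3)[OF rc that]])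
  have hn: "h j \<in> n0_forms X" if "j < N" for j using basis_H0[OF h that] by (rule H0_n0)
  have psi: "shift \<phi>0 (\<psi> \<tau>) = \<phi> (Re \<tau>)" if "\<tau> \<in> U" for \<tau> using bspec[OF UJ(3) that] by (simp add: \<phi>_def)
  have CG: "(\<Sum>k<N. C s j k * gram N h (\<phi> s) k l) = G1 s j l / 2" if "s \<in> J" "j < N" "l < N" for s j l
  proof -
    have "(\<Sum>k<N. C s j k * gram N h (\<phi> s) k l) = (\<Sum>m<N. G1 s j m * (\<Sum>k<N. I s m k * gram N h (\<phi> s) k l)) / 2"
      unfolding C_def sum_distrib_right sum_distrib_left sum_divide_distrib
      by (subst sum.swap) (simp add: algebra_simps)
    also have "\<dots> = (\<Sum>m<N. if m = l then G1 s j l else 0) / 2"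
      unfolding I_def using fmat_inv_left[OF gram_det_nz[OF h m[OF that(1)]] _ that(3)]
      by (intro arg_cong2[of _ _ _ _ "(/)"] sum.cong) auto
    finally show ?thesis using that by simp
  qed
  have D: "chern_D X (\<lambda>\<tau>. shift \<phi>0 (\<psi> \<tau>)) (\<lambda>_. h j) \<tau> = lin_comb N h (C (Re \<tau>) j)"
    if \<tau>: "\<tau> \<in> U" and j: "j < N" for \<tau> j
    unfolding chern_D_def psi[OF \<tau>]
  proof (rule riesz_unique[OF m[OF ReJ[OF \<tau>]]])
    show "lin_comb N h (C (Re \<tau>) j) \<in> H0 X" by (intro H0_lin_comb basis_H0[OF h])
    fix v assume "v \<in> H0 X"
    then obtain b where v: "v = lin_comb N h b" using basis_expand[OF h] by blast
    have hC: "lin_comb N h (C (Re \<tau>) j) \<in> n0_forms X" by (intro H0_n0 H0_lin_comb basis_H0[OF h])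
    have "ip X (\<phi> (Re \<tau>)) (lin_comb N h (C (Re \<tau>) j)) v
      = (\<Sum>l<N. cnj (b l) * (\<Sum>k<N. C (Re \<tau>) j k * gram N h (\<phi> (Re \<tau>)) k l))"
      unfolding v using m[OF ReJ[OF \<tau>]] hn hC by (simp add: ip_lin_comb_right ip_lin_comb_left)
    also have "\<dots> = (\<Sum>l<N. cnj (b l) * (G1 (Re \<tau>) j l / 2))"
      by (rule sum.cong) (simp_all add: CG[OF ReJ[OF \<tau>] j])
    also have "\<dots> = (\<Sum>l<N. cnj (b l) * G1 (Re \<tau>) j l) / 2"
      by (simp add: sum_divide_distrib)
    also have "\<dots> = dt (\<lambda>\<tau>. ip X (shift \<phi>0 (\<psi> \<tau>)) (h j) v) \<tau>"
    proof (rule dt_Re_part(1)[symmetric, OF UJ(2) \<tau>])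
      show "ip X (shift \<phi>0 (\<psi> \<tau>')) (h j) v = (\<Sum>l<N. cnj (b l) * ip X (\<phi> (Re \<tau>')) (h j) (h l))" if "\<tau>' \<in> U" for \<tau>'
        unfolding psi[OF that] v using m[OF ReJ[OF that]] hn j by (simp add: ip_lin_comb_right)
      show "((\<lambda>s. \<Sum>l<N. cnj (b l) * ip X (\<phi> s) (h j) (h l)) has_vector_derivative
          (\<Sum>l<N. cnj (b l) * G1 (Re \<tau>) j l)) (at (Re \<tau>))"
        unfolding G1_def \<phi>_def
        by (intro has_vector_derivative_sum has_vector_derivative_mult_right
            gram_derivative(1)[OF rc _ _ ReJ[OF \<tau>]] hn j) auto
    qed
    finally show "ip X (\<phi> (Re \<tau>)) (lin_comb N h (C (Re \<tau>) j)) v = dt (\<lambda>\<tau>. ip X (shift \<phi>0 (\<psi> \<tau>)) (h j) v) \<tau>" .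
  qed
  have C': "((\<lambda>s. C s j k) has_vector_derivative C1 j k) (at (Re t))" if "j < N" "k < N" for j k
  proof -
    have "(\<lambda>s. C s j k) differentiable (at (Re t))"
      unfolding C_def G1_def I_def \<phi>_def
      by (intro differentiable_divide differentiable_sum differentiable_const ballI
          log_gram_deriv_differentiable[OF rc h ReJ[OF t]] that) auto
    then show ?thesis unfolding C1_def by (simp add: vector_derivative_works)
  qed
  have zero: "chern_D X (\<lambda>\<tau>. shift \<phi>0 (\<psi> \<tau>)) (dtbar_section (\<lambda>_. u)) t = (\<lambda>i p. 0)" for u
    unfolding chern_D_def psi[OF t]
    by (rule riesz_unique[OF m[OF ReJ[OF t]] H0_zero])
      (simp add: dtbar_section_def dtbar_def dt_def ip_zero_left)
  have curv: "chern_curvature X (\<lambda>\<tau>. shift \<phi>0 (\<psi> \<tau>)) t (h j) = lin_comb N h (\<lambda>k. - C1 j k / 2)" if j: "j < N" for j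
  proof (intro ext)
    fix i p
    have "dtbar (\<lambda>\<tau>. chern_D X (\<lambda>\<tau>. shift \<phi>0 (\<psi> \<tau>)) (\<lambda>_. h j) \<tau> i p) t = (\<Sum>k<N. C1 j k * h k i p) / 2"
    proof (rule dt_Re_part(2)[OF UJ(2) t])
      show "chern_D X (\<lambda>\<tau>. shift \<phi>0 (\<psi> \<tau>)) (\<lambda>_. h j) \<tau> i p = (\<Sum>k<N. C (Re \<tau>) j k * h k i p)" if "\<tau> \<in> U" for \<tau>
        unfolding D[OF that j] lin_comb_def ..
      show "((\<lambda>s. \<Sum>k<N. C s j k * h k i p) has_vector_derivative (\<Sum>k<N. C1 j k * h k i p)) (at (Re t))"
        by (intro has_vector_derivative_sum has_vector_derivative_mult_left C' j) auto
    qed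
    then show "chern_curvature X (\<lambda>\<tau>. shift \<phi>0 (\<psi> \<tau>)) t (h j) i p = lin_comb N h (\<lambda>k. - C1 j k / 2) i p"
      unfolding chern_curvature_def zero lin_comb_def by (simp add: dtbar_section_def sum_negf sum_divide_distrib)
  qed
  have "endo_trace N h (chern_curvature X (\<lambda>\<tau>. shift \<phi>0 (\<psi> \<tau>)) t) = (\<Sum>j<N. - C1 j j / 2)"
    unfolding endo_trace_def by (rule sum.cong) (simp_all add: curv coord_lin_comb[OF h])
  also have "\<dots> = - (\<Sum>j<N. 2 * C1 j j) / 4"
    by (simp add: sum_negf sum_divide_distrib)
  also have "\<dots> = dt (dtbar (L_curve N h \<phi>0 \<psi>)) t"
  proof (rule functional_L_dt_dtbar(2)[OF h t UJ rc, symmetric])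
    have "log_gram_deriv N h (shift \<phi>0 (\<psi> (of_real s))) (\<lambda>p. - w1 s p) = (\<Sum>j<N. 2 * C s j j)" for s
      by (simp add: log_gram_deriv_def C_def G1_def I_def \<phi>_def)
    then show "((\<lambda>s. log_gram_deriv N h (shift \<phi>0 (\<psi> (of_real s))) (\<lambda>p. - w1 s p)) has_vector_derivative
        (\<Sum>j<N. 2 * C1 j j)) (at (Re t))"
      by (simp only:) (intro has_vector_derivative_sum has_vector_derivative_mult_right C'; simp)
  qed
  finally show ?thesis by simp
qed

section \<open>Every smooth function is the velocity of a curve\<close>

lemma smooth_functions_cmult: "\<mu> \<in> smooth_functions X \<Longrightarrow> (\<lambda>p. a * \<mu> p) \<in> smooth_functions X"
  using smooth_functions_mult[OF smooth_functions_const] by blast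

lemma shift_metrics:
  assumes "\<phi> \<in> metrics X" "\<mu> \<in> smooth_functions X"
  shows "shift \<phi> \<mu> \<in> metrics X"
  using assms unfolding metrics_def shift_def smooth_functions_def
  by (auto intro!: smooth_on_add open_V)

text \<open>
  The Levi form is affine in \<open>s\<close>. Writing it as an interpolation between two metrics lets only Levi forms of metrics occur.
\<close>

lemma levi_shift_scale:
  assumes "\<phi> \<in> metrics X" "\<mu> \<in> smooth_functions X" "p \<in> cdom X i"
  shows "levi X (shift \<phi> (\<lambda>p. s * \<mu> p)) i p $ j $ k
    = of_real (1 - s) * levi X \<phi> i p $ j $ k + of_real s * levi X (shift \<phi> \<mu>) i p $ j $ k"
proof -
  define x where "x = chart X i p"
  have x: "x \<in> V i" using assms(3) by (simp add: x_def)
  define f where "f = (\<lambda>x. complex_of_real (\<phi> i (chart_inv X i x)))"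
  define g where "g = (\<lambda>x. complex_of_real (shift \<phi> \<mu> i (chart_inv X i x)))"
  have sm: "smooth_on f (V i)" "smooth_on g (V i)"
    unfolding f_def g_def by (intro smooth_on_of_real open_V metrics_smooth assms(1) shift_metrics assms(2))+
  have eq: "complex_of_real (shift \<phi> (\<lambda>p. s * \<mu> p) i (chart_inv X i y)) = of_real (1 - s) * f y + of_real s * g y" for y
    by (simp add: f_def g_def shift_def algebra_simps)
  have d: "f differentiable at y" "g differentiable at y" "pdbar k f differentiable at y" "pdbar k g differentiable at y"
    if "y \<in> V i" for y
    using smooth_on_differentiable[OF _ that] sm smooth_on_pd(2)[OF open_V] by blast+
  have first: "pdbar k (\<lambda>y. of_real (1 - s) * f y + of_real s * g y) y
      = of_real (1 - s) * pdbar k f y + of_real s * pdbar k g y" if "y \<in> V i" for y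
    using d[OF that] by (simp add: pd_add pd_cmult)
  have "pd j (pdbar k (\<lambda>y. of_real (1 - s) * f y + of_real s * g y)) x
      = pd j (\<lambda>y. of_real (1 - s) * pdbar k f y + of_real s * pdbar k g y) x"
    by (rule pd_cong_open(1)[OF open_V x first])
  also have "\<dots> = of_real (1 - s) * pd j (pdbar k f) x + of_real s * pd j (pdbar k g) x"
    using d[OF x] by (simp add: pd_add pd_cmult)
  finally show ?thesis
    unfolding levi_def eq by (simp add: f_def g_def x_def)
qed

text \<open>
  The Levi form of \<open>\<phi>\<close> is bounded below on unit vectors over the compact supports of the finitely many partition functions, so
  small multiples of \<open>\<mu>\<close> keep it positive there. Every point lies in one of these supports, and positivity in the other charts
  at that point follows by the transformation law.
\<close>

lemma ex_pos_interval:
  assumes \<phi>: "\<phi> \<in> pos_metrics X" and \<mu>: "\<mu> \<in> smooth_functions X"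
  shows "\<exists>e>0. \<forall>s. \<bar>s\<bar> < e \<longrightarrow> shift \<phi> (\<lambda>p. s * \<mu> p) \<in> pos_metrics X"
proof -
  have m: "\<phi> \<in> metrics X" by (rule pos_metrics_metrics[OF \<phi>])
  have m1: "shift \<phi> \<mu> \<in> metrics X" by (rule shift_metrics[OF m \<mu>])
  have ms: "shift \<phi> (\<lambda>p. s * \<mu> p) \<in> metrics X" for s
    by (intro shift_metrics m smooth_functions_cmult \<mu>)
  define q where "q \<phi> i z = Re (\<Sum>j\<in>UNIV. \<Sum>k\<in>UNIV. levi X \<phi> i (chart_inv X i (fst z)) $ j $ k * snd z $ j * cnj (snd z $ k))"
    for \<phi> :: "('z, 'i) weight" and i and z :: "(complex^'n) \<times> (complex^'n)"
  define K where "K i = pou_supp i \<times> sphere (0::complex^'n) 1" for i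
  have qc: "continuous_on (K i) (q \<phi>' i)" if "i \<in> pou_index" "\<phi>' \<in> metrics X" for i \<phi>'
  proof -
    have L: "continuous_on (K i) (\<lambda>z. levi X \<phi>' i (chart_inv X i (fst z)) $ j $ k)" for j k
      by (rule continuous_on_compose2[OF smooth_on_imp_continuous_on[OF smooth_on_levi[OF that(2)]]
            continuous_on_fst[OF continuous_on_id]])
        (use pou_supp_subset[OF that(1)] in \<open>auto simp: K_def\<close>)
    have W: "continuous_on (K i) (\<lambda>z. snd z $ j)" for j by (intro continuous_intros)
    show ?thesis
      unfolding q_def[abs_def]
      by (intro continuous_on_Re continuous_on_sum continuous_on_mult continuous_on_cnj L W)
  qed
  have Kc: "compact (K i)" if "i \<in> pou_index" for i
    unfolding K_def by (intro compact_Times compact_pou_supp that compact_sphere)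
  have "\<exists>e>0. \<forall>s. \<bar>s\<bar> < e \<longrightarrow> (\<forall>z\<in>K i. 0 < (1 - s) * q \<phi> i z + s * q (shift \<phi> \<mu>) i z)" if i: "i \<in> pou_index" for i
  proof -
    have "0 < q \<phi> i z" if "z \<in> K i" for z
    proof -
      have "fst z \<in> V i" "snd z \<noteq> 0" using that pou_supp_subset[OF i] by (auto simp: K_def)
      then have "herm_pos (levi X \<phi> i (chart_inv X i (fst z)))"
        using \<phi> chart_inv_in unfolding pos_metrics_iff by blast
      then show ?thesis using \<open>snd z \<noteq> 0\<close> unfolding herm_pos_def q_def by blast
    qed
    then obtain l where l: "l > 0" "\<And>z. z \<in> K i \<Longrightarrow> l \<le> q \<phi> i z"
      using compact_pos_lower_bound[OF Kc[OF i] qc[OF i m]] by blast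
    have "bounded ((\<lambda>z. q (shift \<phi> \<mu>) i z - q \<phi> i z) ` K i)"
      by (intro compact_imp_bounded compact_continuous_image continuous_intros qc Kc i m m1)
    then obtain B where B: "\<And>z. z \<in> K i \<Longrightarrow> \<bar>q (shift \<phi> \<mu>) i z - q \<phi> i z\<bar> \<le> B" "B > 0"
      unfolding bounded_pos by auto
    show ?thesis
    proof (intro exI[of _ "l / B"] conjI allI impI ballI)
      show "l / B > 0" using l B by simp
      fix s z assume s: "\<bar>s\<bar> < l / B" and z: "z \<in> K i"
      have "\<bar>s * (q (shift \<phi> \<mu>) i z - q \<phi> i z)\<bar> \<le> \<bar>s\<bar> * B"
        unfolding abs_mult using B(1)[OF z] by (intro mult_left_mono) auto
      also have "\<dots> < l" using s B(2) by (simp add: field_simps)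
      finally show "0 < (1 - s) * q \<phi> i z + s * q (shift \<phi> \<mu>) i z"
        using l(2)[OF z] by (simp add: algebra_simps abs_if split: if_splits)
    qed
  qed
  then obtain e where e: "\<And>i. i \<in> pou_index \<Longrightarrow> e i > 0"
    "\<And>i s z. i \<in> pou_index \<Longrightarrow> \<bar>s\<bar> < e i \<Longrightarrow> z \<in> K i \<Longrightarrow> 0 < (1 - s) * q \<phi> i z + s * q (shift \<phi> \<mu>) i z"
    by metis
  define E where "E = Min (insert 1 (e ` pou_index))"
  have E: "E > 0" "\<And>i. i \<in> pou_index \<Longrightarrow> E \<le> e i"
    using finite_pou_index e(1) by (auto simp: E_def)
  show ?thesis
  proof (intro exI[of _ E] conjI allI impI E(1))
    fix s assume s: "\<bar>s\<bar> < E"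
    have "herm_pos (levi X (shift \<phi> (\<lambda>p. s * \<mu> p)) i p)" if p: "p \<in> cdom X i" for i p
    proof -
      have "(\<Sum>j\<in>pou_index. pou j p) \<noteq> 0" using sum_pou by simp
      then obtain j where j: "j \<in> pou_index" "pou j p \<noteq> 0" by (meson sum.neutral)
      have pc: "p \<in> closure {p. pou j p \<noteq> 0}" using j(2) closure_subset[of "{p. pou j p \<noteq> 0}"] by blast
      have pj: "p \<in> cdom X j" using pc closure_pou[OF j(1)] by blast
      have ps: "chart X j p \<in> pou_supp j" unfolding pou_supp_def using pc by (rule imageI)
      have "herm_pos (levi X (shift \<phi> (\<lambda>p. s * \<mu> p)) j p)"
        unfolding herm_pos_def
      proof (intro allI impI)
        fix v :: "complex^'n" assume v: "v \<noteq> 0"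
        define w where "w = (1 / norm v) *\<^sub>R v"
        have "(chart X j p, w) \<in> K j" using ps v by (simp add: K_def w_def)
        then have pos: "0 < (1 - s) * q \<phi> j (chart X j p, w) + s * q (shift \<phi> \<mu>) j (chart X j p, w)"
          using e(2)[OF j(1)] s E(2)[OF j(1)] by simp
        have R: "Re (of_real a * z) = a * Re z" for a z by simp
        have "w $ a = of_real (1 / norm v) * v $ a" for a
          unfolding w_def vector_scaleR_component scaleR_conv_of_real[of _ "v $ a"] ..
        then have vw: "v $ a = of_real (norm v) * w $ a" for a using v by simp
        have "(\<Sum>a\<in>UNIV. \<Sum>b\<in>UNIV. levi X (shift \<phi> (\<lambda>p. s * \<mu> p)) j p $ a $ b * v $ a * cnj (v $ b))
          = of_real ((norm v)\<^sup>2) * (of_real (1 - s) * (\<Sum>a\<in>UNIV. \<Sum>b\<in>UNIV. levi X \<phi> j p $ a $ b * w $ a * cnj (w $ b))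
            + of_real s * (\<Sum>a\<in>UNIV. \<Sum>b\<in>UNIV. levi X (shift \<phi> \<mu>) j p $ a $ b * w $ a * cnj (w $ b)))"
          unfolding levi_shift_scale[OF m \<mu> pj] sum_distrib_left sum.distrib[symmetric]
          by (intro sum.cong refl) (simp add: vw algebra_simps power2_eq_square)
        then have "Re (\<Sum>a\<in>UNIV. \<Sum>b\<in>UNIV. levi X (shift \<phi> (\<lambda>p. s * \<mu> p)) j p $ a $ b * v $ a * cnj (v $ b))
          = (norm v)\<^sup>2 * ((1 - s) * q \<phi> j (chart X j p, w) + s * q (shift \<phi> \<mu>) j (chart X j p, w))"
          by (simp only: q_def fst_conv snd_conv chart_inv_chart[OF pj] plus_complex.sel R)
        then show "0 < Re (\<Sum>a\<in>UNIV. \<Sum>b\<in>UNIV. levi X (shift \<phi> (\<lambda>p. s * \<mu> p)) j p $ a $ b * v $ a * cnj (v $ b))"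
          using pos v by simp
      qed
      then show ?thesis
        using herm_pos_transfer[OF m ms p pj] \<phi> p unfolding pos_metrics_iff by blast
    qed
    then show "shift \<phi> (\<lambda>p. s * \<mu> p) \<in> pos_metrics X" using ms pos_metrics_iff by blast
  qed
qed

lemma curve_velocities:
  assumes t: "t \<in> U" and UJ: "U = {t. Re t \<in> J}" "open U" "\<forall>t\<in>U. \<psi> t = \<psi> (of_real (Re t))"
    and rc: "real_curve J \<phi>0 (\<lambda>s. \<psi> (of_real s)) w1 w2"
  shows "vel \<psi> t = (\<lambda>p. w1 (Re t) p / 2)" "vel_bar \<psi> t = (\<lambda>p. w1 (Re t) p / 2)"
    and "Re (dt (dtbar (\<lambda>\<tau>. of_real (\<psi> \<tau> p))) t) = w2 (Re t) p / 4"
proof -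
  have s: "Re \<tau> \<in> J" if "\<tau> \<in> U" for \<tau> using that UJ(1) by simp
  have eq: "complex_of_real (\<psi> \<tau> p) = of_real (\<psi> (of_real (Re \<tau>)) p)" if "\<tau> \<in> U" for \<tau> p
    using bspec[OF UJ(3) that] by simp
  have d: "dt (\<lambda>\<tau>. of_real (\<psi> \<tau> p)) \<tau> = of_real (w1 (Re \<tau>) p) / 2"
    "dtbar (\<lambda>\<tau>. of_real (\<psi> \<tau> p)) \<tau> = of_real (w1 (Re \<tau>) p) / 2" if "\<tau> \<in> U" for \<tau> p
    using dt_Re_part[OF UJ(2) that eq has_vector_derivative_of_real[OF real_curveD(4)[OF rc s[OF that]]]] by auto
  show "vel \<psi> t = (\<lambda>p. w1 (Re t) p / 2)" "vel_bar \<psi> t = (\<lambda>p. w1 (Re t) p / 2)"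
    unfolding vel_def vel_bar_def by (simp_all add: d[OF t])
  have "((\<lambda>s. complex_of_real (w1 s p) / 2) has_vector_derivative of_real (w2 (Re t) p) / 2) (at (Re t))"
    by (intro has_vector_derivative_divide has_vector_derivative_of_real real_curveD(5)[OF rc s[OF t]])
  from dt_Re_part(1)[where f = "\<lambda>s. of_real (w1 s p) / 2", OF UJ(2) t d(2) this]
  have "dt (dtbar (\<lambda>\<tau>. of_real (\<psi> \<tau> p))) t = of_real (w2 (Re t) p / 4)" by simp
  then show "Re (dt (dtbar (\<lambda>\<tau>. of_real (\<psi> \<tau> p))) t) = w2 (Re t) p / 4"
    by (simp only: Re_complex_of_real)
qed

text \<open>
  The line \<open>\<psi> = 2 Re t \<mu>\<close>; the factor \<open>2\<close> compensates \<open>\<partial>\<^sub>t Re t = 1/2\<close>.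
\<close>

lemma ex_curve_velocity:
  assumes \<phi>: "\<phi> \<in> pos_metrics X" and \<mu>: "\<mu> \<in> smooth_functions X"
  obtains U \<psi> where "curve X U \<phi> \<psi>" "0 \<in> U" "shift \<phi> (\<psi> 0) = \<phi>" "vel \<psi> 0 = \<mu>" "vel_bar \<psi> 0 = \<mu>"
proof -
  obtain e where e: "e > 0" "\<And>s. \<bar>s\<bar> < e \<Longrightarrow> shift \<phi> (\<lambda>p. s * \<mu> p) \<in> pos_metrics X"
    using ex_pos_interval[OF \<phi> \<mu>] by blast
  define J where "J = {- e / 2 <..< e / 2}"
  define U where "U = {t. Re t \<in> J}"
  define \<psi> where "\<psi> t p = 2 * Re t * \<mu> p" for t p
  have U: "open U"
    using open_vimage[OF _ continuous_on_Re[OF continuous_on_id], of J] by (simp add: U_def J_def vimage_def)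
  have curve: "curve X U \<phi> \<psi>"
    unfolding curve_def
  proof (intro conjI allI ballI impI)
    have "open J" "is_interval J" "J \<noteq> {}"
      using e(1) by (auto simp: J_def is_interval_convex_1)
    then show "strip U" unfolding strip_def U_def by blast
    show "\<phi> \<in> metrics X" by (rule pos_metrics_metrics[OF \<phi>])
    show "smooth_on (\<lambda>(t, x). \<psi> t (chart_inv X i x)) (U \<times> V i)" for i
    proof -
      have o: "open (U \<times> V i)" by (intro open_Times U open_V)
      have "smooth_on (\<lambda>z::complex \<times> (complex^'n). \<mu> (chart_inv X i (0 + snd z))) (U \<times> V i)"
        by (rule smooth_on_affine[OF open_V o bounded_linear_snd _ smooth_functionsD[OF \<mu>]]) auto
      moreover have "smooth_on (\<lambda>z::complex \<times> (complex^'n). Re (fst z)) (U \<times> V i)"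
        by (rule smooth_on_linear[OF bounded_linear_compose[OF bounded_linear_Re bounded_linear_fst]])
      ultimately have "smooth_on (\<lambda>z::complex \<times> (complex^'n). 2 * Re (fst z) * \<mu> (chart_inv X i (0 + snd z))) (U \<times> V i)"
        by (intro smooth_on_mult smooth_on_const o)
      then show ?thesis by (simp add: \<psi>_def case_prod_unfold)
    qed
    show "\<psi> t = \<psi> t'" if "Re t = Re t'" for t t' using that by (simp add: \<psi>_def fun_eq_iff)
    show "shift \<phi> (\<psi> t) \<in> pos_metrics X" if "t \<in> U" for t
      using e(2)[of "2 * Re t"] that by (simp add: \<psi>_def[abs_def] U_def J_def abs_if split: if_splits)
  qed
  have 0: "0 \<in> U" using e(1) by (simp add: U_def J_def)
  have d: "((\<lambda>s. of_real (2 * s * \<mu> p) :: complex) has_vector_derivative of_real (2 * \<mu> p)) (at (Re 0))" for p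
    by (intro has_vector_derivative_of_real)
      (auto simp flip: has_real_derivative_iff_has_vector_derivative intro!: derivative_eq_intros)
  have "vel \<psi> 0 = \<mu>" "vel_bar \<psi> 0 = \<mu>"
    unfolding vel_def vel_bar_def
    by (intro ext, subst dt_Re_part[OF open_UNIV UNIV_I _ d]; simp add: \<psi>_def)+
  moreover have "shift \<phi> (\<psi> 0) = \<phi>" by (simp add: shift_def \<psi>_def fun_eq_iff)
  ultimately show ?thesis using that[OF curve 0] by blast
qed

text \<open>
  The chosen differential satisfies the same equation as \<open>D\<close> along a curve with velocity \<open>\<mu>\<close>. The same argument applies to
  the Hessian below.
\<close>

lemma differential_eq:
  assumes D: "has_differential X F \<phi> D" and \<phi>: "\<phi> \<in> pos_metrics X" and \<mu>: "\<mu> \<in> smooth_functions X"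
  shows "differential X F \<phi> \<mu> = D \<mu>"
proof -
  have D': "has_differential X F \<phi> (differential X F \<phi>)"
    unfolding differential_def by (rule someI[of "has_differential X F \<phi>", OF D])
  obtain U \<psi> where c: "curve X U \<phi> \<psi>" "0 \<in> U" "shift \<phi> (\<psi> 0) = \<phi>" "vel \<psi> 0 = \<mu>" "vel_bar \<psi> 0 = \<mu>"
    by (rule ex_curve_velocity[OF \<phi> \<mu>])
  have *: "dt (\<lambda>\<tau>. of_real (F (shift \<phi> (\<psi> \<tau>)))) 0 = of_real (D \<mu>)" if "has_differential X F \<phi> D" for D
  proof -
    have "\<forall>U \<phi>0 \<psi>. \<forall>t\<in>U. curve X U \<phi>0 \<psi> \<longrightarrow> shift \<phi>0 (\<psi> t) = \<phi> \<longrightarrow>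
        dt (\<lambda>\<tau>. of_real (F (shift \<phi>0 (\<psi> \<tau>)))) t = of_real (D (vel \<psi> t))"
      using that unfolding has_differential_def by simp
    from this[rule_format, OF c(2,1,3)] show ?thesis by (simp only: c(4))
  qed
  show ?thesis using *[OF D] *[OF D'] by simp
qed

lemma hessian_eq:
  assumes Q: "has_hessian X F \<phi> Q" and \<phi>: "\<phi> \<in> pos_metrics X" and \<mu>: "\<mu> \<in> smooth_functions X"
  shows "hessian X F \<phi> \<mu> \<mu> = Q \<mu> \<mu>"
proof -
  have Q': "has_hessian X F \<phi> (hessian X F \<phi>)"
    unfolding hessian_def by (rule someI[of "has_hessian X F \<phi>", OF Q])
  obtain U \<psi> where c: "curve X U \<phi> \<psi>" "0 \<in> U" "shift \<phi> (\<psi> 0) = \<phi>" "vel \<psi> 0 = \<mu>" "vel_bar \<psi> 0 = \<mu>"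
    by (rule ex_curve_velocity[OF \<phi> \<mu>])
  have *: "dt (dtbar (\<lambda>\<tau>. of_real (F (shift \<phi> (\<psi> \<tau>))))) 0
      = of_real (differential X F \<phi> (geodesic_c X \<phi> \<psi> 0) + Q \<mu> \<mu>)" if "has_hessian X F \<phi> Q" for Q
  proof -
    have "\<forall>U \<phi>0 \<psi>. \<forall>t\<in>U. curve X U \<phi>0 \<psi> \<longrightarrow> shift \<phi>0 (\<psi> t) = \<phi> \<longrightarrow>
        dt (dtbar (\<lambda>\<tau>. of_real (F (shift \<phi>0 (\<psi> \<tau>))))) t =
          of_real (differential X F \<phi> (geodesic_c X \<phi>0 \<psi> t) + Q (vel \<psi> t) (vel_bar \<psi> t))"
      using that unfolding has_hessian_def by simp
    from this[rule_format, OF c(2,1,3)] show ?thesis by (simp only: c(4,5))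
  qed
  show ?thesis using *[OF Q] *[OF Q'] by simp
qed

section \<open>First and second derivatives in an orthonormal basis\<close>

lemma ip_mult_form_right: "ip X \<phi> u (mult_form \<mu> v) = ip X \<phi> (mult_form \<mu> u) v"
  by (simp add: ip_def mult_form_def mult_ac)

lemma mult_form_mult_form: "mult_form \<mu> (mult_form \<nu> u) = mult_form (\<lambda>p. \<mu> p * \<nu> p) u"
  by (simp add: mult_form_def mult_ac)

lemma ip_mult_form_cnj: "ip X \<phi> (mult_form \<mu> v) u = cnj (ip X \<phi> (mult_form \<mu> u) v)"
  by (subst ip_cnj) (simp add: ip_mult_form_right)

lemma ip_mult_form_real: "ip X \<phi> (mult_form \<mu> u) u = of_real (Re (ip X \<phi> (mult_form \<mu> u) u))"
  using ip_mult_form_cnj[of \<phi> \<mu> u u] by (simp add: complex_eq_iff)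

lemma ip_mult_form_linear:
  assumes "\<phi> \<in> metrics X" "u \<in> n0_forms X" "v \<in> n0_forms X" "\<mu> \<in> smooth_functions X" "\<nu> \<in> smooth_functions X"
  shows "ip X \<phi> (mult_form (\<lambda>p. a * \<mu> p + b * \<nu> p) u) v
    = of_real a * ip X \<phi> (mult_form \<mu> u) v + of_real b * ip X \<phi> (mult_form \<nu> u) v"
proof -
  have "mult_form (\<lambda>p. a * \<mu> p + b * \<nu> p) u = (\<lambda>i p. of_real a * mult_form \<mu> u i p + of_real b * mult_form \<nu> u i p)"
    by (simp add: mult_form_def fun_eq_iff algebra_simps)
  then show ?thesis
    using ip_add_left[OF assms(1) n0_scale[OF n0_mult_form[OF assms(4,2)]] n0_scale[OF n0_mult_form[OF assms(5,2)]] assms(3)]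
    by (simp add: ip_scale_left)
qed

lemma orthonormal_basisD:
  assumes "orthonormal_basis X \<phi> N u"
  shows "is_basis X N u" "j < N \<Longrightarrow> u j \<in> H0 X" "j < N \<Longrightarrow> u j \<in> n0_forms X"
    "j < N \<Longrightarrow> k < N \<Longrightarrow> ip X \<phi> (u j) (u k) = (if j = k then 1 else 0)"
  using assms basis_H0 H0_n0 unfolding orthonormal_basis_def by auto

text \<open>
  For an orthonormal basis \<open>u\<close> at \<open>\<phi>\<close> this is \<open>\<L>'.\<mu>\<close>, the integral of \<open>\<mu>\<close> against the Bergman kernel.
\<close>

definition L_diff :: "nat \<Rightarrow> ('z, 'i) weight \<Rightarrow> (nat \<Rightarrow> ('z, 'i) n0form) \<Rightarrow> ('z \<Rightarrow> real) \<Rightarrow> real" where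
  "L_diff N \<phi> u \<mu> = (\<Sum>j<N. Re (gram1 u \<phi> \<mu> j j))"

text \<open>
  The polarisation in \<open>\<mu>\<close> of the squared norm of the \<open>(n,1)\<close>-form \<open>\<partial>\<mu> \<and> v\<close> (with \<open>\<partial>\<close>-bar).
\<close>

definition grad_ip :: "('z, 'i) weight \<Rightarrow> ('z \<Rightarrow> real) \<Rightarrow> ('z \<Rightarrow> real) \<Rightarrow> ('z, 'i) n0form \<Rightarrow> complex" where
  "grad_ip \<phi> \<mu> \<nu> v = form_integral X (\<lambda>i p.
     of_real (covector_ip (levi X \<phi> i p) (dbar_fun X \<mu> i p) (dbar_fun X \<nu> i p)) *
     (v i p * cnj (v i p) * of_real (exp (- \<phi> i p))))"

text \<open>
  The polarisation in \<open>\<mu>\<close> of \<open>A(\<mu>, v)\<close>: the last two terms are minus the squared norm of the part of \<open>\<mu>v\<close> orthogonal to \<open>H0\<close>,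
  with the projection expanded in the orthonormal basis \<open>u\<close>.
\<close>

definition form_A_polar :: "nat \<Rightarrow> ('z, 'i) weight \<Rightarrow> (nat \<Rightarrow> ('z, 'i) n0form) \<Rightarrow> ('z \<Rightarrow> real) \<Rightarrow> ('z \<Rightarrow> real) \<Rightarrow>
    ('z, 'i) n0form \<Rightarrow> real" where
  "form_A_polar N \<phi> u \<mu> \<nu> v = Re (grad_ip \<phi> \<mu> \<nu> v) - Re (ip X \<phi> (mult_form (\<lambda>p. \<mu> p * \<nu> p) v) v)
     + (\<Sum>k<N. Re (ip X \<phi> (mult_form \<mu> v) (u k) * cnj (ip X \<phi> (mult_form \<nu> v) (u k))))"

definition L_hess :: "nat \<Rightarrow> ('z, 'i) weight \<Rightarrow> (nat \<Rightarrow> ('z, 'i) n0form) \<Rightarrow> ('z \<Rightarrow> real) \<Rightarrow> ('z \<Rightarrow> real) \<Rightarrow> real" where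
  "L_hess N \<phi> u \<mu> \<nu> = (\<Sum>j<N. form_A_polar N \<phi> u \<mu> \<nu> (u j))"

lemma L_diff_linear:
  assumes "\<phi> \<in> metrics X" "orthonormal_basis X \<phi> N u" "\<mu> \<in> smooth_functions X" "\<nu> \<in> smooth_functions X"
  shows "L_diff N \<phi> u (\<lambda>p. a * \<mu> p + b * \<nu> p) = a * L_diff N \<phi> u \<mu> + b * L_diff N \<phi> u \<nu>"
  using orthonormal_basisD(3)[OF assms(2)] assms
  by (simp add: L_diff_def ip_mult_form_linear sum_distrib_left sum.distrib)

text \<open>
  \<open>\<partial>\<close>-bar is linear on smooth functions, and the coefficients are continuous, hence integrable.
\<close>

lemma grad_ip_linear:
  assumes \<phi>: "\<phi> \<in> pos_metrics X" and v: "v \<in> n0_forms X"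
    and s: "\<mu> \<in> smooth_functions X" "\<nu> \<in> smooth_functions X" "\<kappa> \<in> smooth_functions X"
  shows "grad_ip \<phi> (\<lambda>p. a * \<mu> p + b * \<nu> p) \<kappa> v = of_real a * grad_ip \<phi> \<mu> \<kappa> v + of_real b * grad_ip \<phi> \<nu> \<kappa> v"
proof -
  define R where "R \<mu> i p = complex_of_real (covector_ip (levi X \<phi> i p) (dbar_fun X \<mu> i p) (dbar_fun X \<kappa> i p)) *
     (v i p * cnj (v i p) * of_real (exp (- \<phi> i p)))" for \<mu> i p
  have c: "chart_continuous (R \<mu>)" if "\<mu> \<in> smooth_functions X" for \<mu>
    unfolding R_def[abs_def]
    by (intro chart_continuous_mult ip_continuous[OF pos_metrics_metrics[OF \<phi>] v v])
      (auto simp: chart_continuous_def intro!: continuous_intros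
        smooth_on_imp_continuous_on[OF smooth_on_covector_ip[OF \<phi> that s(3)]])
  have d: "dbar_fun X (\<lambda>p. a * \<mu> p + b * \<nu> p) i p $ k = of_real a * dbar_fun X \<mu> i p $ k + of_real b * dbar_fun X \<nu> i p $ k"
    if p: "p \<in> cdom X i" for i p k
  proof -
    have df: "(\<lambda>x. complex_of_real (\<mu> (chart_inv X i x))) differentiable at (chart X i p)"
      if "\<mu> \<in> smooth_functions X" for \<mu>
      by (rule smooth_on_differentiable[OF smooth_on_of_real[OF open_V smooth_functionsD[OF that]]]) (use p in auto)
    show ?thesis
      unfolding dbar_fun_def by (simp add: pd_add pd_cmult df s)
  qed
  have "form_integral X (R (\<lambda>p. a * \<mu> p + b * \<nu> p)) = form_integral X (\<lambda>i p. of_real a * R \<mu> i p + of_real b * R \<nu> i p)"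
    by (rule form_integral_cong) (simp add: R_def covector_ip_left[OF d] algebra_simps)
  also have "\<dots> = of_real a * form_integral X (R \<mu>) + of_real b * form_integral X (R \<nu>)"
    unfolding form_integral_cmult[symmetric]
    by (rule form_integral_add) (intro chart_continuous_mult chart_continuous_const c s)+
  finally show ?thesis unfolding grad_ip_def R_def[abs_def] .
qed

lemma grad_ip_same:
  assumes \<phi>: "\<phi> \<in> pos_metrics X" and \<mu>: "\<mu> \<in> smooth_functions X"
  shows "grad_ip \<phi> \<mu> \<mu> v = ip X \<phi> (mult_form (dbar_sq X \<phi> \<mu>) v) v"
  unfolding grad_ip_def ip_def
  by (rule form_integral_cong) (simp add: covector_ip_same dbar_sq_chart[OF \<phi> \<mu>] mult_form_def mult_ac)

lemma L_hess_commute: "L_hess N \<phi> u \<mu> \<nu> = L_hess N \<phi> u \<nu> \<mu>"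
  unfolding L_hess_def form_A_polar_def grad_ip_def covector_ip_commute[of _ "dbar_fun X \<mu> _ _"]
  by (simp add: mult.commute)

lemma form_A_polar_linear:
  assumes \<phi>: "\<phi> \<in> pos_metrics X" and u: "orthonormal_basis X \<phi> N u" and v: "v \<in> n0_forms X"
    and s: "\<mu> \<in> smooth_functions X" "\<nu> \<in> smooth_functions X" "\<kappa> \<in> smooth_functions X"
  shows "form_A_polar N \<phi> u (\<lambda>p. a * \<mu> p + b * \<nu> p) \<kappa> v
    = a * form_A_polar N \<phi> u \<mu> \<kappa> v + b * form_A_polar N \<phi> u \<nu> \<kappa> v"
proof -
  note m = pos_metrics_metrics[OF \<phi>] and un = orthonormal_basisD(3)[OF u]
  have R: "Re (of_real a * z) = a * Re z" for a z by simp
  have 1: "ip X \<phi> (mult_form (\<lambda>p. (a * \<mu> p + b * \<nu> p) * \<kappa> p) v) v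
      = of_real a * ip X \<phi> (mult_form (\<lambda>p. \<mu> p * \<kappa> p) v) v + of_real b * ip X \<phi> (mult_form (\<lambda>p. \<nu> p * \<kappa> p) v) v"
    using ip_mult_form_linear[OF m v v smooth_functions_mult[OF s(1,3)] smooth_functions_mult[OF s(2,3)], of a b]
    by (simp add: distrib_right mult.assoc)
  define S where "S \<mu> = (\<Sum>k<N. Re (ip X \<phi> (mult_form \<mu> v) (u k) * cnj (ip X \<phi> (mult_form \<kappa> v) (u k))))" for \<mu>
  have "S (\<lambda>p. a * \<mu> p + b * \<nu> p) = a * S \<mu> + b * S \<nu>"
    unfolding S_def sum_distrib_left sum.distrib[symmetric] using un
    by (intro sum.cong refl) (simp add: ip_mult_form_linear[OF m v _ s(1,2)] algebra_simps)
  then show ?thesis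
    unfolding form_A_polar_def S_def[symmetric] 1 grad_ip_linear[OF \<phi> v s] plus_complex.sel R
    by (simp add: algebra_simps)
qed

lemma L_hess_linear:
  assumes "\<phi> \<in> pos_metrics X" and u: "orthonormal_basis X \<phi> N u"
    and "\<mu> \<in> smooth_functions X" "\<nu> \<in> smooth_functions X" "\<kappa> \<in> smooth_functions X"
  shows "L_hess N \<phi> u (\<lambda>p. a * \<mu> p + b * \<nu> p) \<kappa> = a * L_hess N \<phi> u \<mu> \<kappa> + b * L_hess N \<phi> u \<nu> \<kappa>"
  using form_A_polar_linear[OF assms(1) u orthonormal_basisD(3)[OF u] assms(3-5)]
  by (simp add: L_hess_def sum_distrib_left sum.distrib)

lemma functional_L_basis_dt:
  assumes c: "curve X U \<phi>0 \<psi>" and h: "is_basis X N h" and u: "is_basis X N u" and U: "open U" and t: "t \<in> U"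
  shows "dt (L_curve N h \<phi>0 \<psi>) t
       = dt (L_curve N u \<phi>0 \<psi>) t"
    and "dtbar (L_curve N h \<phi>0 \<psi>) t
       = dtbar (L_curve N u \<phi>0 \<psi>) t"
proof -
  obtain C where C: "\<And>\<phi>. \<phi> \<in> metrics X \<Longrightarrow> functional_L X N h \<phi> = functional_L X N u \<phi> + C"
    by (rule functional_L_change_of_basis[OF h u]) blast
  have eqC: "complex_of_real (functional_L X N h (shift \<phi>0 (\<psi> \<tau>))) = of_real (functional_L X N u (shift \<phi>0 (\<psi> \<tau>))) + of_real C"
    if "\<tau> \<in> U" for \<tau>
  proof -
    have "shift \<phi>0 (\<psi> \<tau>) \<in> metrics X" using c that unfolding curve_def pos_metrics_def by blast
    then show ?thesis by (simp add: C)
  qed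
  show "dt (L_curve N h \<phi>0 \<psi>) t
       = dt (L_curve N u \<phi>0 \<psi>) t"
    by (rule dt_add_const(1)[OF U t]) (rule eqC)
  show "dtbar (L_curve N h \<phi>0 \<psi>) t
       = dtbar (L_curve N u \<phi>0 \<psi>) t"
    by (rule dt_add_const(2)[OF U t]) (rule eqC)
qed

lemma log_gram_deriv_orthonormal:
  assumes u: "orthonormal_basis X \<phi> N u" and m: "\<phi> \<in> metrics X"
  shows "log_gram_deriv N u \<phi> \<mu> = (\<Sum>j<N. gram1 u \<phi> \<mu> j j)"
proof -
  have "log_gram_deriv N u \<phi> \<mu> = (\<Sum>i<N. \<Sum>j<N. if j = i then gram1 u \<phi> \<mu> i i else 0)"
    unfolding log_gram_deriv_def
    by (intro sum.cong refl)
      (auto simp: fmat_inv_one[OF gram_det_nz[OF orthonormal_basisD(1)[OF u] m] orthonormal_basisD(4)[OF u]])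
  then show ?thesis by simp
qed

lemma functional_L_has_differential:
  assumes h: "is_basis X N h" and \<phi>: "\<phi> \<in> pos_metrics X" and u: "orthonormal_basis X \<phi> N u"
  shows "has_differential X (functional_L X N h) \<phi> (L_diff N \<phi> u)"
  unfolding has_differential_def
proof (intro conjI ballI allI impI)
  note m = pos_metrics_metrics[OF \<phi>]
  show "L_diff N \<phi> u (\<lambda>p. a * \<mu> p + b * \<nu> p) = a * L_diff N \<phi> u \<mu> + b * L_diff N \<phi> u \<nu>"
    if "\<mu> \<in> smooth_functions X" "\<nu> \<in> smooth_functions X" for \<mu> \<nu> a b
    by (rule L_diff_linear[OF m u that])
  fix U \<phi>0 \<psi> t assume t: "t \<in> U" and c: "curve X U \<phi>0 \<psi>" and eq: "shift \<phi>0 (\<psi> t) = \<phi>"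
  obtain J w1 w2 where UJ: "U = {t. Re t \<in> J}" "open U" "\<forall>t\<in>U. \<psi> t = \<psi> (of_real (Re t))"
    and rc: "real_curve J \<phi>0 (\<lambda>s. \<psi> (of_real s)) w1 w2"
    using curve_real_curve[OF c] by blast
  show "(\<lambda>\<tau>. functional_L X N h (shift \<phi>0 (\<psi> \<tau>))) differentiable (at t)"
    by (rule functional_L_dt(1)[OF h t UJ rc])
  have vs: "gram1 u \<phi> (\<lambda>p. - w1 (Re t) p) j j = - 2 * gram1 u \<phi> (vel \<psi> t) j j" for j
    unfolding curve_velocities(1)[OF t UJ rc] ip_scale_left[symmetric] by (simp add: mult_form_def)
  have "dt (L_curve N h \<phi>0 \<psi>) t
      = - (\<Sum>j<N. gram1 u \<phi> (\<lambda>p. - w1 (Re t) p) j j) / 2"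
    unfolding functional_L_basis_dt(1)[OF c h orthonormal_basisD(1)[OF u] UJ(2) t]
      functional_L_dt(2)[OF orthonormal_basisD(1)[OF u] t UJ rc] eq log_gram_deriv_orthonormal[OF u m] ..
  also have "\<dots> = (\<Sum>j<N. gram1 u \<phi> (vel \<psi> t) j j)"
    unfolding vs sum_distrib_left[symmetric] by simp
  also have "\<dots> = of_real (L_diff N \<phi> u (vel \<psi> t))"
    unfolding L_diff_def of_real_sum by (intro sum.cong refl ip_mult_form_real)
  finally show "dt (L_curve N h \<phi>0 \<psi>) t = of_real (L_diff N \<phi> u (vel \<psi> t))" .
qed

text \<open>
  At a parameter where the basis is orthonormal the second derivative of \<open>ln det G\<close> is
  \<open>tr G'' - tr G' G'\<close>; \<open>\<partial>\<^sub>t\<partial>\<^sub>t\<close>-bar of \<open>\<L>\<close> is \<open>- 1/4\<close> of it. Here \<open>G' = - (\<langle>\<phi>' u\<^sub>i, u\<^sub>j\<rangle>)\<close> gives the squared coefficients of the projection, and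
  \<open>G'' = (\<langle>(\<phi>'\<^sup>2 - \<phi>'') u\<^sub>i, u\<^sub>j\<rangle>)\<close> gives \<open>- \<parallel>\<phi>\<^sub>t u\<^sub>i\<parallel>\<^sup>2\<close> and the part \<open>\<psi>\<^sub>t\<^sub>t\<close> of \<open>c(\<phi>)\<close>; the gradient
  term of \<open>c(\<phi>)\<close> cancels the one in the Hessian.
\<close>

lemma functional_L_second_derivative:
  assumes h: "is_basis X N h" and u: "orthonormal_basis X \<phi> N u"
    and c: "curve X U \<phi>0 \<psi>" and t: "t \<in> U" and eq: "shift \<phi>0 (\<psi> t) = \<phi>"
  shows "dtbar (L_curve N h \<phi>0 \<psi>) differentiable (at t)"
    and "geodesic_c X \<phi>0 \<psi> t \<in> smooth_functions X"
    and "dt (dtbar (L_curve N h \<phi>0 \<psi>)) t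
      = of_real (L_diff N \<phi> u (geodesic_c X \<phi>0 \<psi> t) + L_hess N \<phi> u (vel \<psi> t) (vel \<psi> t))"
proof -
  obtain J w1 w2 where UJ: "U = {t. Re t \<in> J}" "open U" "\<forall>t\<in>U. \<psi> t = \<psi> (of_real (Re t))"
    and rc: "real_curve J \<phi>0 (\<lambda>s. \<psi> (of_real s)) w1 w2"
    using curve_real_curve[OF c] by blast
  have s: "Re t \<in> J" using t UJ(1) by simp
  have eq': "shift \<phi>0 (\<psi> (of_real (Re t))) = \<phi>" using bspec[OF UJ(3) t] eq by simp
  have \<phi>: "\<phi> \<in> pos_metrics X" using c t eq unfolding curve_def by blast
  note m = pos_metrics_metrics[OF \<phi>] and un = orthonormal_basisD(3)[OF u] and ub = orthonormal_basisD(1)[OF u]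
  note velo = curve_velocities[OF t UJ rc]
  define v where "v = vel \<psi> t"
  define a where "a = w2 (Re t)"
  \<comment> \<open>\<open>w1\<close>, \<open>w2\<close> are real derivatives, so \<open>\<phi>\<^sub>t = w1 / 2\<close> and the mixed second derivative is \<open>w2 / 4\<close>.\<close>
  have w1v: "w1 (Re t) p = 2 * v p" for p by (simp add: v_def velo(1))
  have sm: "v \<in> smooth_functions X" "a \<in> smooth_functions X"
  proof -
    have "w1 (Re t) \<in> smooth_functions X" "w2 (Re t) \<in> smooth_functions X"
      using chart_smooth_inD(1) real_curveD(7,8)[OF rc] s by blast+
    then show "v \<in> smooth_functions X" "a \<in> smooth_functions X"
      using smooth_functions_cmult[of "w1 (Re t)" "1/2"] by (simp_all add: v_def velo(1) a_def)
  qed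
  define b where "b = dbar_sq X \<phi> v"
  have b: "b \<in> smooth_functions X" unfolding b_def by (rule dbar_sq_smooth[OF \<phi> sm(1)])
  have geo: "geodesic_c X \<phi>0 \<psi> t = (\<lambda>p. (1 / 4) * a p + (-1) * b p)"
    unfolding geodesic_c_def velo(3) eq by (simp add: a_def b_def v_def)
  show "geodesic_c X \<phi>0 \<psi> t \<in> smooth_functions X"
    unfolding geo by (intro smooth_functions_add smooth_functions_cmult sm b)
  define d where "d = (\<Sum>i<N. \<Sum>j<N. gram1 u \<phi> (\<lambda>p. - w1 (Re t) p) i j * (- gram1 u \<phi> (\<lambda>p. - w1 (Re t) p) j i)
     + gram1 u \<phi> (\<lambda>p. w1 (Re t) p * w1 (Re t) p - w2 (Re t) p) i j * (if j = i then 1 else 0))"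
  have der: "((\<lambda>s. log_gram_deriv N u (shift \<phi>0 (\<psi> (of_real s))) (\<lambda>p. - w1 s p)) has_vector_derivative d) (at (Re t))"
    unfolding log_gram_deriv_def d_def
  proof (intro has_vector_derivative_sum)
    fix i j assume "i \<in> {..<N}" "j \<in> {..<N}"
    then have ij: "i < N" "j < N" by auto
    note G' = gram_derivative(1)[OF rc un un s, unfolded eq']
    have I: "((\<lambda>s. fmat_inv N (gram N u (shift \<phi>0 (\<psi> (of_real s)))) j i) has_vector_derivative
        - gram1 u \<phi> (\<lambda>p. - w1 (Re t) p) j i) (at (Re t))"
      "fmat_inv N (gram N u \<phi>) j i = (if j = i then 1 else 0)"
      using fmat_inv_derivative_at_one[OF real_curveD(1)[OF rc] s, of N "\<lambda>s. gram N u (shift \<phi>0 (\<psi> (of_real s)))"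
          "gram1 u \<phi> (\<lambda>p. - w1 (Re t) p)" j i, unfolded eq', OF gram_det_nz[OF ub pos_metrics_metrics[OF real_curveD(3)[OF rc]]]
          G' orthonormal_basisD(4)[OF u] ij(2) ij(1)]
      by auto
    show "((\<lambda>s. gram1 u (shift \<phi>0 (\<psi> (of_real s))) (\<lambda>p. - w1 s p) i j * fmat_inv N (gram N u (shift \<phi>0 (\<psi> (of_real s)))) j i)
      has_vector_derivative gram1 u \<phi> (\<lambda>p. - w1 (Re t) p) i j * (- gram1 u \<phi> (\<lambda>p. - w1 (Re t) p) j i)
       + gram1 u \<phi> (\<lambda>p. w1 (Re t) p * w1 (Re t) p - w2 (Re t) p) i j * (if j = i then 1 else 0)) (at (Re t))"
      using has_vector_derivative_mult[OF gram_derivative(2)[OF rc un[OF ij(1)] un[OF ij(2)] s] I(1)]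
      unfolding eq' I(2) .
  qed
  note der2 = functional_L_dt_dtbar[OF ub t UJ rc der]
  note basis = functional_L_basis_dt(2)[OF c h ub UJ(2)]
  show "dtbar (L_curve N h \<phi>0 \<psi>) differentiable (at t)"
    using der2(1) basis has_derivative_transform_within_open[OF _ UJ(2) t] unfolding differentiable_def
    by (metis (no_types, lifting))
  have "dt (dtbar (L_curve N h \<phi>0 \<psi>)) t
      = dt (dtbar (L_curve N u \<phi>0 \<psi>)) t"
    by (rule dt_add_const(1)[where c = 0, OF UJ(2) t]) (simp add: basis)
  also have "\<dots> = - d / 4" by (rule der2(2))
  also have "\<dots> = of_real (L_diff N \<phi> u (geodesic_c X \<phi>0 \<psi> t) + L_hess N \<phi> u (vel \<psi> t) (vel \<psi> t))"
  proof -
    have g1: "gram1 u \<phi> (\<lambda>p. - w1 (Re t) p) i j = - 2 * gram1 u \<phi> v i j" for i j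
      unfolding w1v ip_scale_left[symmetric] by (simp add: mult_form_def mult.assoc)
    have g2: "gram1 u \<phi> (\<lambda>p. w1 (Re t) p * w1 (Re t) p - w2 (Re t) p) i i
        = 4 * gram1 u \<phi> (\<lambda>p. v p * v p) i i - gram1 u \<phi> a i i" if i: "i < N" for i
      using ip_mult_form_linear[OF m un[OF i] un[OF i] smooth_functions_mult[OF sm(1,1)] sm(2), of 4 "-1"]
      by (simp add: w1v a_def algebra_simps)
    have g3: "gram1 u \<phi> (geodesic_c X \<phi>0 \<psi> t) i i = gram1 u \<phi> a i i / 4 - gram1 u \<phi> b i i" if i: "i < N" for i
      unfolding geo ip_mult_form_linear[OF m un[OF i] un[OF i] sm(2) b] by simp
    define T where "T i = (\<Sum>j<N. gram1 u \<phi> (\<lambda>p. - w1 (Re t) p) i j * (- gram1 u \<phi> (\<lambda>p. - w1 (Re t) p) j i)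
       + gram1 u \<phi> (\<lambda>p. w1 (Re t) p * w1 (Re t) p - w2 (Re t) p) i j * (if j = i then 1 else 0))" for i
    have dT: "d = (\<Sum>i<N. T i)" unfolding d_def T_def ..
    have "- d / 4 = (\<Sum>i<N. - T i / 4)"
      unfolding dT by (simp add: sum_negf sum_divide_distrib)
    also have "\<dots> = (\<Sum>i<N. gram1 u \<phi> (geodesic_c X \<phi>0 \<psi> t) i i + (grad_ip \<phi> v v (u i)
        - gram1 u \<phi> (\<lambda>p. v p * v p) i i + (\<Sum>j<N. gram1 u \<phi> v i j * cnj (gram1 u \<phi> v i j))))"
    proof (rule sum.cong[OF refl])
      fix i assume "i \<in> {..<N}"
      then have i: "i < N" by simp
      have S: "T i
        = (\<Sum>j<N. - 4 * (gram1 u \<phi> v i j * cnj (gram1 u \<phi> v i j)))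
         + gram1 u \<phi> (\<lambda>p. w1 (Re t) p * w1 (Re t) p - w2 (Re t) p) i i"
        unfolding T_def sum.distrib
      proof (rule arg_cong2[of _ _ _ _ "(+)"])
        show "(\<Sum>j<N. gram1 u \<phi> (\<lambda>p. - w1 (Re t) p) i j * (- gram1 u \<phi> (\<lambda>p. - w1 (Re t) p) j i))
            = (\<Sum>j<N. - 4 * (gram1 u \<phi> v i j * cnj (gram1 u \<phi> v i j)))"
          unfolding g1 ip_mult_form_cnj[of \<phi> v "u _" "u i"] by (intro sum.cong refl) simp
        show "(\<Sum>j<N. gram1 u \<phi> (\<lambda>p. w1 (Re t) p * w1 (Re t) p - w2 (Re t) p) i j * (if j = i then 1 else 0))
            = gram1 u \<phi> (\<lambda>p. w1 (Re t) p * w1 (Re t) p - w2 (Re t) p) i i"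
          using i by (simp add: if_distrib[where f = "\<lambda>c. _ * c"] cong: if_cong)
      qed
      show "- T i / 4
        = gram1 u \<phi> (geodesic_c X \<phi>0 \<psi> t) i i + (grad_ip \<phi> v v (u i)
        - gram1 u \<phi> (\<lambda>p. v p * v p) i i + (\<Sum>j<N. gram1 u \<phi> v i j * cnj (gram1 u \<phi> v i j)))"
        unfolding S g2[OF i] g3[OF i] grad_ip_same[OF \<phi> sm(1)] b_def[symmetric] sum_distrib_left[symmetric]
        by (simp add: diff_divide_distrib add_divide_distrib)
    qed
    also have "\<dots> = of_real (L_diff N \<phi> u (geodesic_c X \<phi>0 \<psi> t) + L_hess N \<phi> u v v)"
    proof -
      have real: "gram1 u \<phi> \<mu> i i = of_real (Re (gram1 u \<phi> \<mu> i i))" for \<mu> i by (rule ip_mult_form_real)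
      have real2: "z * cnj z = of_real (Re (z * cnj z))" for z by (simp add: complex_eq_iff)
      have real3: "grad_ip \<phi> v v (u i) = of_real (Re (grad_ip \<phi> v v (u i)))" for i
        unfolding grad_ip_same[OF \<phi> sm(1)] by (rule ip_mult_form_real)
      show ?thesis
        unfolding L_diff_def L_hess_def form_A_polar_def of_real_add sum.distrib[symmetric] of_real_sum of_real_diff
        by (simp only: real[symmetric] real2[symmetric] real3[symmetric])
    qed
    finally show ?thesis by (simp add: v_def)
  qed
  finally show "dt (dtbar (L_curve N h \<phi>0 \<psi>)) t
      = of_real (L_diff N \<phi> u (geodesic_c X \<phi>0 \<psi> t) + L_hess N \<phi> u (vel \<psi> t) (vel \<psi> t))" .
qed

lemma functional_L_has_hessian:
  assumes h: "is_basis X N h" and \<phi>: "\<phi> \<in> pos_metrics X" and u: "orthonormal_basis X \<phi> N u"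
  shows "has_hessian X (functional_L X N h) \<phi> (L_hess N \<phi> u)"
  unfolding has_hessian_def
proof (intro conjI ballI allI impI)
  show "L_hess N \<phi> u \<mu> \<nu> = L_hess N \<phi> u \<nu> \<mu>" for \<mu> \<nu> by (rule L_hess_commute)
  show "L_hess N \<phi> u (\<lambda>p. a * \<mu> p + b * \<nu> p) \<kappa> = a * L_hess N \<phi> u \<mu> \<kappa> + b * L_hess N \<phi> u \<nu> \<kappa>"
    if "\<mu> \<in> smooth_functions X" "\<nu> \<in> smooth_functions X" "\<kappa> \<in> smooth_functions X" for \<mu> \<nu> \<kappa> a b
    by (rule L_hess_linear[OF \<phi> u that])
  fix U \<phi>0 \<psi> t assume t: "t \<in> U" and c: "curve X U \<phi>0 \<psi>" and eq: "shift \<phi>0 (\<psi> t) = \<phi>"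
  note d2 = functional_L_second_derivative[OF h u c t eq]
  show "dtbar (L_curve N h \<phi>0 \<psi>) differentiable (at t)" by (rule d2(1))
  obtain J w1 w2 where UJ: "U = {t. Re t \<in> J}" "open U" "\<forall>t\<in>U. \<psi> t = \<psi> (of_real (Re t))"
    and rc: "real_curve J \<phi>0 (\<lambda>s. \<psi> (of_real s)) w1 w2"
    using curve_real_curve[OF c] by blast
  have "vel_bar \<psi> t = vel \<psi> t" using curve_velocities[OF t UJ rc] by simp
  then show "dt (dtbar (L_curve N h \<phi>0 \<psi>)) t
      = of_real (differential X (functional_L X N h) \<phi> (geodesic_c X \<phi>0 \<psi> t) + L_hess N \<phi> u (vel \<psi> t) (vel_bar \<psi> t))"
    using d2(3) differential_eq[OF functional_L_has_differential[OF h \<phi> u] \<phi> d2(2)] by simp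
qed

section \<open>The minimal solution and the form \<open>A\<close>\<close>

text \<open>
  Since \<open>v\<close> is holomorphic, \<open>\<partial>\<close>-bar of \<open>\<mu>v\<close> is the given right-hand side, and the other solutions differ from \<open>\<mu>v\<close> by
  holomorphic sections.
\<close>

lemma dbar_solutions_iff:
  assumes \<mu>: "\<mu> \<in> smooth_functions X" and v: "v \<in> H0 X"
  shows "w \<in> dbar_solutions X (dbar_wedge X \<mu> v) \<longleftrightarrow>
    w \<in> n0_forms X \<and> (\<lambda>i p. mult_form \<mu> v i p - w i p) \<in> H0 X"
proof (cases "w \<in> n0_forms X")
  case w: True
  have vn: "v \<in> n0_forms X" by (rule H0_n0[OF v])
  have mn: "mult_form \<mu> v \<in> n0_forms X" by (rule n0_mult_form[OF \<mu> vn])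
  have dm: "(\<lambda>x. complex_of_real (\<mu> (chart_inv X i x))) differentiable at x" if "x \<in> V i" for i x
    by (rule smooth_on_differentiable[OF smooth_on_of_real[OF open_V smooth_functionsD[OF \<mu>]] that])
  have 1: "pdbar k (\<lambda>x. mult_form \<mu> v i (chart_inv X i x)) x = dbar_wedge X \<mu> v i (chart_inv X i x) $ k"
    if x: "x \<in> V i" for i x k
  proof -
    have "pdbar k (\<lambda>x. v i (chart_inv X i x)) x = 0" using v x unfolding H0_iff by blast
    then show ?thesis
      unfolding mult_form_def pd_mult(2)[OF dm[OF x] n0_differentiable[OF vn x]]
      by (simp add: dbar_wedge_def dbar_fun_at[OF x])
  qed
  have 2: "pdbar k (\<lambda>x. mult_form \<mu> v i (chart_inv X i x) - w i (chart_inv X i x)) x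
      = dbar_wedge X \<mu> v i (chart_inv X i x) $ k - pdbar k (\<lambda>x. w i (chart_inv X i x)) x" if x: "x \<in> V i" for i x k
    unfolding pd_diff(2)[OF n0_differentiable[OF mn x] n0_differentiable[OF w x]] 1[OF x] ..
  have "w \<in> dbar_solutions X (dbar_wedge X \<mu> v) \<longleftrightarrow>
      (\<forall>i. \<forall>p\<in>cdom X i. \<forall>k. pdbar k (\<lambda>x. w i (chart_inv X i x)) (chart X i p) = dbar_wedge X \<mu> v i p $ k)"
    unfolding dbar_solutions_def dbar_form_def using w by (simp add: Finite_Cartesian_Product.vec_eq_iff)
  also have "\<dots> \<longleftrightarrow> (\<forall>i. \<forall>x\<in>V i. \<forall>k. pdbar k (\<lambda>x. mult_form \<mu> v i (chart_inv X i x) - w i (chart_inv X i x)) x = 0)"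
    by (auto simp: 2 chart_inv_chart)
  also have "\<dots> \<longleftrightarrow> (\<lambda>i p. mult_form \<mu> v i p - w i p) \<in> H0 X"
    using n0_diff[OF mn w] unfolding H0_iff by blast
  finally show ?thesis using w by blast
qed (simp add: dbar_solutions_def)

text \<open>
  \<open>v0\<close> is \<open>\<mu>v\<close> minus its orthogonal projection to \<open>H0 X\<close>. It is orthogonal to \<open>H0 X\<close>, so by Pythagoras every other solution, which
  differs from it by an element of \<open>H0 X\<close>, is strictly longer.
\<close>

lemma minimal_solution_eq:
  assumes \<phi>: "\<phi> \<in> metrics X" and \<mu>: "\<mu> \<in> smooth_functions X" and v: "v \<in> H0 X"
    and u: "orthonormal_basis X \<phi> N u"
  defines "a \<equiv> \<lambda>k. ip X \<phi> (mult_form \<mu> v) (u k)"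
  defines "v0 \<equiv> \<lambda>i p. mult_form \<mu> v i p - lin_comb N u a i p"
  shows "minimal_solution X \<phi> (dbar_wedge X \<mu> v) = v0"
    and "norm_sq_n0 X \<phi> v0 = Re (ip X \<phi> (mult_form (\<lambda>p. \<mu> p * \<mu> p) v) v) - (\<Sum>k<N. (cmod (a k))\<^sup>2)"
proof -
  note un = orthonormal_basisD(3)[OF u]
  have mn: "mult_form \<mu> v \<in> n0_forms X" by (rule n0_mult_form[OF \<mu> H0_n0[OF v]])
  have PH: "lin_comb N u a \<in> H0 X" by (intro H0_lin_comb orthonormal_basisD(2)[OF u])
  note Pn = H0_n0[OF PH]
  have v0n: "v0 \<in> n0_forms X" unfolding v0_def by (intro n0_diff mn Pn)
  have v0s: "v0 \<in> dbar_solutions X (dbar_wedge X \<mu> v)"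
    unfolding dbar_solutions_iff[OF \<mu> v] using v0n PH by (simp add: v0_def)
  have orth_u: "ip X \<phi> v0 (u l) = 0" if l: "l < N" for l
  proof -
    have "ip X \<phi> v0 (u l) = a l - (\<Sum>k<N. a k * (if k = l then 1 else 0))"
      unfolding v0_def ip_diff_left[OF \<phi> mn Pn un[OF l]] using un l \<phi> orthonormal_basisD(4)[OF u]
      by (simp add: ip_lin_comb_left a_def)
    then show ?thesis using l by (simp add: if_distrib[where f = "\<lambda>c. _ * c"] cong: if_cong)
  qed
  have orth: "ip X \<phi> v0 k = 0" if k: "k \<in> H0 X" for k
  proof -
    obtain c where "k = lin_comb N u c" by (rule basis_expand[OF orthonormal_basisD(1)[OF u] k])
    then show ?thesis using \<phi> v0n un orth_u by (simp add: ip_lin_comb_right)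
  qed
  have pyth: "norm_sq_n0 X \<phi> w = norm_sq_n0 X \<phi> v0 + norm_sq_n0 X \<phi> (\<lambda>i p. w i p - v0 i p)"
    and diff: "(\<lambda>i p. w i p - v0 i p) \<in> H0 X"
    if w: "w \<in> dbar_solutions X (dbar_wedge X \<mu> v)" for w
  proof -
    define k where "k = (\<lambda>i p. w i p - v0 i p)"
    have "(\<lambda>i p. lin_comb N u a i p - (mult_form \<mu> v i p - w i p)) \<in> H0 X"
      using w unfolding dbar_solutions_iff[OF \<mu> v] by (intro H0_diff[OF PH]) auto
    moreover have "(\<lambda>i p. lin_comb N u a i p - (mult_form \<mu> v i p - w i p)) = k"
      by (simp add: k_def v0_def fun_eq_iff)
    ultimately have k: "k \<in> H0 X" by simp
    then show "(\<lambda>i p. w i p - v0 i p) \<in> H0 X" by (simp add: k_def)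
    have wk: "w = (\<lambda>i p. v0 i p + k i p)" by (simp add: k_def fun_eq_iff)
    have kv: "ip X \<phi> k v0 = 0" by (subst ip_cnj) (simp add: orth[OF k])
    have "ip X \<phi> w w = ip X \<phi> v0 v0 + ip X \<phi> k k"
      unfolding wk using \<phi> v0n H0_n0[OF k] n0_add[OF v0n H0_n0[OF k]] orth[OF k] kv
      by (simp add: ip_add_left ip_add_right)
    then show "norm_sq_n0 X \<phi> w = norm_sq_n0 X \<phi> v0 + norm_sq_n0 X \<phi> (\<lambda>i p. w i p - v0 i p)"
      by (simp add: norm_sq_n0_def k_def)
  qed
  show "minimal_solution X \<phi> (dbar_wedge X \<mu> v) = v0"
    unfolding minimal_solution_def
  proof (rule the_equality)
    show "v0 \<in> dbar_solutions X (dbar_wedge X \<mu> v) \<and>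
      (\<forall>w\<in>dbar_solutions X (dbar_wedge X \<mu> v). norm_sq_n0 X \<phi> v0 \<le> norm_sq_n0 X \<phi> w)"
    proof (intro conjI ballI v0s)
      fix w assume w: "w \<in> dbar_solutions X (dbar_wedge X \<mu> v)"
      show "norm_sq_n0 X \<phi> v0 \<le> norm_sq_n0 X \<phi> w"
        using pyth[OF w] norm_sq_n0_nonneg[OF \<phi> H0_n0[OF diff[OF w]]] by simp
    qed
    fix w assume w: "w \<in> dbar_solutions X (dbar_wedge X \<mu> v) \<and>
      (\<forall>w'\<in>dbar_solutions X (dbar_wedge X \<mu> v). norm_sq_n0 X \<phi> w \<le> norm_sq_n0 X \<phi> w')"
    then have "norm_sq_n0 X \<phi> w \<le> norm_sq_n0 X \<phi> v0" using v0s by blast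
    then have "norm_sq_n0 X \<phi> (\<lambda>i p. w i p - v0 i p) = 0"
      using pyth[of w] norm_sq_n0_nonneg[OF \<phi> H0_n0[OF diff[of w]]] w by simp
    then have "(\<lambda>i p. w i p - v0 i p) = (\<lambda>i p. 0)"
      using norm_sq_n0_eq_0[OF \<phi> H0_n0[OF diff[of w]]] w by blast
    then have "w i p - v0 i p = 0" for i p by (simp add: fun_eq_iff)
    then show "w = v0" by (intro ext) simp
  qed
  have "ip X \<phi> v0 v0 = cnj (ip X \<phi> v0 (mult_form \<mu> v)) - ip X \<phi> (lin_comb N u a) v0"
    by (subst (1) v0_def, subst ip_diff_left[OF \<phi> mn Pn v0n], subst (1) ip_cnj, rule refl)
  also have "ip X \<phi> (lin_comb N u a) v0 = 0" by (subst ip_cnj) (simp add: orth[OF PH])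
  also have "ip X \<phi> v0 (mult_form \<mu> v) = ip X \<phi> (mult_form (\<lambda>p. \<mu> p * \<mu> p) v) v - (\<Sum>k<N. a k * cnj (a k))"
  proof -
    have "ip X \<phi> (u k) (mult_form \<mu> v) = cnj (a k)" for k unfolding a_def by (rule ip_cnj)
    then have "ip X \<phi> (lin_comb N u a) (mult_form \<mu> v) = (\<Sum>k<N. a k * cnj (a k))"
      using \<phi> mn un by (simp add: ip_lin_comb_left)
    then show ?thesis
      unfolding v0_def ip_diff_left[OF \<phi> mn Pn mn] by (simp add: ip_mult_form_right mult_form_mult_form)
  qed
  finally show "norm_sq_n0 X \<phi> v0 = Re (ip X \<phi> (mult_form (\<lambda>p. \<mu> p * \<mu> p) v) v) - (\<Sum>k<N. (cmod (a k))\<^sup>2)"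
    unfolding norm_sq_n0_def by (simp add: cmod_power2 flip: power2_eq_square)
qed

text \<open>
  The factor \<open>det (\<phi>\<^sub>j\<^sub>k)\<close> in the volume form cancels against the norm of \<open>dz\<close>; positivity is used to divide by it.
\<close>

lemma norm_sq_n1_dbar_wedge:
  assumes \<phi>: "\<phi> \<in> pos_metrics X"
  shows "norm_sq_n1 X \<phi> (dbar_wedge X \<mu> v) = Re (grad_ip \<phi> \<mu> \<mu> v)"
proof -
  have "of_real (covector_sq (levi X \<phi> i p) (dbar_wedge X \<mu> v i p)) / Determinants.det (levi X \<phi> i p)
        * of_real (exp (- \<phi> i p)) * Determinants.det (levi X \<phi> i p)
      = of_real (covector_ip (levi X \<phi> i p) (dbar_fun X \<mu> i p) (dbar_fun X \<mu> i p)) *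
     (v i p * cnj (v i p) * of_real (exp (- \<phi> i p)))" if p: "p \<in> cdom X i" for i p
  proof -
    have nz: "Determinants.det (levi X \<phi> i p) \<noteq> 0"
      using levi_invertible[OF \<phi> p] by (simp add: invertible_det_nz)
    have "dbar_wedge X \<mu> v i p = (\<chi> k. dbar_fun X \<mu> i p $ k * v i p)" by (simp add: dbar_wedge_def)
    then have "complex_of_real (covector_sq (levi X \<phi> i p) (dbar_wedge X \<mu> v i p))
      = of_real (covector_ip (levi X \<phi> i p) (dbar_fun X \<mu> i p) (dbar_fun X \<mu> i p)) * (v i p * cnj (v i p))"
      by (simp only: covector_sq_scale covector_ip_same of_real_mult complex_norm_square)
    then show ?thesis using nz by simp
  qed
  then show ?thesis
    unfolding norm_sq_n1_def grad_ip_def by (intro arg_cong[of _ _ Re] form_integral_cong)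
qed

lemma form_A_eq_polar:
  assumes \<phi>: "\<phi> \<in> pos_metrics X" and \<mu>: "\<mu> \<in> smooth_functions X" and u: "orthonormal_basis X \<phi> N u" and v: "v \<in> H0 X"
  shows "form_A X \<phi> \<mu> v = form_A_polar N \<phi> u \<mu> \<mu> v"
proof -
  have "(cmod z)\<^sup>2 = Re (z * cnj z)" for z
    using complex_norm_square[of z] by (metis Re_complex_of_real)
  then show ?thesis
    unfolding form_A_polar_def form_A_def norm_sq_n1_dbar_wedge[OF \<phi>]
      minimal_solution_eq[OF pos_metrics_metrics[OF \<phi>] \<mu> v u]
    by simp
qed

lemma L_diff_bergman:
  assumes "\<phi> \<in> metrics X" "orthonormal_basis X \<phi> N u" "\<mu> \<in> smooth_functions X"
  shows "of_real (L_diff N \<phi> u \<mu>) = form_integral X (\<lambda>i p. of_real (\<mu> p) * bergman \<phi> N u i p)"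
proof -
  have "form_integral X (\<lambda>i p. of_real (\<mu> p) * bergman \<phi> N u i p)
      = form_integral X (\<lambda>i p. \<Sum>j<N. mult_form \<mu> (u j) i p * cnj (u j i p) * of_real (exp (- \<phi> i p)))"
    by (simp add: bergman_def mult_form_def sum_distrib_left mult.assoc)
  also have "\<dots> = (\<Sum>j<N. gram1 u \<phi> \<mu> j j)"
    unfolding ip_def
    by (rule form_integral_sum) (intro ip_continuous n0_mult_form assms orthonormal_basisD(3)[OF assms(2)]; simp)
  also have "\<dots> = of_real (L_diff N \<phi> u \<mu>)"
    unfolding L_diff_def of_real_sum by (intro sum.cong refl ip_mult_form_real)
  finally show ?thesis by simp
qed

end

theorem lemma5p1:
  fixes X :: "('z::t2_space, 'n::finite, 'i) line_bundle"
    and N :: nat and h :: "nat \<Rightarrow> ('z, 'i) n0form"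
    and U :: "complex set" and \<phi>0 :: "('z, 'i) weight" and \<psi> :: "complex \<Rightarrow> 'z \<Rightarrow> real"
  assumes "compact (UNIV :: 'z set)" and "complex_manifold X"
    and "positive_line_bundle X"
    and "is_basis X N h"
    and "curve X U \<phi>0 \<psi>"
  shows "(\<forall>t\<in>U. \<forall>u. orthonormal_basis X (shift \<phi>0 (\<psi> t)) N u \<longrightarrow>
            of_real (differential X (functional_L X N h) (shift \<phi>0 (\<psi> t)) (vel \<psi> t)) =
              form_integral X (\<lambda>i p. of_real (vel \<psi> t p) * bergman (shift \<phi>0 (\<psi> t)) N u i p))
       \<and> (\<forall>t\<in>U. dt (dtbar (\<lambda>\<tau>. of_real (functional_L X N h (shift \<phi>0 (\<psi> \<tau>))))) t =
              endo_trace N h (chern_curvature X (\<lambda>\<tau>. shift \<phi>0 (\<psi> \<tau>)) t))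
       \<and> (\<forall>\<phi>\<in>pos_metrics X. \<forall>\<mu>\<in>smooth_functions X. \<forall>u. orthonormal_basis X \<phi> N u \<longrightarrow>
            hessian X (functional_L X N h) \<phi> \<mu> \<mu> = (\<Sum>j<N. form_A X \<phi> \<mu> (u j)))"
proof (intro conjI ballI allI impI)
  interpret compact_line_bundle X
    using assms(1-3) unfolding positive_line_bundle_def by unfold_locales auto
  show "of_real (differential X (functional_L X N h) (shift \<phi>0 (\<psi> t)) (vel \<psi> t)) =
      form_integral X (\<lambda>i p. of_real (vel \<psi> t p) * bergman (shift \<phi>0 (\<psi> t)) N u i p)"
    if t: "t \<in> U" and u: "orthonormal_basis X (shift \<phi>0 (\<psi> t)) N u" for t u
  proof -
    obtain J w1 w2 where UJ: "U = {t. Re t \<in> J}" "open U" "\<forall>t\<in>U. \<psi> t = \<psi> (of_real (Re t))"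
      and rc: "real_curve J \<phi>0 (\<lambda>s. \<psi> (of_real s)) w1 w2"
      using curve_real_curve[OF assms(5)] by blast
    have \<phi>: "shift \<phi>0 (\<psi> t) \<in> pos_metrics X" using assms(5) t unfolding curve_def by blast
    have "w1 (Re t) \<in> smooth_functions X"
      using chart_smooth_inD(1)[OF real_curveD(7)[OF rc]] t UJ(1) by simp
    then have v: "vel \<psi> t \<in> smooth_functions X"
      unfolding curve_velocities(1)[OF t UJ rc] using smooth_functions_cmult[of "w1 (Re t)" "1/2"] by simp
    show ?thesis
      unfolding differential_eq[OF functional_L_has_differential[OF assms(4) \<phi> u] \<phi> v]
      by (rule L_diff_bergman[OF pos_metrics_metrics[OF \<phi>] u v])
  qed
  show "dt (dtbar (\<lambda>\<tau>. of_real (functional_L X N h (shift \<phi>0 (\<psi> \<tau>))))) t =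
      endo_trace N h (chern_curvature X (\<lambda>\<tau>. shift \<phi>0 (\<psi> \<tau>)) t)" if "t \<in> U" for t
    by (rule trace_chern_curvature[OF assms(5,4) that])
  show "hessian X (functional_L X N h) \<phi> \<mu> \<mu> = (\<Sum>j<N. form_A X \<phi> \<mu> (u j))"
    if \<phi>: "\<phi> \<in> pos_metrics X" and \<mu>: "\<mu> \<in> smooth_functions X" and u: "orthonormal_basis X \<phi> N u" for \<phi> \<mu> u
    unfolding hessian_eq[OF functional_L_has_hessian[OF assms(4) \<phi> u] \<phi> \<mu>] L_hess_def
    by (rule sum.cong) (simp_all add: form_A_eq_polar[OF \<phi> \<mu> u orthonormal_basisD(2)[OF u]])
qed

end
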